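(* Let $d>0$ and let $V_0:\mathbb{R}\to\mathbb{R}$ be continuous, even and $d$-periodic. For $t\in[0,d]$ let $L=-\partial_x^2+V(x)$ with $V(x)=V_0(x)$ for $x<0$ and $V(x)=V_0(x+t)$ for $x\ge0$. Consider the semi-infinite gap $G_0=(-\infty,s_1)$. (a) If $V_0$ is strictly increasing on $[0,\frac d2]$, then there is no eigenvalue of $L$ in $G_0$ for $t\in[0,\frac d2]$, and exactly one eigenvalue of $L$ in $G_0$ for $t\in(\frac d2,d)$. (b) If $V_0$ is strictly decreasing on $[0,\frac d2]$, then there is exactly one eigenvalue of $L$ in $G_0$ for $t\in(0,\frac d2)$, and no eigenvalue of $L$ in $G_0$ for $t\in[\frac d2,d]$.
   Context: The operator $L$ (the one-sided dislocation problem) acts in $L^2(\mathbb{R})$ with domain $H^2(\mathbb{R})$; its eigenvalues are called dislocation eigenvalues. Here $s_1=\min\sigma(L_0)$, where $L_0=-\partial_x^2+V_0$ on $\mathbb{R}$. *)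

theory Defs
  imports "HOL-Analysis.Analysis"
begin

text \<open>
  Elements of the complex Hilbert space \<open>L\<^sup>2(\<real>)\<close> are represented by square-integrable functions;
  the identification of functions that agree almost everywhere is made explicit through
  \<open>\<approx>\<close>.
\<close>

definition L2 :: "(real \<Rightarrow> complex) set" where
  "L2 = {u. u \<in> borel_measurable lborel \<and> integrable lborel (\<lambda>x. (cmod (u x))\<^sup>2)}"

definition L2_norm :: "(real \<Rightarrow> complex) \<Rightarrow> real" where
  "L2_norm u = sqrt (LBINT x. (cmod (u x))\<^sup>2)"

definition ae_eq :: "(real \<Rightarrow> complex) \<Rightarrow> (real \<Rightarrow> complex) \<Rightarrow> bool"  (infix "\<approx>" 50) where
  "u \<approx> v \<longleftrightarrow> (AE x in lborel. u x = v x)"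

definition test_functions :: "(real \<Rightarrow> real) set" where
  "test_functions =
     {\<phi>. (\<forall>n x. (deriv ^^ n) \<phi> field_differentiable at x) \<and> compact (closure {x. \<phi> x \<noteq> 0})}"

definition has_weak_deriv :: "nat \<Rightarrow> (real \<Rightarrow> complex) \<Rightarrow> (real \<Rightarrow> complex) \<Rightarrow> bool" where
  "has_weak_deriv k u g \<longleftrightarrow>
     (\<forall>\<phi>\<in>test_functions.
        (LBINT x. (deriv ^^ k) \<phi> x *\<^sub>R u x) = (- 1) ^ k * (LBINT x. \<phi> x *\<^sub>R g x))"

definition sobolev_H :: "nat \<Rightarrow> (real \<Rightarrow> complex) set" where
  "sobolev_H m = {u \<in> L2. \<forall>k\<le>m. \<exists>g\<in>L2. has_weak_deriv k u g}"

text \<open>The weak derivative is only unique almost everywhere; an arbitrary representative is chosen.\<close>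

definition weak_deriv :: "nat \<Rightarrow> (real \<Rightarrow> complex) \<Rightarrow> (real \<Rightarrow> complex)" where
  "weak_deriv k u = (SOME g. g \<in> L2 \<and> has_weak_deriv k u g)"

text \<open>
  An unbounded operator in \<open>L\<^sup>2(\<real>)\<close> is given by its domain \<open>D\<close> and its action \<open>T\<close> on
  representatives. The resolvent set consists of those \<open>z\<close> for which \<open>T - z\<close> is a bijection
  from \<open>D\<close> onto \<open>L\<^sup>2(\<real>)\<close> (modulo \<open>\<approx>\<close>) with bounded inverse.
\<close>

definition resolvent_set ::
    "(real \<Rightarrow> complex) set \<Rightarrow> ((real \<Rightarrow> complex) \<Rightarrow> (real \<Rightarrow> complex)) \<Rightarrow> complex set" where
  "resolvent_set D T =
     {z. (\<forall>f\<in>L2. \<exists>u\<in>D. (\<lambda>x. T u x - z * u x) \<approx> f) \<and>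
         (\<forall>u\<in>D. \<forall>v\<in>D. (\<lambda>x. T u x - z * u x) \<approx> (\<lambda>x. T v x - z * v x) \<longrightarrow> u \<approx> v) \<and>
         (\<exists>C. \<forall>u\<in>D. L2_norm u \<le> C * L2_norm (\<lambda>x. T u x - z * u x))}"

definition spectrum ::
    "(real \<Rightarrow> complex) set \<Rightarrow> ((real \<Rightarrow> complex) \<Rightarrow> (real \<Rightarrow> complex)) \<Rightarrow> complex set" where
  "spectrum D T = - resolvent_set D T"

definition eigenvalues ::
    "(real \<Rightarrow> complex) set \<Rightarrow> ((real \<Rightarrow> complex) \<Rightarrow> (real \<Rightarrow> complex)) \<Rightarrow> complex set" where
  "eigenvalues D T = {z. \<exists>u\<in>D. \<not> u \<approx> (\<lambda>x. 0) \<and> T u \<approx> (\<lambda>x. z * u x)}"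

text \<open>The operator \<open>-\<partial>\<^sub>x\<^sup>2 + V\<close>, to be taken with domain \<^term>\<open>sobolev_H 2\<close>.\<close>

definition schroedinger :: "(real \<Rightarrow> real) \<Rightarrow> (real \<Rightarrow> complex) \<Rightarrow> (real \<Rightarrow> complex)" where
  "schroedinger V u = (\<lambda>x. - weak_deriv 2 u x + complex_of_real (V x) * u x)"

definition dislocated :: "(real \<Rightarrow> real) \<Rightarrow> real \<Rightarrow> (real \<Rightarrow> real)" where
  "dislocated V\<^sub>0 t = (\<lambda>x. if x < 0 then V\<^sub>0 x else V\<^sub>0 (x + t))"

definition dislocation_eigenvalues :: "(real \<Rightarrow> real) \<Rightarrow> real \<Rightarrow> complex set" where
  "dislocation_eigenvalues V\<^sub>0 t = eigenvalues (sobolev_H 2) (schroedinger (dislocated V\<^sub>0 t))"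

text \<open>The minimum of the (real) spectrum of the periodic operator \<open>-\<partial>\<^sub>x\<^sup>2 + V\<^sub>0\<close>.\<close>

definition spectrum_min :: "(real \<Rightarrow> real) \<Rightarrow> real" where
  "spectrum_min V\<^sub>0 =
     (LEAST s. complex_of_real s \<in> spectrum (sobolev_H 2) (schroedinger V\<^sub>0))"

definition semi_infinite_gap :: "(real \<Rightarrow> real) \<Rightarrow> complex set" where
  "semi_infinite_gap V\<^sub>0 = complex_of_real ` {..<spectrum_min V\<^sub>0}"

end

theory Submission
  imports Defs
begin

text \<open>
  The proof turns the eigenvalue problem into a scalar equation for logarithmic derivatives of
  decaying solutions. Put \<open>h = d/2\<close> and let \<open>c\<close>, \<open>s\<close> be the even and odd solutions of
  \<open>u'' = (V - l) u\<close> with \<open>c 0 = s' 0 = 1\<close>. Let \<open>bottom\<close> be the largest \<open>l\<close> for which \<open>c > 0\<close> on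
  \<open>[0, h]\<close> and \<open>c' h \<ge> 0\<close>. At \<open>l = bottom\<close> the condition \<open>c' h = 0\<close> holds, so \<open>c\<close> is symmetric
  about \<open>0\<close> and about \<open>h\<close>, hence \<open>d\<close>-periodic: it is the positive ground state \<open>p\<close>. For
  \<open>l < bottom\<close> the combination \<open>psi = c - kappa s\<close> with
  \<open>kappa\<^sup>2 = c h c' h / (s h s' h)\<close> is a positive solution with \<open>psi (x + d) = rho psi x\<close>
  and \<open>rho < 1\<close>: comparing the values at \<open>-h\<close> and \<open>h\<close> is enough, because evenness expresses both by
  the same four numbers.

  The number \<open>bottom\<close> is the minimum \<open>s\<^sub>1\<close> of the periodic spectrum (\<open>spectrum_min_eq\<close>). Below it,
  \<open>m = psi' / psi\<close> solves the Riccati equation \<open>m' = V - l - m\<^sup>2\<close> and the operator factorises,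
  \<open>-D\<^sup>2 + V - l = (-D - m) (D - m)\<close>. Multiplying by a periodic factor turns each first-order
  factor into one with a constant non-zero coefficient, which is inverted on \<open>L\<^sup>2\<close> by convolution with
  an exponential. At \<open>bottom\<close> itself the functions \<open>p / (1 + (e x)\<^sup>2)\<close> satisfy
  \<open>|(L - bottom) u| \<le> M e |u|\<close> pointwise, so no bounded inverse exists.

  For the dislocated operator, an eigenfunction at \<open>l < bottom\<close> must be a multiple of \<open>psi (x + t)\<close> on
  the right and of \<open>psi (-x)\<close> on the left, so \<open>l\<close> is an eigenvalue exactly if \<open>m 0 + m t = 0\<close>. A
  Wronskian argument over one period shows that \<open>m\<close> increases strictly with \<open>l\<close>
  (\<open>log_deriv_strict_mono\<close>), and \<open>m < 0\<close> once \<open>l\<close> lies below the potential. At \<open>l = bottom\<close> one has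
  \<open>m 0 + m t = p' t / p t\<close>. By the intermediate value theorem the gap contains one
  eigenvalue if \<open>p' t > 0\<close> and none otherwise. Finally \<open>p' 0 = p' h = 0\<close> and \<open>p'' = (V - bottom) p\<close>,
  so for monotone \<open>V\<close> on \<open>[0, h]\<close> the derivative \<open>p'\<close> has one strict sign on \<open>(0, h)\<close> and, by symmetry
  about \<open>h\<close>, the opposite one on \<open>(h, d)\<close>.

  Weak derivatives enter only through \<open>wderiv\<close>, which allows continuously differentiable test functions
  and therefore multiplication by the Floquet factors. The lemma of du Bois-Reymond shows that it
  agrees with the notion defined by smooth test functions.
\<close>

section \<open>Linear differential equations of second order\<close>

lemma antiderivative_exists:
  fixes g :: "real \<Rightarrow> 'a::euclidean_space"
  assumes "continuous_on UNIV g"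
  obtains G where "\<And>x. (G has_vector_derivative g x) (at x)" "G a = c"
proof -
  have "\<exists>F. \<forall>x::real. (-\<infinity>::ereal) < x \<longrightarrow> x < (\<infinity>::ereal) \<longrightarrow> (F has_vector_derivative g x) (at x)"
    using assms by (intro einterval_antiderivative) (auto simp: continuous_on_eq_continuous_at)
  then obtain F where F: "\<And>x. (F has_vector_derivative g x) (at x)"
    by auto
  show ?thesis
  proof (rule that[of "\<lambda>x. F x - F a + c"])
    show "((\<lambda>x. F x - F a + c) has_vector_derivative g x) (at x)" for x
      by (auto intro!: derivative_eq_intros F)
  qed simp
qed

definition primitive :: "(real \<Rightarrow> real) \<Rightarrow> real \<Rightarrow> real" where
  "primitive g = (SOME G. (\<forall>x. (G has_real_derivative g x) (at x)) \<and> G 0 = 0)"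

lemma primitive:
  assumes "continuous_on UNIV g"
  shows "(primitive g has_real_derivative g x) (at x)" "primitive g 0 = 0"
proof -
  have "\<exists>G. (\<forall>x. (G has_real_derivative g x) (at x)) \<and> G 0 = 0"
    using antiderivative_exists[OF assms, of 0 0]
    by (auto simp: has_real_derivative_iff_has_vector_derivative)
  from someI_ex[OF this] show "(primitive g has_real_derivative g x) (at x)" "primitive g 0 = 0"
    by (auto simp: primitive_def)
qed

text \<open>
  The comparison function \<open>M (K x)^(n + 1) / (n + 1)!\<close> has the bound on
  \<open>g\<close> as its derivative; the factor \<open>K\<close> in the hypothesis is the one
  that differentiation produces.
\<close>

lemma primitive_bound_nonneg:
  fixes g G :: "real \<Rightarrow> real"
  assumes G: "\<And>x. (G has_real_derivative g x) (at x)" "G 0 = 0"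
    and g: "\<And>x. x \<ge> 0 \<Longrightarrow> \<bar>g x\<bar> \<le> K * (M * (K * x) ^ n / fact n)"
    and x: "x \<ge> 0"
  shows "\<bar>G x\<bar> \<le> M * (K * x) ^ Suc n / fact (Suc n)"
proof -
  define H where "H x = M * (K * x) ^ Suc n / fact (Suc n)" for x
  have H: "(H has_real_derivative K * (M * (K * x) ^ n / fact n)) (at x)" for x
  proof -
    have "(H has_real_derivative M * (real (Suc n) * K * (K * x) ^ n) / fact (Suc n)) (at x)"
      unfolding H_def
      by (rule derivative_eq_intros refl | simp del: power_Suc of_nat_Suc)+
    also have "M * (real (Suc n) * K * (K * x) ^ n) / fact (Suc n) = K * (M * (K * x) ^ n / fact n)"
      by (simp del: of_nat_Suc add: divide_simps)
    finally show ?thesis .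
  qed
  have "H 0 - G 0 \<le> H x - G x"
  proof (rule DERIV_nonneg_imp_nondecreasing[OF x])
    fix y assume "0 \<le> y" "y \<le> x"
    then show "\<exists>z. ((\<lambda>x. H x - G x) has_real_derivative z) (at y) \<and> 0 \<le> z"
      using g[of y] by (intro exI[of _ "K * (M * (K * y) ^ n / fact n) - g y"] conjI DERIV_diff G H) auto
  qed
  moreover have "H 0 + G 0 \<le> H x + G x"
  proof (rule DERIV_nonneg_imp_nondecreasing[OF x])
    fix y assume "0 \<le> y" "y \<le> x"
    then show "\<exists>z. ((\<lambda>x. H x + G x) has_real_derivative z) (at y) \<and> 0 \<le> z"
      using g[of y] by (intro exI[of _ "K * (M * (K * y) ^ n / fact n) + g y"] conjI DERIV_add G H) auto
  qed
  moreover have "H 0 = 0" by (simp add: H_def)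
  ultimately show ?thesis using G(2) by (simp add: H_def)
qed

lemma primitive_bound:
  fixes g G :: "real \<Rightarrow> real"
  assumes G: "\<And>x. (G has_real_derivative g x) (at x)" "G 0 = 0"
    and g: "\<And>x. \<bar>g x\<bar> \<le> K * (M * (K * \<bar>x\<bar>) ^ n / fact n)"
  shows "\<bar>G x\<bar> \<le> M * (K * \<bar>x\<bar>) ^ Suc n / fact (Suc n)"
proof (cases "x \<ge> 0")
  case True
  have "\<bar>g x\<bar> \<le> K * (M * (K * x) ^ n / fact n)" if "x \<ge> 0" for x
    using g[of x] that by simp
  from primitive_bound_nonneg[OF G this True] True show ?thesis by simp
next
  case False
  have "((\<lambda>x. - G (- x)) has_real_derivative g (- x)) (at x)" for x
    by (auto intro!: derivative_eq_intros DERIV_chain'[where f="\<lambda>x. -x" and g=G, OF _ G(1)])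
  moreover have "\<bar>g (- x)\<bar> \<le> K * (M * (K * x) ^ n / fact n)" if "x \<ge> 0" for x
    using g[of "- x"] that by simp
  ultimately have "\<bar>- G (- (- x))\<bar> \<le> M * (K * (- x)) ^ Suc n / fact (Suc n)"
    using False by (intro primitive_bound_nonneg[where G = "\<lambda>x. - G (- x)" and g="\<lambda>x. g (- x)"]) (auto simp: G)
  then show ?thesis using False by simp
qed

text \<open>
  Picard iteration for the first-order system \<open>u' = w\<close>, \<open>w' = q u\<close>:
  entry \<open>n\<close> is the \<open>n\<close>-th term of the resulting series, not its partial
  sum.
\<close>

primrec picard :: "(real \<Rightarrow> real) \<Rightarrow> real \<Rightarrow> real \<Rightarrow> nat \<Rightarrow> (real \<Rightarrow> real) \<times> (real \<Rightarrow> real)" where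
  "picard q a b 0 = (\<lambda>_. a, \<lambda>_. b)"
| "picard q a b (Suc n) =
     (primitive (snd (picard q a b n)), primitive (\<lambda>x. q x * fst (picard q a b n) x))"

text \<open>
  The terms of the Picard series are dominated by those of an exponential series, so the series
  and its derivative converge uniformly on bounded intervals and may be differentiated termwise.
\<close>

lemma linear_ode_exists:
  fixes q :: "real \<Rightarrow> real"
  assumes q: "continuous_on UNIV q" and Q: "\<And>x. \<bar>q x\<bar> \<le> Q"
  obtains u w where "\<And>x. (u has_real_derivative w x) (at x)"
    "\<And>x. (w has_real_derivative q x * u x) (at x)" "u 0 = a" "w 0 = b"
proof -
  define f where "f n = fst (picard q a b n)" for n
  define g where "g n = snd (picard q a b n)" for n
  define K where "K = max 1 Q"
  define M where "M = max \<bar>a\<bar> \<bar>b\<bar>"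
  have K: "K \<ge> 1" "Q \<le> K" and M: "M \<ge> 0" by (auto simp: K_def M_def)
  have cont: "continuous_on UNIV (f n) \<and> continuous_on UNIV (g n)" for n
  proof (induction n)
    case 0
    show ?case by (simp add: f_def g_def)
  next
    case (Suc n)
    have "continuous_on UNIV (\<lambda>x. q x * f n x)" using Suc q by (intro continuous_intros) auto
    then show ?case using Suc
      by (auto simp: f_def g_def intro!: DERIV_continuous_on DERIV_subset[OF primitive(1)])
  qed
  have contq: "continuous_on UNIV (\<lambda>x. q x * f n x)" for n
    using cont q by (intro continuous_intros) auto
  have f': "(f (Suc n) has_real_derivative g n x) (at x)" "f (Suc n) 0 = 0"
   and g': "(g (Suc n) has_real_derivative q x * f n x) (at x)" "g (Suc n) 0 = 0" for n x
    using primitive[of "g n"] primitive[OF contq[of n]] cont[of n] by (auto simp: f_def g_def)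
  have bound: "(\<forall>x. \<bar>f n x\<bar> \<le> M * (K * \<bar>x\<bar>) ^ n / fact n) \<and> (\<forall>x. \<bar>g n x\<bar> \<le> M * (K * \<bar>x\<bar>) ^ n / fact n)" for n
  proof (induction n)
    case 0
    show ?case by (simp add: f_def g_def M_def)
  next
    case (Suc n)
    have nn: "0 \<le> M * (K * \<bar>x\<bar>) ^ n / fact n" for x using M K by auto
    have "\<bar>g n x\<bar> \<le> K * (M * (K * \<bar>x\<bar>) ^ n / fact n)" for x
      using Suc mult_right_mono[OF K(1) nn[of x]] by (smt (verit, best) mult_1)
    moreover have "\<bar>q x * f n x\<bar> \<le> K * (M * (K * \<bar>x\<bar>) ^ n / fact n)" for x
      unfolding abs_mult using Suc Q[of x] K by (intro mult_mono) auto
    ultimately show ?case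
      using primitive_bound[OF f'[of n]] primitive_bound[OF g'[of n]] by blast
  qed
  have unif: "uniformly_convergent_on {-R..R} (\<lambda>n x. \<Sum>i<n. g i x)"
      "uniformly_convergent_on {-R..R} (\<lambda>n x. \<Sum>i<n. q x * f i x)"
      "x \<in> {-R..R} \<Longrightarrow> summable (\<lambda>n. f n x)"
      "x \<in> {-R..R} \<Longrightarrow> summable (\<lambda>n. g n x)" if R: "R \<ge> 0" for R x
  proof -
    have sm: "summable (\<lambda>n. M * (K * R) ^ n / fact n)"
      using summable_mult[OF summable_exp[of "K * R"], of M] by (simp add: field_simps)
    have le: "M * (K * \<bar>x\<bar>) ^ n / fact n \<le> M * (K * R) ^ n / fact n" if "x \<in> {-R..R}" for n x
      using that K M by (intro divide_right_mono mult_left_mono power_mono) auto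
    have bd: "\<bar>f n x\<bar> \<le> M * (K * R) ^ n / fact n" "\<bar>g n x\<bar> \<le> M * (K * R) ^ n / fact n"
      if "x \<in> {-R..R}" for n x
      using bound le[OF that] order_trans by blast+
    show "uniformly_convergent_on {-R..R} (\<lambda>n x. \<Sum>i<n. g i x)"
      by (rule Weierstrass_m_test'[OF _ sm]) (use bd in simp)
    have sm2: "summable (\<lambda>n. K * (M * (K * R) ^ n / fact n))" by (rule summable_mult[OF sm])
    show "uniformly_convergent_on {-R..R} (\<lambda>n x. \<Sum>i<n. q x * f i x)"
    proof (rule Weierstrass_m_test'[OF _ sm2])
      fix n x assume "x \<in> {-R..R}"
      then show "norm (q x * f n x) \<le> K * (M * (K * R) ^ n / fact n)"
        unfolding real_norm_def abs_mult using Q[of x] K bd[of x n] by (intro mult_mono) auto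
    qed
    show "summable (\<lambda>n. f n x)" if "x \<in> {-R..R}"
      by (rule summable_comparison_test'[OF sm, of 0]) (use bd[OF that] in simp)
    show "summable (\<lambda>n. g n x)" if "x \<in> {-R..R}"
      by (rule summable_comparison_test'[OF sm, of 0]) (use bd[OF that] in simp)
  qed
  define u where "u x = (\<Sum>n. f n x)" for x
  define w where "w x = (\<Sum>n. g n x)" for x
  have sf: "summable (\<lambda>n. f n x)" and sg: "summable (\<lambda>n. g n x)" for x
  proof -
    have "x \<in> {- \<bar>x\<bar>..\<bar>x\<bar>}" unfolding atLeastAtMost_iff by linarith
    from unif(3)[OF abs_ge_zero this] unif(4)[OF abs_ge_zero this]
    show "summable (\<lambda>n. f n x)" "summable (\<lambda>n. g n x)" .
  qed
  show ?thesis
  proof (rule that)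
    fix x :: real
    define R where "R = \<bar>x\<bar> + 1"
    have R: "R \<ge> 0" "x \<in> {-R<..<R}" "interior {-R..R} = {-R<..<R}" by (auto simp: R_def)
    have "((\<lambda>x. \<Sum>n. f (Suc n) x) has_real_derivative (\<Sum>n. g n x)) (at x)"
      by (rule has_field_derivative_series'(2)[where S = "{-R..R}" and ?x0.0 = 0])
         (use R unif f' in \<open>auto intro!: DERIV_subset[OF f'(1)] simp: f'\<close>)
    then have "((\<lambda>x. (\<Sum>n. f (Suc n) x) + a) has_real_derivative w x) (at x)"
      by (auto intro!: derivative_eq_intros simp: w_def)
    moreover have "(\<lambda>x. (\<Sum>n. f (Suc n) x) + a) = u"
      by (rule ext) (use suminf_split_head[OF sf] in \<open>auto simp: u_def f_def\<close>)
    ultimately show "(u has_real_derivative w x) (at x)" by simp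
    have "((\<lambda>x. \<Sum>n. g (Suc n) x) has_real_derivative (\<Sum>n. q x * f n x)) (at x)"
      by (rule has_field_derivative_series'(2)[where S = "{-R..R}" and ?x0.0 = 0])
         (use R unif g' in \<open>auto intro!: DERIV_subset[OF g'(1)] simp: g'\<close>)
    moreover have "(\<Sum>n. q x * f n x) = q x * u x"
      unfolding u_def by (rule suminf_mult[OF sf])
    ultimately have "((\<lambda>x. (\<Sum>n. g (Suc n) x) + b) has_real_derivative q x * u x) (at x)"
      by (auto intro!: derivative_eq_intros)
    moreover have "(\<lambda>x. (\<Sum>n. g (Suc n) x) + b) = w"
      by (rule ext) (use suminf_split_head[OF sg] in \<open>auto simp: w_def g_def\<close>)
    ultimately show "(w has_real_derivative q x * u x) (at x)" by simp
  next
    show "u 0 = a" "w 0 = b"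
      using suminf_split_head[OF sf, of 0] suminf_split_head[OF sg, of 0] f'(2) g'(2)
      by (auto simp: u_def w_def f_def g_def)
  qed
qed

text \<open>
  A Gronwall estimate for the energy \<open>D\<^sup>2 + E\<^sup>2\<close> of an inhomogeneous
  equation. With \<open>r = 0\<close> it gives uniqueness; with \<open>r\<close> the effect of a
  changed spectral parameter it gives continuous dependence on that parameter.
\<close>

lemma gronwall_square:
  fixes D E q r :: "real \<Rightarrow> real"
  assumes D: "\<And>x. (D has_real_derivative E x) (at x)"
    and E: "\<And>x. (E has_real_derivative q x * D x + r x) (at x)"
    and q: "\<And>x. \<bar>q x\<bar> \<le> Q"
    and r: "\<And>x. 0 \<le> x \<Longrightarrow> x \<le> X \<Longrightarrow> \<bar>r x\<bar> \<le> R"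
    and x: "0 \<le> x" "x \<le> X"
  shows "(D x)\<^sup>2 + (E x)\<^sup>2 \<le> exp ((Q + 2) * x) * ((D 0)\<^sup>2 + (E 0)\<^sup>2 + R\<^sup>2)"
proof -
  define K where "K = Q + 2"
  have K: "K \<ge> 2" using q[of 0] by (simp add: K_def)
  define N where "N x = (D x)\<^sup>2 + (E x)\<^sup>2" for x
  define H where "H x = exp (- K * x) * (N x + R\<^sup>2)" for x
  have "H x \<le> H 0"
  proof (rule DERIV_nonpos_imp_nonincreasing[OF x(1)])
    fix y assume y: "0 \<le> y" "y \<le> x"
    define z where "z = 2 * D y * E y + 2 * E y * (q y * D y + r y)"
    have "(H has_real_derivative exp (- K * y) * (z - K * (N y + R\<^sup>2))) (at y)"
      unfolding H_def N_def z_def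
      by (auto intro!: derivative_eq_intros D E simp: algebra_simps)
    moreover have "z \<le> K * (N y + R\<^sup>2)"
    proof -
      have s: "2 * \<bar>D y\<bar> * \<bar>E y\<bar> \<le> N y"
        using sum_squares_bound[of "\<bar>D y\<bar>" "\<bar>E y\<bar>"] by (simp add: N_def)
      have "z \<le> (1 + \<bar>q y\<bar>) * (2 * \<bar>D y\<bar> * \<bar>E y\<bar>) + 2 * \<bar>E y\<bar> * \<bar>r y\<bar>"
      proof -
        have "D y * E y \<le> \<bar>D y\<bar> * \<bar>E y\<bar>" "E y * r y \<le> \<bar>E y\<bar> * \<bar>r y\<bar>" 
          "q y * (D y * E y) \<le> \<bar>q y\<bar> * (\<bar>D y\<bar> * \<bar>E y\<bar>)"
          by (metis abs_ge_self abs_mult)+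
        then show ?thesis by (simp add: z_def algebra_simps)
      qed
      also have "\<dots> \<le> (1 + Q) * N y + ((E y)\<^sup>2 + R\<^sup>2)"
      proof (intro add_mono mult_mono s)
        have "2 * \<bar>E y\<bar> * \<bar>r y\<bar> \<le> \<bar>E y\<bar>\<^sup>2 + \<bar>r y\<bar>\<^sup>2" by (rule sum_squares_bound)
        moreover have "\<bar>r y\<bar>\<^sup>2 \<le> R\<^sup>2" using r[of y] y x by (intro power_mono) auto
        ultimately show "2 * \<bar>E y\<bar> * \<bar>r y\<bar> \<le> (E y)\<^sup>2 + R\<^sup>2" by simp
      qed (use q[of y] in auto)
      also have "\<dots> \<le> (1 + Q) * N y + (N y + R\<^sup>2)" by (simp add: N_def)
      also have "\<dots> \<le> K * (N y + R\<^sup>2)"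
      proof -
        have "1 * R\<^sup>2 \<le> K * R\<^sup>2" using K by (intro mult_right_mono) auto
        then show ?thesis by (simp add: K_def algebra_simps)
      qed
      finally show ?thesis .
    qed
    ultimately show "\<exists>z. (H has_real_derivative z) (at y) \<and> z \<le> 0"
      by (intro exI[of _ "exp (- K * y) * (z - K * (N y + R\<^sup>2))"]) (auto simp: mult_le_0_iff)
  qed
  then have "exp (K * x) * H x \<le> exp (K * x) * H 0" by simp
  moreover have "exp (K * x) * H x = N x + R\<^sup>2"
    by (simp add: H_def exp_minus field_simps)
  moreover have "H 0 = N 0 + R\<^sup>2" by (simp add: H_def)
  ultimately have "N x + R\<^sup>2 \<le> exp (K * x) * (N 0 + R\<^sup>2)" by simp
  then show ?thesis unfolding N_def K_def by (smt (verit) zero_le_power2)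
qed

definition ode_solution :: "(real \<Rightarrow> real) \<Rightarrow> (real \<Rightarrow> real) \<Rightarrow> (real \<Rightarrow> real) \<Rightarrow> bool" where
  "ode_solution q u w \<longleftrightarrow>
     (\<forall>x. (u has_real_derivative w x) (at x)) \<and> (\<forall>x. (w has_real_derivative q x * u x) (at x))"

lemma ode_solution_D:
  assumes "ode_solution q u w"
  shows "(u has_real_derivative w x) (at x)" "(w has_real_derivative q x * u x) (at x)"
  using assms by (auto simp: ode_solution_def)

lemma ode_solution_shift:
  assumes "ode_solution q u w"
  shows "ode_solution (\<lambda>x. q (x + c)) (\<lambda>x. u (x + c)) (\<lambda>x. w (x + c))"
  using assms by (simp add: ode_solution_def flip: DERIV_shift)

lemma ode_solution_reflect:
  assumes "ode_solution q u w"
  shows "ode_solution (\<lambda>x. q (- x)) (\<lambda>x. u (- x)) (\<lambda>x. - w (- x))"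
  using assms DERIV_mirror[of u] DERIV_mirror[of w] DERIV_minus[of "\<lambda>x. w (- x)"]
  unfolding ode_solution_def by fastforce

lemma ode_solution_combine:
  assumes "ode_solution q u w" "ode_solution q u' w'"
  shows "ode_solution q (\<lambda>x. a * u x + b * u' x) (\<lambda>x. a * w x + b * w' x)"
  using assms by (auto simp: ode_solution_def algebra_simps intro!: derivative_eq_intros)

lemma ode_solution_zero:
  assumes s: "ode_solution q u w" and q: "\<And>x. \<bar>q x\<bar> \<le> Q" and "u c = 0" "w c = 0"
  shows "u x = 0 \<and> w x = 0"
proof -
  have *: "u x = 0 \<and> w x = 0" if "ode_solution q u w" "\<And>x. \<bar>q x\<bar> \<le> Q" "u 0 = 0" "w 0 = 0" "x \<ge> 0"
    for q u w and x :: real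
    using gronwall_square[of u w q "\<lambda>_. 0" Q x 0 x] that
    by (auto simp: ode_solution_def sum_power2_le_zero_iff)
  note sh = ode_solution_shift[OF s, of c]
  show ?thesis
  proof (cases "x \<ge> c")
    case True
    then show ?thesis using *[OF sh, of "x - c"] q assms by simp
  next
    case False
    then show ?thesis using *[OF ode_solution_reflect[OF sh], of "c - x"] q assms by simp
  qed
qed

lemma ode_solution_unique:
  assumes "ode_solution q u w" "ode_solution q u' w'" "\<And>x. \<bar>q x\<bar> \<le> Q"
    and "u c = u' c" "w c = w' c"
  shows "u x = u' x \<and> w x = w' x"
  using ode_solution_zero[OF ode_solution_combine[OF assms(1,2), of 1 "-1"] assms(3), of c x] assms(4,5)
  by simp

text \<open>
  For two spectral parameters the derivative of the Wronskian is proportional to the product of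
  the solutions; every monotonicity in the parameter comes from this identity.
\<close>

lemma wronskian_deriv:
  assumes "ode_solution q u w" "ode_solution q' u' w'"
  shows "((\<lambda>x. u x * w' x - w x * u' x) has_real_derivative (q' x - q x) * (u x * u' x)) (at x)"
  using assms by (auto simp: ode_solution_def algebra_simps intro!: derivative_eq_intros)

text \<open>
  Each unknown drives the other upwards. Before a first zero of \<open>r\<close> both functions
  can only increase, so there is no such zero. This is used for \<open>r = u\<close>,
  \<open>w = u'\<close> under a non-negative potential, and for the quotient and the Wronskian of
  two solutions (Sturm comparison).
\<close>

lemma cooperative_system_nonneg:
  fixes r w \<alpha> \<beta> :: "real \<Rightarrow> real"
  assumes r: "\<And>x. 0 \<le> x \<Longrightarrow> x \<le> X \<Longrightarrow> (r has_real_derivative \<alpha> x * w x) (at x)"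
    and w: "\<And>x. 0 \<le> x \<Longrightarrow> x \<le> X \<Longrightarrow> (w has_real_derivative \<beta> x * r x) (at x)"
    and \<alpha>: "\<And>x. 0 \<le> x \<Longrightarrow> x \<le> X \<Longrightarrow> \<alpha> x \<ge> 0" and \<beta>: "\<And>x. 0 \<le> x \<Longrightarrow> x \<le> X \<Longrightarrow> \<beta> x \<ge> 0"
    and 0: "r 0 > 0" "w 0 \<ge> 0" and x: "0 \<le> x" "x \<le> X"
  shows "r x \<ge> r 0" "w x \<ge> w 0"
proof -
  have mono_w: "w 0 \<le> w y" if y: "0 \<le> y" "y \<le> X" "\<And>z. 0 \<le> z \<Longrightarrow> z < y \<Longrightarrow> r z \<ge> 0" for y
  proof (rule DERIV_nonneg_imp_increasing_open[OF y(1)])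
    fix z assume z: "0 < z" "z < y"
    then show "\<exists>d. (w has_real_derivative d) (at z) \<and> 0 \<le> d"
      using y w[of z] \<beta>[of z] by (intro exI[of _ "\<beta> z * r z"]) auto
  next
    show "continuous_on {0..y} w" 
      by (intro DERIV_continuous_on[where D = "\<lambda>x. \<beta> x * r x"] DERIV_subset[OF w]) (use y in auto)
  qed
  have mono_r: "r 0 \<le> r y" if y: "0 \<le> y" "y \<le> X" "\<And>z. 0 \<le> z \<Longrightarrow> z < y \<Longrightarrow> r z \<ge> 0" for y
  proof (rule DERIV_nonneg_imp_nondecreasing[OF y(1)])
    fix z assume z: "0 \<le> z" "z \<le> y"
    have "w 0 \<le> w z" by (rule mono_w) (use y z in auto)
    then show "\<exists>d. (r has_real_derivative d) (at z) \<and> 0 \<le> d"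
      using y z r[of z] \<alpha>[of z] 0 by (intro exI[of _ "\<alpha> z * w z"]) auto
  qed
  have pos: "r y > 0" if y: "0 \<le> y" "y \<le> X" for y
  proof (rule ccontr)
    assume neg: "\<not> r y > 0"
    define Z where "Z = {0..X} \<inter> {z. r z \<le> 0}"
    have "continuous_on {0..X} r" 
      by (intro DERIV_continuous_on[where D = "\<lambda>x. \<alpha> x * w x"] DERIV_subset[OF r]) auto
    then have "closed ({0..X} \<inter> r -` {..0})" by (rule continuous_closed_preimage) auto
    then have "closed Z" by (simp add: Z_def vimage_def)
    moreover have Zne: "Z \<noteq> {}" and bdd: "bdd_below Z" using y neg by (auto simp: Z_def intro!: bdd_belowI[of _ 0])
    ultimately have z0: "Inf Z \<in> Z" by (intro closed_contains_Inf)
    have "r z > 0" if "0 \<le> z" "z < Inf Z" for z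
      using that cInf_lower[OF _ bdd, of z] z0 by (force simp: Z_def)
    then have "r 0 \<le> r (Inf Z)" using z0 by (intro mono_r) (auto simp: Z_def less_imp_le)
    then show False using z0 0 by (auto simp: Z_def)
  qed
  show "r x \<ge> r 0" by (rule mono_r) (use x pos in \<open>auto intro!: less_imp_le\<close>)
  show "w x \<ge> w 0" by (rule mono_w) (use x pos in \<open>auto intro!: less_imp_le\<close>)
qed

section \<open>Smooth bump functions\<close>

definition smooth :: "(real \<Rightarrow> real) \<Rightarrow> bool" where
  "smooth f \<longleftrightarrow> (\<forall>n x. (deriv ^^ n) f field_differentiable at x)"

lemma smooth_deriv: "smooth f \<Longrightarrow> smooth (deriv f)"
  unfolding smooth_def by (metis comp_apply funpow_Suc_right)

lemma smooth_has_deriv: "smooth f \<Longrightarrow> (f has_real_derivative deriv f x) (at x)"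
  unfolding smooth_def by (metis DERIV_deriv_iff_field_differentiable funpow_0)

lemma smooth_continuous: "smooth f \<Longrightarrow> continuous_on UNIV f"
  by (meson DERIV_continuous_on DERIV_subset smooth_has_deriv subset_UNIV)

lemma smooth_primitive:
  assumes "\<And>x. (F has_real_derivative f x) (at x)" "smooth f"
  shows "smooth F"
  unfolding smooth_def
proof (intro allI)
  fix n x
  have "deriv F = f" using assms(1) by (auto intro!: DERIV_imp_deriv)
  then show "(deriv ^^ n) F field_differentiable at x"
    using assms by (cases n) (auto simp: smooth_def field_differentiable_def funpow_Suc_right simp del: funpow.simps(2))
qed

lemma smooth_diff_mult:
  assumes "smooth f" "smooth g"
  shows "smooth (\<lambda>x. f x - c * g x)"
proof -
  have "(deriv ^^ n) (\<lambda>x. f x - c * g x) = (\<lambda>x. (deriv ^^ n) f x - c * (deriv ^^ n) g x)" for n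
  proof (induction n)
    case (Suc n)
    have "((\<lambda>x. (deriv ^^ n) f x - c * (deriv ^^ n) g x) has_real_derivative
        (deriv ^^ Suc n) f x - c * (deriv ^^ Suc n) g x) (at x)" for x
      using assms by (intro DERIV_diff DERIV_cmult) (auto simp: smooth_def DERIV_deriv_iff_field_differentiable)
    then show ?case unfolding funpow.simps(2) comp_apply Suc by (auto intro!: DERIV_imp_deriv)
  qed simp
  then show ?thesis
    using assms by (auto simp: smooth_def
        intro!: field_differentiable_diff field_differentiable_mult field_differentiable_const)
qed

text \<open>
  Smoothness follows once a function lies in any class that is closed under differentiation.
\<close>

lemma smooth_coinduct:
  assumes "\<And>g. g \<in> A \<Longrightarrow> \<exists>g'\<in>A. \<forall>x. (g has_real_derivative g' x) (at x)" "f \<in> A"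
  shows "smooth f"
proof -
  have *: "deriv g \<in> A" "\<forall>x. g field_differentiable at x" if "g \<in> A" for g
  proof -
    from assms(1)[OF that] obtain g' where g': "g' \<in> A" "\<forall>x. (g has_real_derivative g' x) (at x)" by blast
    then have "deriv g = g'" by (auto intro!: DERIV_imp_deriv)
    with g' show "deriv g \<in> A" "\<forall>x. g field_differentiable at x" by (auto simp: field_differentiable_def)
  qed
  have "(deriv ^^ n) f \<in> A" for n by (induction n) (use assms(2) * in auto)
  then show ?thesis using * by (auto simp: smooth_def)
qed

text \<open>
  The functions \<open>p(1/x) exp(-1/x)\<close>, continued by zero: differentiation only changes
  the polynomial \<open>p\<close>.
\<close>

definition flat_exp :: "real poly \<Rightarrow> real \<Rightarrow> real" where
  "flat_exp p x = (if x > 0 then poly p (1 / x) * exp (- (1 / x)) else 0)"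

lemma poly_exp_tendsto_0: "((\<lambda>y. poly p y * exp (- y)) \<longlongrightarrow> (0::real)) at_top"
proof (induction p)
  case (pCons a p)
  have *: "((\<lambda>y. y ^ n * exp (- y)) \<longlongrightarrow> (0::real)) at_top" for n
    using tendsto_power_div_exp_0[of n] by (simp add: exp_minus field_simps)
  have "((\<lambda>y. y * poly p y * exp (- y)) \<longlongrightarrow> 0) at_top"
    unfolding poly_altdef sum_distrib_left sum_distrib_right
  proof (rule tendsto_null_sum)
    fix i
    show "((\<lambda>y. y * (coeff p i * y ^ i) * exp (- y)) \<longlongrightarrow> 0) at_top"
      using tendsto_mult_right_zero[OF *[of "Suc i"], of "coeff p i"] by (simp add: mult_ac)
  qed
  moreover have "((\<lambda>y. a * exp (- y)) \<longlongrightarrow> 0) at_top"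
    using tendsto_mult_right_zero[OF *[of 0], of a] by simp
  ultimately have "((\<lambda>y. a * exp (- y) + y * poly p y * exp (- y)) \<longlongrightarrow> 0 + 0) at_top"
    by (rule tendsto_add[rotated])
  then show ?case by (simp add: algebra_simps)
qed simp

lemma flat_exp_deriv:
  "(flat_exp p has_real_derivative flat_exp (monom 1 2 * (p - pderiv p)) x) (at x)"
proof -
  consider "x > 0" | "x < 0" | "x = 0" by linarith
  then show ?thesis
  proof cases
    case 1
    have "((\<lambda>x. poly p (1 / x) * exp (- (1 / x))) has_real_derivative
        flat_exp (monom 1 2 * (p - pderiv p)) x) (at x)"
      using 1 by (auto intro!: derivative_eq_intros DERIV_chain'[where g="poly p", OF _ poly_DERIV]
           simp: flat_exp_def poly_monom power2_eq_square field_simps)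
    then show ?thesis
      by (rule has_field_derivative_transform_within_open[where S = "{0<..}"]) (use 1 in \<open>auto simp: flat_exp_def\<close>)
  next
    case 2
    have "((\<lambda>x. 0) has_real_derivative flat_exp (monom 1 2 * (p - pderiv p)) x) (at x)"
      using 2 by (auto simp: flat_exp_def)
    then show ?thesis
      by (rule has_field_derivative_transform_within_open[where S = "{..<0}"]) (use 2 in \<open>auto simp: flat_exp_def\<close>)
  next
    case 3
    have "((\<lambda>x. poly (pCons 0 p) (inverse x) * exp (- inverse x)) \<longlongrightarrow> 0) (at_right (0::real))"
      using filterlim_compose[OF poly_exp_tendsto_0 filterlim_inverse_at_top_right] .
    then have R: "((\<lambda>x. flat_exp p x / x) \<longlongrightarrow> 0) (at_right 0)"
      by (rule Lim_transform_eventually)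
         (auto simp: flat_exp_def eventually_at_right_less field_simps intro!: eventually_mono[OF eventually_at_right_less])
    have L: "((\<lambda>x. flat_exp p x / x) \<longlongrightarrow> 0) (at_left 0)"
      by (rule Lim_transform_eventually[OF tendsto_const])
         (auto simp: flat_exp_def eventually_at_filter)
    from R L have "((\<lambda>x. flat_exp p x / x) \<longlongrightarrow> 0) (at 0)"
      by (simp add: filterlim_at_split)
    then show ?thesis using 3 by (simp add: has_field_derivative_iff flat_exp_def)
  qed
qed

text \<open>
  Closed under differentiation by the sum and product rules, so that products of rescaled and
  reflected \<open>flat_exp\<close> functions, which can have compact support, are smooth.
\<close>

inductive_set flat_algebra :: "(real \<Rightarrow> real) set" where
  base: "(\<lambda>x. flat_exp p (c * x + e)) \<in> flat_algebra"
| add: "f \<in> flat_algebra \<Longrightarrow> g \<in> flat_algebra \<Longrightarrow> (\<lambda>x. f x + g x) \<in> flat_algebra"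
| mult: "f \<in> flat_algebra \<Longrightarrow> g \<in> flat_algebra \<Longrightarrow> (\<lambda>x. f x * g x) \<in> flat_algebra"

lemma smooth_flat_algebra: 
  assumes "f \<in> flat_algebra" shows "smooth f"
proof (rule smooth_coinduct[OF _ assms])
  fix g assume "g \<in> flat_algebra"
  then show "\<exists>g'\<in>flat_algebra. \<forall>x. (g has_real_derivative g' x) (at x)"
  proof induction
    case (base p c e)
    have "((\<lambda>x. flat_exp p (c * x + e)) has_real_derivative 
       flat_exp (smult c (monom 1 2 * (p - pderiv p))) (c * x + e)) (at x)" for x
    proof -
      have "((\<lambda>x. flat_exp p (c * x + e)) has_real_derivative
         c * flat_exp (monom 1 2 * (p - pderiv p)) (c * x + e)) (at x)"
        by (rule DERIV_chain'[where g="flat_exp p", OF _ flat_exp_deriv, THEN DERIV_cong])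
           (auto intro!: derivative_eq_intros)
      moreover have "c * flat_exp (monom 1 2 * (p - pderiv p)) (c * x + e)
          = flat_exp (smult c (monom 1 2 * (p - pderiv p))) (c * x + e)" by (simp add: flat_exp_def)
      ultimately show ?thesis by simp
    qed
    then show ?case
      using flat_algebra.base[of "smult c (monom 1 2 * (p - pderiv p))" c e] by metis
  next
    case (add f g)
    from add.IH obtain f' g' where *: "f' \<in> flat_algebra" "g' \<in> flat_algebra"
      "\<forall>x. (f has_real_derivative f' x) (at x)" "\<forall>x. (g has_real_derivative g' x) (at x)"
      by (elim bexE)
    show ?case
      by (rule bexI[OF _ flat_algebra.add[OF *(1,2)]]) (simp add: DERIV_add *(3,4))
  next
    case (mult f g)
    from mult.IH obtain f' g' where *: "f' \<in> flat_algebra" "g' \<in> flat_algebra"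
      "\<forall>x. (f has_real_derivative f' x) (at x)" "\<forall>x. (g has_real_derivative g' x) (at x)"
      by (elim bexE)
    note mem = flat_algebra.add[OF flat_algebra.mult[OF *(1) mult.hyps(2)]
        flat_algebra.mult[OF *(2) mult.hyps(1)]]
    show ?case
      by (rule bexI[OF _ mem]) (use *(3,4) in \<open>simp add: DERIV_mult\<close>)
  qed
qed

text \<open>
  As \<open>k\<close> grows, the two factors are stretched and the bump tends to the indicator
  function of the interval.
\<close>

definition bump :: "real \<Rightarrow> real \<Rightarrow> nat \<Rightarrow> real \<Rightarrow> real" where
  "bump a b k x = flat_exp 1 (real (Suc k) * (x - a)) * flat_exp 1 (real (Suc k) * (b - x))"

lemma test_functions_iff:
  "\<phi> \<in> test_functions \<longleftrightarrow> smooth \<phi> \<and> (\<exists>R. \<forall>x. \<bar>x\<bar> > R \<longrightarrow> \<phi> x = 0)"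
proof -
  have "compact (closure {x. \<phi> x \<noteq> 0}) \<longleftrightarrow> (\<exists>R. \<forall>x. \<bar>x\<bar> > R \<longrightarrow> \<phi> x = 0)"
    unfolding compact_closure bounded_iff by (auto simp: not_le) (meson linorder_not_less)+
  then show ?thesis by (auto simp: test_functions_def smooth_def)
qed

lemma bump_test: "bump a b k \<in> test_functions"
proof -
  have *: "bump a b k = (\<lambda>x. flat_exp 1 (real (Suc k) * x + - real (Suc k) * a) * flat_exp 1 (- real (Suc k) * x + real (Suc k) * b))"
    by (auto simp: bump_def fun_eq_iff algebra_simps)
  have "bump a b k \<in> flat_algebra" unfolding *
    by (intro flat_algebra.intros)
  moreover have "bump a b k x = 0" if "\<bar>x\<bar> > \<bar>a\<bar> + \<bar>b\<bar>" for x
  proof (cases "x > 0")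
    case True
    with that have "b - x \<le> 0" by linarith
    then show ?thesis by (auto simp: bump_def flat_exp_def zero_less_mult_iff simp del: of_nat_Suc)
  next
    case False
    with that have "x - a \<le> 0" by linarith
    then show ?thesis by (auto simp: bump_def flat_exp_def zero_less_mult_iff simp del: of_nat_Suc)
  qed
  ultimately show ?thesis
    by (auto simp: test_functions_iff smooth_flat_algebra)
qed

lemma bump_bounds: "0 \<le> bump a b k x" "bump a b k x \<le> 1" "x \<notin> {a<..<b} \<Longrightarrow> bump a b k x = 0"
  "x \<in> {a<..<b} \<Longrightarrow> bump a b k x > 0"
proof -
  have *: "0 \<le> flat_exp 1 x" "flat_exp 1 x \<le> 1" for x by (auto simp: flat_exp_def)
  show "0 \<le> bump a b k x" "bump a b k x \<le> 1" unfolding bump_def using * by (auto intro!: mult_le_one)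
  show "x \<notin> {a<..<b} \<Longrightarrow> bump a b k x = 0" "x \<in> {a<..<b} \<Longrightarrow> bump a b k x > 0"
    by (auto simp: bump_def flat_exp_def zero_less_mult_iff simp del: of_nat_Suc)
qed

lemma bump_tendsto: "(\<lambda>k. bump a b k x) \<longlonglongrightarrow> indicator {a<..<b} x"
proof (cases "x \<in> {a<..<b}")
  case True
  \<comment> \<open>Inside the interval both exponents tend to \<open>0\<close>.\<close>
  have "(\<lambda>k. exp (- (1 / (real (Suc k) * (x - a)))) * exp (- (1 / (real (Suc k) * (b - x))))) \<longlonglongrightarrow> exp (- 0) * exp (- 0)"
  proof (intro tendsto_mult tendsto_exp tendsto_minus)
    have "(\<lambda>k. (1 / c) * inverse (real (Suc k))) \<longlonglongrightarrow> (1 / c) * 0" for c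
      by (intro tendsto_mult tendsto_const LIMSEQ_inverse_real_of_nat)
    then have "(\<lambda>k. 1 / (real (Suc k) * c)) \<longlonglongrightarrow> 0" for c
      by (simp add: divide_inverse mult.commute del: of_nat_Suc)
    then show "(\<lambda>k. 1 / (real (Suc k) * (x - a))) \<longlonglongrightarrow> 0" "(\<lambda>k. 1 / (real (Suc k) * (b - x))) \<longlonglongrightarrow> 0"
      by blast+
  qed
  then show ?thesis using True by (simp add: bump_def flat_exp_def zero_less_mult_iff del: of_nat_Suc)
next
  case False
  then show ?thesis by (simp add: bump_bounds)
qed

section \<open>Weak derivatives of locally integrable functions\<close>

definition loc_int :: "(real \<Rightarrow> complex) \<Rightarrow> bool" where
  "loc_int u \<longleftrightarrow> (\<forall>R. set_integrable lborel {-R..R} u)"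

text \<open>
  Test functions are required to be only once continuously differentiable, so that a product of a
  test function with a coefficient such as \<open>exp\<close> or a Floquet factor is again one.
\<close>

definition c1_test :: "(real \<Rightarrow> real) \<Rightarrow> (real \<Rightarrow> real) \<Rightarrow> bool" where
  "c1_test \<phi> \<phi>' \<longleftrightarrow> (\<forall>x. (\<phi> has_real_derivative \<phi>' x) (at x)) \<and> continuous_on UNIV \<phi>' \<and>
     (\<exists>R. \<forall>x. \<bar>x\<bar> > R \<longrightarrow> \<phi> x = 0)"

definition wderiv :: "(real \<Rightarrow> complex) \<Rightarrow> (real \<Rightarrow> complex) \<Rightarrow> bool" where
  "wderiv u g \<longleftrightarrow> loc_int u \<and> loc_int g \<and>
     (\<forall>\<phi> \<phi>'. c1_test \<phi> \<phi>' \<longrightarrow> (LBINT x. \<phi>' x *\<^sub>R u x) = - (LBINT x. \<phi> x *\<^sub>R g x))"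

lemma loc_int_measurable [measurable_dest]:
  assumes "loc_int u" shows "u \<in> borel_measurable borel"
proof (rule borel_measurable_LIMSEQ_metric)
  fix n :: nat
  show "(\<lambda>x. indicator {- real n..real n} x *\<^sub>R u x) \<in> borel_measurable borel"
  proof -
    have "integrable lborel (\<lambda>x. indicator {- real n..real n} x *\<^sub>R u x)"
      using assms by (simp add: loc_int_def set_integrable_def)
    from borel_measurable_integrable[OF this] show ?thesis by (simp only: measurable_lborel1 measurable_lborel2)
  qed
next
  fix x :: real
  obtain N :: nat where "\<bar>x\<bar> \<le> real N" using real_arch_simple by blast
  then have "\<forall>\<^sub>F n in sequentially. indicator {- real n..real n} x *\<^sub>R u x = u x"
    by (intro eventually_sequentiallyI[of N]) (auto simp: indicator_def)
  then show "(\<lambda>n. indicator {- real n..real n} x *\<^sub>R u x) \<longlonglongrightarrow> u x"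
    by (rule tendsto_eventually)
qed

lemma loc_int_I:
  assumes "u \<in> borel_measurable borel" "\<And>R. R > 0 \<Longrightarrow> \<exists>h. integrable lborel h \<and> (\<forall>x\<in>{-R..R}. norm (u x) \<le> h x)"
  shows "loc_int u"
  unfolding loc_int_def set_integrable_def
proof
  fix R :: real
  have "\<bar>R\<bar>+1 > 0" by simp
  from assms(2)[OF this] obtain h where h: "integrable lborel h" "\<forall>x\<in>{-(\<bar>R\<bar>+1)..\<bar>R\<bar>+1}. norm (u x) \<le> h x"
    by blast
  have *: "norm (indicator {-R..R} x *\<^sub>R u x) \<le> norm (h x)" for x
    using h(2)[rule_format, of x] by (auto simp: indicator_def)
  show "integrable lborel (\<lambda>x. indicator {-R..R} x *\<^sub>R u x)"
    by (rule Bochner_Integration.integrable_bound[OF h(1)])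
       (use * assms(1) in auto)
qed

lemma loc_int_continuous_mult:
  assumes u: "loc_int u" and c: "continuous_on UNIV c"
  shows "loc_int (\<lambda>x. c x *\<^sub>R u x)"
proof (rule loc_int_I)
  have [measurable]: "c \<in> borel_measurable borel" "u \<in> borel_measurable borel"
    using c u by (auto intro: borel_measurable_continuous_onI loc_int_measurable)
  show "(\<lambda>x. c x *\<^sub>R u x) \<in> borel_measurable borel" by measurable
  fix R :: real
  have "bounded (c ` {-R..R})"
    by (intro compact_imp_bounded compact_continuous_image continuous_on_subset[OF c]) auto
  then obtain B where B: "\<forall>x\<in>{-R..R}. norm (c x) \<le> B" by (auto simp: bounded_iff)
  have "integrable lborel (\<lambda>x. B * norm (indicator {-R..R} x *\<^sub>R u x))"
    using u by (intro integrable_mult_right integrable_norm) (auto simp: loc_int_def set_integrable_def)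
  then show "\<exists>h. integrable lborel h \<and> (\<forall>x\<in>{-R..R}. norm (c x *\<^sub>R u x) \<le> h x)"
    by (intro exI[of _ "\<lambda>x. B * norm (indicator {-R..R} x *\<^sub>R u x)"]) (use B in \<open>auto intro: mult_right_mono\<close>)
qed

lemma loc_int_continuous:
  fixes u :: "real \<Rightarrow> complex"
  assumes "continuous_on UNIV u"
  shows "loc_int u"
  unfolding loc_int_def
proof
  fix R :: real
  have "continuous_on {-R..R} u" using assms by (rule continuous_on_subset) simp
  then show "set_integrable lborel {-R..R} u" by (rule borel_integrable_atLeastAtMost')
qed

lemma integrable_compact_support:
  assumes "loc_int u" "continuous_on UNIV c" "\<And>x. \<bar>x\<bar> > R \<Longrightarrow> c x = 0"
  shows "integrable lborel (\<lambda>x. c x *\<^sub>R u x)"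
proof -
  have "(\<lambda>x. indicator {-R..R} x *\<^sub>R (c x *\<^sub>R u x)) = (\<lambda>x. c x *\<^sub>R u x)"
  proof
    fix x show "indicator {-R..R} x *\<^sub>R (c x *\<^sub>R u x) = c x *\<^sub>R u x"
      using assms(3)[of x] by (cases "\<bar>x\<bar> \<le> R") (auto simp: indicator_def abs_le_iff)
  qed
  then show ?thesis
    using loc_int_continuous_mult[OF assms(1,2)] unfolding loc_int_def set_integrable_def by metis
qed

lemma loc_int_add: "loc_int u \<Longrightarrow> loc_int v \<Longrightarrow> loc_int (\<lambda>x. u x + v x)"
  unfolding loc_int_def set_integrable_def by (simp add: scaleR_right_distrib)

lemma loc_int_cmult: "loc_int u \<Longrightarrow> loc_int (\<lambda>x. c * u x)"
  unfolding loc_int_def set_integrable_def by (simp flip: mult_scaleR_right)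

lemma loc_int_diff: "loc_int u \<Longrightarrow> loc_int v \<Longrightarrow> loc_int (\<lambda>x. u x - v x)"
  using loc_int_add[of u "\<lambda>x. (-1) * v x"] loc_int_cmult[of v "-1"] by simp

lemma loc_int_L2:
  assumes "u \<in> L2" shows "loc_int u"
proof (rule loc_int_I)
  show "u \<in> borel_measurable borel" using assms by (simp add: L2_def)
  fix R :: real
  have "integrable lborel (\<lambda>x. indicator {-R..R} x *\<^sub>R 1 + (cmod (u x))\<^sup>2)"
    using assms borel_integrable_atLeastAtMost'[of "-R" R "\<lambda>_. 1::real"]
    by (intro Bochner_Integration.integrable_add) (auto simp: L2_def set_integrable_def)
  moreover have "cmod (u x) \<le> 1 + (cmod (u x))\<^sup>2" for x
  proof -
    have "2 * cmod (u x) \<le> 1 + (cmod (u x))\<^sup>2" using sum_squares_bound[of 1 "cmod (u x)"] by simp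
    then show ?thesis using norm_ge_zero[of "u x"] by linarith
  qed
  ultimately show "\<exists>h. integrable lborel h \<and> (\<forall>x\<in>{-R..R}. norm (u x) \<le> h x)"
    by (intro exI[of _ "\<lambda>x. indicator {-R..R} x *\<^sub>R 1 + (cmod (u x))\<^sup>2"]) auto
qed

lemma c1_test_zero:
  assumes "c1_test \<phi> \<phi>'"
  shows "\<exists>R>0. \<forall>x. \<bar>x\<bar> > R \<longrightarrow> \<phi> x = 0 \<and> \<phi>' x = 0"
proof -
  from assms obtain R0 where R0: "\<And>x. \<bar>x\<bar> > R0 \<Longrightarrow> \<phi> x = 0" by (auto simp: c1_test_def)
  define R where "R = \<bar>R0\<bar> + 1"
  have z: "\<phi> x = 0" if "\<bar>x\<bar> > R" for x using R0[of x] that by (auto simp: R_def)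
  have "\<phi>' x = 0" if x: "\<bar>x\<bar> > R" for x
  proof -
    have "open {x. \<bar>x\<bar> > R}" by (intro open_Collect_less continuous_intros)
    moreover have "((\<lambda>x. 0) has_real_derivative 0) (at x)" by simp
    ultimately have "(\<phi> has_real_derivative 0) (at x)"
      using has_field_derivative_transform_within_open[of "\<lambda>_. 0" 0 x "{x. \<bar>x\<bar> > R}" \<phi>] x z by auto
    then show ?thesis using assms DERIV_unique[of \<phi> 0 x "\<phi>' x"] by (auto simp: c1_test_def)
  qed
  then show ?thesis using z by (intro exI[of _ R]) (auto simp: R_def)
qed

lemma c1_test_continuous: "c1_test \<phi> \<phi>' \<Longrightarrow> continuous_on UNIV \<phi>" "c1_test \<phi> \<phi>' \<Longrightarrow> continuous_on UNIV \<phi>'"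
  unfolding c1_test_def by (auto intro: DERIV_continuous_on)

lemma c1_test_integrable:
  assumes "c1_test \<phi> \<phi>'" "loc_int u" "continuous_on UNIV c"
  shows "integrable lborel (\<lambda>x. (\<phi> x * c x) *\<^sub>R u x)" "integrable lborel (\<lambda>x. (\<phi>' x * c x) *\<^sub>R u x)"
proof -
  obtain R where R: "R > 0" "\<And>x. \<bar>x\<bar> > R \<Longrightarrow> \<phi> x = 0" "\<And>x. \<bar>x\<bar> > R \<Longrightarrow> \<phi>' x = 0"
    using c1_test_zero[OF assms(1)] by blast
  note c = c1_test_continuous[OF assms(1)]
  show "integrable lborel (\<lambda>x. (\<phi> x * c x) *\<^sub>R u x)" "integrable lborel (\<lambda>x. (\<phi>' x * c x) *\<^sub>R u x)"
    by (intro integrable_compact_support[OF assms(2), where R=R] continuous_on_mult c assms(3);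
        simp add: R)+
qed

lemma c1_test_integrable':
  assumes "c1_test \<phi> \<phi>'" "loc_int u"
  shows "integrable lborel (\<lambda>x. \<phi> x *\<^sub>R u x)" "integrable lborel (\<lambda>x. \<phi>' x *\<^sub>R u x)"
  using c1_test_integrable[OF assms, of "\<lambda>_. 1"] by auto

lemma wderiv_add:
  assumes "wderiv u g" "wderiv v h" shows "wderiv (\<lambda>x. u x + v x) (\<lambda>x. g x + h x)"
  using assms c1_test_integrable' unfolding wderiv_def
  by (auto simp: loc_int_add scaleR_right_distrib)

lemma wderiv_cmult:
  assumes "wderiv u g" shows "wderiv (\<lambda>x. c * u x) (\<lambda>x. c * g x)"
  using assms unfolding wderiv_def
  by (auto simp: loc_int_cmult simp flip: mult_scaleR_right)

lemma wderiv_diff: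
  assumes "wderiv u g" "wderiv v h" shows "wderiv (\<lambda>x. u x - v x) (\<lambda>x. g x - h x)"
  using wderiv_add[OF assms(1) wderiv_cmult[OF assms(2), of "-1"]] by simp

lemma loc_int_cong:
  assumes "loc_int u" "ae_eq u v" "v \<in> borel_measurable borel" shows "loc_int v"
proof -
  have [measurable]: "u \<in> borel_measurable borel" by (rule loc_int_measurable[OF assms(1)])
  show ?thesis unfolding loc_int_def set_integrable_def
  proof
    fix R
    show "integrable lborel (\<lambda>x. indicator {-R..R} x *\<^sub>R v x)"
      using assms
      by (subst integrable_cong_AE[where g = "\<lambda>x. indicator {-R..R} x *\<^sub>R u x"])
         (auto simp: loc_int_def set_integrable_def ae_eq_def)
  qed
qed

lemma wderiv_cong:
  assumes "wderiv u g" "ae_eq u v" "v \<in> borel_measurable borel" "ae_eq g h" "h \<in> borel_measurable borel"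
  shows "wderiv v h"
  unfolding wderiv_def
proof (intro conjI allI impI)
  show "loc_int v" "loc_int h" 
    using assms(1) by (auto simp: wderiv_def intro: loc_int_cong[OF _ assms(2,3)] loc_int_cong[OF _ assms(4,5)])
  fix \<phi> \<phi>' assume t: "c1_test \<phi> \<phi>'"
  have [measurable]: "u \<in> borel_measurable borel" "g \<in> borel_measurable borel"
    "v \<in> borel_measurable borel" "h \<in> borel_measurable borel"
    "\<phi> \<in> borel_measurable borel" "\<phi>' \<in> borel_measurable borel"
    using assms t c1_test_continuous[OF t]
    by (auto simp: wderiv_def loc_int_measurable borel_measurable_continuous_onI)
  have "(LBINT x. \<phi>' x *\<^sub>R v x) = (LBINT x. \<phi>' x *\<^sub>R u x)"
    using assms(2) by (intro integral_cong_AE) (auto simp: ae_eq_def)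
  moreover have "(LBINT x. \<phi> x *\<^sub>R h x) = (LBINT x. \<phi> x *\<^sub>R g x)"
    using assms(4) by (intro integral_cong_AE) (auto simp: ae_eq_def)
  ultimately show "(LBINT x. \<phi>' x *\<^sub>R v x) = - (LBINT x. \<phi> x *\<^sub>R h x)"
    using assms(1) t by (auto simp: wderiv_def)
qed

text \<open>
  The factor is moved to the test function, which stays admissible because only one continuous
  derivative is demanded of it.
\<close>

lemma wderiv_mult:
  assumes W: "wderiv u g" and c: "\<And>x. (c has_real_derivative c' x) (at x)" "continuous_on UNIV c'"
  shows "wderiv (\<lambda>x. c x *\<^sub>R u x) (\<lambda>x. c' x *\<^sub>R u x + c x *\<^sub>R g x)"
  unfolding wderiv_def
proof (intro conjI allI impI)
  have cc: "continuous_on UNIV c" by (rule DERIV_continuous_on[OF c(1)])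
  have li: "loc_int u" "loc_int g" using W by (auto simp: wderiv_def)
  show "loc_int (\<lambda>x. c x *\<^sub>R u x)" "loc_int (\<lambda>x. c' x *\<^sub>R u x + c x *\<^sub>R g x)"
    using li cc c(2) by (auto intro!: loc_int_add loc_int_continuous_mult)
  fix \<phi> \<phi>' assume t: "c1_test \<phi> \<phi>'"
  have t': "c1_test (\<lambda>x. \<phi> x * c x) (\<lambda>x. \<phi>' x * c x + c' x * \<phi> x)"
    using t c cc c1_test_continuous[OF t] unfolding c1_test_def
    by (auto intro!: DERIV_mult continuous_intros)
  note i = c1_test_integrable[OF t li(1) cc] c1_test_integrable[OF t li(2) cc] c1_test_integrable[OF t li(1) c(2)]
  have "(LBINT x. (\<phi>' x * c x) *\<^sub>R u x) + (LBINT x. (\<phi> x * c' x) *\<^sub>R u x) = (LBINT x. (\<phi>' x * c x + c' x * \<phi> x) *\<^sub>R u x)"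
    using i by (subst Bochner_Integration.integral_add[symmetric]) (auto simp: algebra_simps)
  also have "\<dots> = - (LBINT x. (\<phi> x * c x) *\<^sub>R g x)"
    using W t' by (simp add: wderiv_def)
  finally have "(LBINT x. (\<phi>' x * c x) *\<^sub>R u x) = - ((LBINT x. (\<phi> x * c' x) *\<^sub>R u x) + (LBINT x. (\<phi> x * c x) *\<^sub>R g x))"
    by (simp add: algebra_simps)
  also have "(LBINT x. (\<phi> x * c' x) *\<^sub>R u x) + (LBINT x. (\<phi> x * c x) *\<^sub>R g x) = (LBINT x. \<phi> x *\<^sub>R (c' x *\<^sub>R u x + c x *\<^sub>R g x))"
    using i by (subst Bochner_Integration.integral_add[symmetric]) (auto simp: algebra_simps)
  finally show "(LBINT x. \<phi>' x *\<^sub>R c x *\<^sub>R u x) = - (LBINT x. \<phi> x *\<^sub>R (c' x *\<^sub>R u x + c x *\<^sub>R g x))"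
    by simp
qed

text \<open>
  The product of the function and a test function is continuous and has a derivative off a finite
  set, so the fundamental theorem of calculus applies across the exceptional points. The point in
  question later is the dislocation at \<open>0\<close>.
\<close>

lemma wderiv_classical:
  fixes F g :: "real \<Rightarrow> complex"
  assumes F: "continuous_on UNIV F" "finite S" "\<And>x. x \<notin> S \<Longrightarrow> (F has_vector_derivative g x) (at x)"
    and g: "loc_int g"
  shows "wderiv F g"
  unfolding wderiv_def
proof (intro conjI allI impI)
  show li: "loc_int F" "loc_int g" using F(1) g by (auto intro: loc_int_continuous)
  fix \<phi> \<phi>' assume t: "c1_test \<phi> \<phi>'"
  obtain R where R: "R > 0" "\<And>x. \<bar>x\<bar> > R \<Longrightarrow> \<phi> x = 0" "\<And>x. \<bar>x\<bar> > R \<Longrightarrow> \<phi>' x = 0"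
    using c1_test_zero[OF t] by blast
  define f where "f x = \<phi> x *\<^sub>R g x + \<phi>' x *\<^sub>R F x" for x
  have der: "((\<lambda>x. \<phi> x *\<^sub>R F x) has_vector_derivative f x) (at x)" if "x \<notin> S" for x
    unfolding f_def
    by (rule has_vector_derivative_scaleR) (use t F(3)[OF that] in \<open>auto simp: c1_test_def\<close>)
  have "(f has_integral (\<phi> (R+1) *\<^sub>R F (R+1) - \<phi> (-(R+1)) *\<^sub>R F (-(R+1)))) {-(R+1)..R+1}"
    using R der F(1) c1_test_continuous[OF t]
    by (intro fundamental_theorem_of_calculus_strong[OF F(2)])
       (auto intro!: continuous_intros intro: continuous_on_subset)
  then have 0: "(f has_integral 0) {-(R+1)..R+1}" using R by simp
  have "integrable lborel f" unfolding f_def using c1_test_integrable'[OF t] li by auto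
  then have "(f has_integral integral\<^sup>L lborel f) UNIV" by (rule has_integral_integral_lborel)
  moreover have "(f has_integral 0) UNIV"
    by (rule has_integral_on_superset[OF 0]) (use R in \<open>auto simp: f_def abs_if not_le split: if_splits\<close>)
  ultimately have "integral\<^sup>L lborel f = 0" by (rule has_integral_unique)
  then show "(LBINT x. \<phi>' x *\<^sub>R F x) = - (LBINT x. \<phi> x *\<^sub>R g x)"
    unfolding f_def using c1_test_integrable'[OF t] li
    by (subst (asm) Bochner_Integration.integral_add) (auto simp: eq_neg_iff_add_eq_0 add.commute)
qed

section \<open>The lemma of du Bois-Reymond\<close>

lemma test_function_c1: "\<phi> \<in> test_functions \<Longrightarrow> c1_test \<phi> (deriv \<phi>)"
  by (auto simp: test_functions_iff c1_test_def smooth_has_deriv smooth_continuous smooth_deriv)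

lemma test_function_deriv:
  assumes "\<phi> \<in> test_functions" shows "deriv \<phi> \<in> test_functions"
proof -
  have "\<exists>R. \<forall>x. \<bar>x\<bar> > R \<longrightarrow> deriv \<phi> x = 0"
    using c1_test_zero[OF test_function_c1[OF assms]] by blast
  then show ?thesis using assms by (auto simp: test_functions_iff smooth_deriv)
qed

lemma test_function_integrable:
  assumes "\<phi> \<in> test_functions" "loc_int u"
  shows "integrable lborel (\<lambda>x. \<phi> x *\<^sub>R u x)"
  using c1_test_integrable'(1)[OF test_function_c1[OF assms(1)] assms(2)] .

text \<open>
  Open intervals form an intersection-stable generator of the Borel sets, and the sets on which
  the integral of \<open>f\<close> vanishes form a Dynkin system.
\<close>

lemma integral_zero_on_intervals:
  fixes f :: "real \<Rightarrow> complex"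
  assumes f: "integrable lborel f" and 0: "\<And>a b. (LBINT x:{a<..<b}. f x) = 0"
  shows "AE x in lborel. f x = 0"
proof (rule sigma_finite_measure.density_zero[OF lborel.sigma_finite_measure_axioms f])
  fix A :: "real set" assume "A \<in> sets lborel"
  define G where "G = range (\<lambda>(a::real, b). box a b)"
  have "A \<in> sigma_sets UNIV G"
    using \<open>A \<in> sets lborel\<close> by (simp add: G_def borel_eq_box)
  have int: "set_integrable lborel S f" if "S \<in> sigma_sets UNIV G" for S
  proof -
    have "S \<in> sets lborel" using that by (simp add: G_def borel_eq_box)
    then show ?thesis using f unfolding set_integrable_def by (intro integrable_mult_indicator)
  qed
  have "Int_stable G" by (auto simp: Int_stable_def G_def box_Int_box)
  have "G \<subseteq> Pow UNIV" by simp
  from \<open>Int_stable G\<close> this \<open>A \<in> sigma_sets UNIV G\<close>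
  show "set_lebesgue_integral lborel A f = 0"
  proof (induction rule: sigma_sets_induct_disjoint)
    case (basic A)
    then show ?case using 0 by (auto simp: G_def)
  next
    case empty
    show ?case by (simp add: set_lebesgue_integral_def)
  next
    case (compl A)
    have "(LBINT x. f x) = 0"
    proof -
      have "(\<lambda>n. LBINT x. indicator {- real n<..<real n} x *\<^sub>R f x) \<longlonglongrightarrow> (LBINT x. f x)"
      proof (rule integral_dominated_convergence[where w = "\<lambda>x. norm (f x)"])
        show "integrable lborel (\<lambda>x. norm (f x))" using f by simp
        show "AE x in lborel. (\<lambda>n. indicator {- real n<..<real n} x *\<^sub>R f x) \<longlonglongrightarrow> f x"
        proof (rule AE_I2)
          fix x :: real
          obtain N :: nat where "\<bar>x\<bar> < real N" using reals_Archimedean2 by blast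
          then have "\<forall>\<^sub>F n in sequentially. indicator {- real n<..<real n} x *\<^sub>R f x = f x"
            by (intro eventually_sequentiallyI[of N]) (auto simp: indicator_def)
          then show "(\<lambda>n. indicator {- real n<..<real n} x *\<^sub>R f x) \<longlonglongrightarrow> f x"
            by (rule tendsto_eventually)
        qed
        show "f \<in> borel_measurable lborel" using f by simp
        then show "(\<lambda>x. indicator {- real n<..<real n} x *\<^sub>R f x) \<in> borel_measurable lborel" for n
          by measurable
        show "AE x in lborel. norm (indicator {- real n<..<real n} x *\<^sub>R f x) \<le> norm (f x)" for n
          by (auto simp: indicator_def)
      qed
      then have "(\<lambda>n::nat. 0) \<longlonglongrightarrow> (LBINT x. f x)"
        using 0 unfolding set_lebesgue_integral_def by simp
      then show ?thesis by (simp add: LIMSEQ_const_iff)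
    qed
    moreover have "set_lebesgue_integral lborel (UNIV - A) f = (LBINT x. f x) - (LBINT x:A. f x)"
    proof -
      have "set_lebesgue_integral lborel (UNIV - A \<union> A) f = (LBINT x:UNIV - A. f x) + (LBINT x:A. f x)"
        using compl.hyps by (intro set_integral_Un int sigma_sets.Compl) auto
      then show ?thesis by (simp add: set_lebesgue_integral_def)
    qed
    ultimately show ?case using compl.IH by simp
  next
    case (union B)
    have "(\<lambda>n. 0) sums (LBINT x:(\<Union>n. B n). f x)"
    proof -
      have "(\<Union>n. B n) \<in> sigma_sets UNIV G" using union.hyps by (auto intro: sigma_sets.Union)
      then have "(LBINT x:(\<Union>n. B n). f x) = (\<Sum>n. LBINT x:B n. f x)"
        using union.hyps
        by (intro lebesgue_integral_countable_add int)
           (auto simp: disjoint_family_on_def G_def borel_eq_box)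
      then show ?thesis using union.IH by simp
    qed
    then show ?case by (simp add: sums_iff)
  qed
qed

text \<open>
  Bump functions converge boundedly to indicator functions of intervals, so the integrals over
  all intervals vanish.
\<close>

lemma fundamental_lemma_variations:
  assumes w: "loc_int w" and 0: "\<And>\<phi>. \<phi> \<in> test_functions \<Longrightarrow> (LBINT x. \<phi> x *\<^sub>R w x) = 0"
  shows "AE x in lborel. w x = 0"
proof -
  have [measurable]: "w \<in> borel_measurable borel" by (rule loc_int_measurable[OF w])
  have int0: "(LBINT x:{a<..<b}. w x) = 0" for a b
  proof -
    have "(\<lambda>k. LBINT x. bump a b k x *\<^sub>R w x) \<longlonglongrightarrow> (LBINT x. indicator {a<..<b} x *\<^sub>R w x)"
    proof (rule integral_dominated_convergence[where w = "\<lambda>x. norm (indicator {-(\<bar>a\<bar>+\<bar>b\<bar>)..\<bar>a\<bar>+\<bar>b\<bar>} x *\<^sub>R w x)"])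
      show "integrable lborel (\<lambda>x. norm (indicator {-(\<bar>a\<bar>+\<bar>b\<bar>)..\<bar>a\<bar>+\<bar>b\<bar>} x *\<^sub>R w x))"
        using w unfolding loc_int_def set_integrable_def by (intro integrable_norm) blast
      have "bump a b k \<in> borel_measurable borel" for k
        using bump_test[of a b k] by (intro borel_measurable_continuous_onI smooth_continuous) (simp add: test_functions_iff)
      then show "(\<lambda>x. bump a b k x *\<^sub>R w x) \<in> borel_measurable lborel" for k by measurable
      show "AE x in lborel. (\<lambda>k. bump a b k x *\<^sub>R w x) \<longlonglongrightarrow> indicator {a<..<b} x *\<^sub>R w x"
        by (intro AE_I2 tendsto_scaleR bump_tendsto tendsto_const)
      show "AE x in lborel. norm (bump a b k x *\<^sub>R w x) \<le> norm (indicator {-(\<bar>a\<bar>+\<bar>b\<bar>)..\<bar>a\<bar>+\<bar>b\<bar>} x *\<^sub>R w x)" for k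
      proof (rule AE_I2)
        fix x
        show "norm (bump a b k x *\<^sub>R w x) \<le> norm (indicator {-(\<bar>a\<bar>+\<bar>b\<bar>)..\<bar>a\<bar>+\<bar>b\<bar>} x *\<^sub>R w x)"
        proof (cases "x \<in> {a<..<b}")
          case True
          then have "x \<in> {-(\<bar>a\<bar>+\<bar>b\<bar>)..\<bar>a\<bar>+\<bar>b\<bar>}" by auto
          then show ?thesis using bump_bounds(1,2)[of a b k x] by (simp add: mult_left_le_one_le)
        qed (simp add: bump_bounds)
      qed
    qed measurable
    then have "(\<lambda>k::nat. 0) \<longlonglongrightarrow> (LBINT x. indicator {a<..<b} x *\<^sub>R w x)"
      using 0[OF bump_test] by simp
    then show ?thesis by (simp add: LIMSEQ_const_iff set_lebesgue_integral_def)
  qed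
  have "AE x in lborel. indicator {- real n<..<real n} x *\<^sub>R w x = 0" for n :: nat
  proof (rule integral_zero_on_intervals)
    have "integrable lborel (\<lambda>x. indicator {- real n<..<real n} x *\<^sub>R (indicator {- real n..real n} x *\<^sub>R w x))"
      using w[unfolded loc_int_def set_integrable_def, rule_format, of "real n"]
      by (rule integrable_mult_indicator[rotated]) simp
    also have "(\<lambda>x. indicator {- real n<..<real n} x *\<^sub>R (indicator {- real n..real n} x *\<^sub>R w x)) = 
       (\<lambda>x. indicator {- real n<..<real n} x *\<^sub>R w x)" by (auto simp: indicator_def)
    finally show "integrable lborel (\<lambda>x. indicator {- real n<..<real n} x *\<^sub>R w x)" .
    fix a b :: real
    have "(LBINT x:{a<..<b}. indicator {- real n<..<real n} x *\<^sub>R w x) = (LBINT x:{max a (- real n)<..<min b (real n)}. w x)"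
      unfolding set_lebesgue_integral_def by (intro Bochner_Integration.integral_cong) (auto simp: indicator_def)
    then show "(LBINT x:{a<..<b}. indicator {- real n<..<real n} x *\<^sub>R w x) = 0" by (simp add: int0)
  qed
  then have "AE x in lborel. \<forall>n::nat. indicator {- real n<..<real n} x *\<^sub>R w x = 0"
    by (subst AE_all_countable) blast
  then show ?thesis
  proof eventually_elim
    case (elim x)
    obtain N :: nat where "\<bar>x\<bar> < real N" using reals_Archimedean2 by blast
    then show ?case using elim[rule_format, of N] by (auto simp: indicator_def split: if_splits)
  qed
qed

text \<open>
  Subtracting a multiple of a fixed bump \<open>\<theta>\<close> from a test function makes its
  integral zero, and then it is the derivative of a test function. Hence \<open>w\<close> minus a
  constant is annihilated by all test functions.
\<close>

lemma du_Bois_Reymond: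
  assumes w: "loc_int w" and 0: "\<And>\<phi>. \<phi> \<in> test_functions \<Longrightarrow> (LBINT x. deriv \<phi> x *\<^sub>R w x) = 0"
  shows "\<exists>c. AE x in lborel. w x = c"
proof -
  have one: "loc_int (\<lambda>x. 1)" by (intro loc_int_continuous) simp
  have itest: "integrable lborel \<phi>" if "\<phi> \<in> test_functions" for \<phi>
  proof -
    have "integrable lborel (\<lambda>x. \<phi> x *\<^sub>R (1::complex))" by (rule test_function_integrable[OF that one])
    then have "integrable lborel (\<lambda>x. Re (\<phi> x *\<^sub>R (1::complex)))" by (rule integrable_Re)
    then show ?thesis by simp
  qed
  define \<theta> where "\<theta> = bump 0 1 0"
  define I where "I = (LBINT x. \<theta> x)"
  have \<theta>: "\<theta> \<in> test_functions" unfolding \<theta>_def by (rule bump_test)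
  have "I \<noteq> 0"
  proof
    assume "I = 0"
    then have "AE x in lborel. \<theta> x = 0"
      unfolding I_def using itest[OF \<theta>] integral_nonneg_eq_0_iff_AE[of lborel \<theta>] by (simp add: \<theta>_def bump_bounds)
    then have "AE x in lborel. x \<notin> {0<..<1::real}"
      by eventually_elim (use bump_bounds(4)[of _ 0 1 0] in \<open>force simp: \<theta>_def\<close>)
    then have "emeasure lborel {0<..<1::real} = 0"
      by (subst (asm) AE_iff_measurable[where N="{0<..<1::real}"]) auto
    then show False by simp
  qed
  define c where "c = (LBINT x. \<theta> x *\<^sub>R w x) / of_real I"
  have "AE x in lborel. w x - c = 0"
  proof (rule fundamental_lemma_variations)
    show "loc_int (\<lambda>x. w x - c)" using loc_int_diff[OF w loc_int_cmult[OF one, of c]] by simp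
    fix \<phi> assume \<phi>: "\<phi> \<in> test_functions"
    define J where "J = (LBINT x. \<phi> x)"
    define \<zeta> where "\<zeta> x = \<phi> x - (J / I) * \<theta> x" for x
    have sm: "smooth \<zeta>" unfolding \<zeta>_def using \<phi> \<theta> by (intro smooth_diff_mult) (auto simp: test_functions_iff)
    from \<phi> \<theta> obtain R1 R2 where R12: "\<And>x. \<bar>x\<bar> > R1 \<Longrightarrow> \<phi> x = 0" "\<And>x. \<bar>x\<bar> > R2 \<Longrightarrow> \<theta> x = 0" 
      unfolding test_functions_iff by metis
    \<comment> \<open>The function \<open>\<zeta>\<close> vanishes at \<open>\<plusminus>R\<close> itself, not only beyond.\<close>
    define R where "R = max 0 (max R1 R2) + 1"
    have R: "\<zeta> x = 0" if "\<bar>x\<bar> \<ge> R" for x using that R12[of x] by (auto simp: \<zeta>_def R_def)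
    have "(LBINT x. \<zeta> x) = 0"
      unfolding \<zeta>_def using itest[OF \<phi>] itest[OF \<theta>] \<open>I \<noteq> 0\<close> by (simp add: J_def I_def)
    obtain Z where Z: "\<And>x. (Z has_vector_derivative \<zeta> x) (at x)" "Z (-R) = 0"
      using antiderivative_exists[OF smooth_continuous[OF sm], of "-R" 0] by blast
    then have Z': "(Z has_real_derivative \<zeta> x) (at x)" for x by (simp add: has_real_derivative_iff_has_vector_derivative)
    have ZR: "Z R = 0"
    proof -
      have "(LBINT x. indicator {-R..R} x *\<^sub>R \<zeta> x) = Z R - Z (-R)"
        using smooth_continuous[OF sm] Z
        by (intro integral_FTC_atLeastAtMost) (auto simp: R_def intro: continuous_on_subset has_vector_derivative_at_within)
      also have "(\<lambda>x. indicator {-R..R} x *\<^sub>R \<zeta> x) = \<zeta>" 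
      proof
        fix x show "indicator {-R..R} x *\<^sub>R \<zeta> x = \<zeta> x"
          using R[of x] by (cases "\<bar>x\<bar> \<le> R") (auto simp: indicator_def abs_le_iff)
      qed
      finally show ?thesis using \<open>(LBINT x. \<zeta> x) = 0\<close> Z(2) by simp
    qed
    have "Z x = 0" if "\<bar>x\<bar> > R" for x
    proof (cases "x > 0")
      case True
      have "Z x = Z R"
        by (rule DERIV_isconst_end[of R x Z])
           (use that True R in \<open>auto intro!: DERIV_continuous_on[OF DERIV_subset[OF Z']] DERIV_cong[OF Z']\<close>)
      then show ?thesis using ZR by simp
    next
      case False
      have "Z (-R) = Z x"
        by (rule DERIV_isconst_end[of x "-R" Z])
           (use that False R in \<open>auto intro!: DERIV_continuous_on[OF DERIV_subset[OF Z']] DERIV_cong[OF Z']\<close>)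
      then show ?thesis using Z by simp
    qed
    then have "Z \<in> test_functions"
      using smooth_primitive[OF Z' sm] by (auto simp: test_functions_iff)
    moreover have "deriv Z = \<zeta>" using Z' by (auto intro!: DERIV_imp_deriv)
    ultimately have "(LBINT x. \<zeta> x *\<^sub>R w x) = 0" using 0 by metis
    moreover have "(\<lambda>x. \<zeta> x *\<^sub>R w x) = (\<lambda>x. \<phi> x *\<^sub>R w x - (J / I) *\<^sub>R (\<theta> x *\<^sub>R w x))"
      by (simp add: \<zeta>_def scaleR_left_diff_distrib)
    moreover have "(LBINT x. \<phi> x *\<^sub>R w x - (J / I) *\<^sub>R (\<theta> x *\<^sub>R w x))
        = (LBINT x. \<phi> x *\<^sub>R w x) - (J / I) *\<^sub>R (LBINT x. \<theta> x *\<^sub>R w x)"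
      using test_function_integrable[OF \<phi> w] test_function_integrable[OF \<theta> w]
      by (subst Bochner_Integration.integral_diff) (auto simp del: scaleR_scaleR)
    ultimately have "(LBINT x. \<phi> x *\<^sub>R w x) = (J / I) *\<^sub>R (LBINT x. \<theta> x *\<^sub>R w x)"
      by simp
    also have "\<dots> = J *\<^sub>R c" using \<open>I \<noteq> 0\<close> by (simp add: c_def scaleR_conv_of_real)
    finally have A: "(LBINT x. \<phi> x *\<^sub>R w x) = J *\<^sub>R c" .
    have "(LBINT x. \<phi> x *\<^sub>R (w x - c)) = (LBINT x. \<phi> x *\<^sub>R w x - \<phi> x *\<^sub>R c)"
      by (simp add: scaleR_right_diff_distrib)
    also have "\<dots> = (LBINT x. \<phi> x *\<^sub>R w x) - (LBINT x. \<phi> x *\<^sub>R c)"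
      using test_function_integrable[OF \<phi> w] itest[OF \<phi>] by (intro Bochner_Integration.integral_diff) auto
    also have "(LBINT x. \<phi> x *\<^sub>R c) = J *\<^sub>R c" using itest[OF \<phi>] by (simp add: J_def)
    finally show "(LBINT x. \<phi> x *\<^sub>R (w x - c)) = 0" using A by simp
  qed
  then show ?thesis by (intro exI[of _ c]) simp
qed

section \<open>Primitives of locally integrable functions\<close>

text \<open>
  The signed indicator function of the interval between \<open>0\<close> and \<open>x\<close>. It
  writes the primitive based at \<open>0\<close> as one integral over the line, for both signs of
  \<open>x\<close>.
\<close>

definition step_kernel :: "real \<Rightarrow> real \<Rightarrow> real" where
  "step_kernel x y = (if 0 < y \<and> y \<le> x then 1 else if x \<le> y \<and> y \<le> 0 then - 1 else 0)"

definition indef_integral :: "(real \<Rightarrow> complex) \<Rightarrow> real \<Rightarrow> complex" where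
  "indef_integral g x = (LBINT y. step_kernel x y *\<^sub>R g y)"

lemma step_kernel_measurable [measurable]:
  "(\<lambda>(x, y). step_kernel x y) \<in> borel_measurable (borel \<Otimes>\<^sub>M borel)"
  "step_kernel x \<in> borel_measurable borel" "(\<lambda>x. step_kernel x y) \<in> borel_measurable borel"
  unfolding step_kernel_def[abs_def] by measurable

lemma step_kernel_bound: "\<bar>step_kernel x y\<bar> \<le> 1" "\<bar>x\<bar> \<le> R \<Longrightarrow> \<bar>y\<bar> > R \<Longrightarrow> step_kernel x y = 0"
  by (auto simp: step_kernel_def)

lemma indef_integral_continuous:
  assumes g: "loc_int g"
  shows "continuous_on UNIV (indef_integral g)"
proof (rule continuous_on_sequentiallyI)
  have [measurable]: "g \<in> borel_measurable borel" by (rule loc_int_measurable[OF g])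
  fix xs :: "nat \<Rightarrow> real" and a :: real
  assume xs: "xs \<longlonglongrightarrow> a"
  then have "Bseq xs" by (intro convergent_imp_Bseq convergentI)
  then obtain B where B: "\<And>n. \<bar>xs n\<bar> \<le> B" by (auto simp: Bseq_def)
  define R where "R = max B \<bar>a\<bar>"
  have R: "\<bar>xs n\<bar> \<le> R" "\<bar>a\<bar> \<le> R" for n using B[of n] by (auto simp: R_def)
  show "(\<lambda>n. indef_integral g (xs n)) \<longlonglongrightarrow> indef_integral g a"
    unfolding indef_integral_def
  proof (rule integral_dominated_convergence[where w = "\<lambda>y. norm (indicator {-R..R} y *\<^sub>R g y)"])
    show "integrable lborel (\<lambda>y. norm (indicator {-R..R} y *\<^sub>R g y))"
      using g unfolding loc_int_def set_integrable_def by (intro integrable_norm) blast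
    show "AE y in lborel. norm (step_kernel (xs n) y *\<^sub>R g y) \<le> norm (indicator {-R..R} y *\<^sub>R g y)" for n
    proof (rule AE_I2)
      fix y
      show "norm (step_kernel (xs n) y *\<^sub>R g y) \<le> norm (indicator {-R..R} y *\<^sub>R g y)"
        using step_kernel_bound(1)[of "xs n" y] step_kernel_bound(2)[OF R(1), of y n]
        by (cases "\<bar>y\<bar> \<le> R") (auto simp: indicator_def abs_le_iff mult_left_le_one_le)
    qed
    show "AE y in lborel. (\<lambda>n. step_kernel (xs n) y *\<^sub>R g y) \<longlonglongrightarrow> step_kernel a y *\<^sub>R g y"
      using AE_lborel_singleton[of a]
    proof eventually_elim
      case (elim y)
      have "\<forall>\<^sub>F n in sequentially. step_kernel (xs n) y = step_kernel a y"
      proof (cases "y < a")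
        case True
        from order_tendstoD(1)[OF xs this] show ?thesis
          by eventually_elim (use True in \<open>auto simp: step_kernel_def\<close>)
      next
        case False
        then have "a < y" using elim by auto
        from order_tendstoD(2)[OF xs this] show ?thesis
          by eventually_elim (use \<open>a < y\<close> in \<open>auto simp: step_kernel_def\<close>)
      qed
      then have "\<forall>\<^sub>F n in sequentially. step_kernel (xs n) y *\<^sub>R g y = step_kernel a y *\<^sub>R g y"
        by eventually_elim simp
      then show ?case by (rule tendsto_eventually)
    qed
  qed measurable
qed

lemma c1_test_integral_step_kernel:
  assumes t: "c1_test \<phi> \<phi>'"
  shows "(LBINT x. \<phi>' x * step_kernel x y) = - \<phi> y"
proof -
  obtain R0 where R0: "R0 > 0" "\<And>x. \<bar>x\<bar> > R0 \<Longrightarrow> \<phi> x = 0" "\<And>x. \<bar>x\<bar> > R0 \<Longrightarrow> \<phi>' x = 0"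
    using c1_test_zero[OF t] by blast
  define R where "R = max R0 \<bar>y\<bar> + 1"
  have R: "R > \<bar>y\<bar>" "\<And>x. \<bar>x\<bar> \<ge> R \<Longrightarrow> \<phi> x = 0" "\<And>x. \<bar>x\<bar> \<ge> R \<Longrightarrow> \<phi>' x = 0"
    using R0 by (auto simp: R_def)
  have ftc: "(LBINT x. indicator {a..b} x *\<^sub>R \<phi>' x) = \<phi> b - \<phi> a" if "a \<le> b" for a b
    using that t c1_test_continuous(2)[OF t]
    by (intro integral_FTC_atLeastAtMost)
       (auto simp: c1_test_def has_real_derivative_iff_has_vector_derivative
          intro: continuous_on_subset has_vector_derivative_at_within)
  show ?thesis
  proof (cases "y > 0")
    case True
    have "(\<lambda>x. \<phi>' x * step_kernel x y) = (\<lambda>x. indicator {y..R} x *\<^sub>R \<phi>' x)"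
    proof
      fix x show "\<phi>' x * step_kernel x y = indicator {y..R} x *\<^sub>R \<phi>' x"
        using True R(3)[of x] by (cases "x \<le> R") (auto simp: step_kernel_def indicator_def)
    qed
    then have "(LBINT x. \<phi>' x * step_kernel x y) = \<phi> R - \<phi> y" using ftc[of y R] R(1) by simp
    then show ?thesis using R(2)[of R] R(1) by simp
  next
    case False
    have "(\<lambda>x. \<phi>' x * step_kernel x y) = (\<lambda>x. - (indicator {-R..y} x *\<^sub>R \<phi>' x))"
    proof
      fix x show "\<phi>' x * step_kernel x y = - (indicator {-R..y} x *\<^sub>R \<phi>' x)"
        using False R(3)[of x] by (cases "- R \<le> x") (auto simp: step_kernel_def indicator_def)
    qed
    then have "(LBINT x. \<phi>' x * step_kernel x y) = - (\<phi> y - \<phi> (-R))" using ftc[of "-R" y] R(1) by simp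
    then show ?thesis using R(2)[of "-R"] R(1) by simp
  qed
qed

text \<open>
  Integration by parts for a primitive of a merely integrable function is an exchange of two
  integrations; the inner integral of \<open>\<phi>'\<close> against the kernel is
  \<open>- \<phi>\<close>.
\<close>

lemma wderiv_indef_integral:
  assumes g: "loc_int g"
  shows "wderiv (indef_integral g) g"
  unfolding wderiv_def
proof (intro conjI allI impI)
  have gm[measurable]: "g \<in> borel_measurable borel" by (rule loc_int_measurable[OF g])
  show "loc_int (indef_integral g)" by (intro loc_int_continuous indef_integral_continuous g)
  show "loc_int g" by (rule g)
  fix \<phi> \<phi>' assume t: "c1_test \<phi> \<phi>'"
  obtain R where R: "R > 0" "\<And>x. \<bar>x\<bar> > R \<Longrightarrow> \<phi> x = 0" "\<And>x. \<bar>x\<bar> > R \<Longrightarrow> \<phi>' x = 0"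
    using c1_test_zero[OF t] by blast
  have [measurable]: "\<phi>' \<in> borel_measurable borel"
    by (intro borel_measurable_continuous_onI c1_test_continuous[OF t])
  define f where "f x y = \<phi>' x *\<^sub>R (step_kernel x y *\<^sub>R g y)" for x y
  define G where "G y = indicator {-R..R} y *\<^sub>R g y" for y
  have G: "integrable lborel G" using g unfolding G_def loc_int_def set_integrable_def by blast
  have \<phi>': "integrable lborel \<phi>'"
  proof -
    have "integrable lborel (\<lambda>x. \<phi>' x *\<^sub>R (1::complex))"
      by (intro c1_test_integrable'(2)[OF t] loc_int_continuous) simp
    from integrable_Re[OF this] show ?thesis by simp
  qed
  have bound: "norm (f x y) \<le> \<bar>\<phi>' x\<bar> * norm (G y)" for x y
  proof (cases "\<bar>x\<bar> \<le> R")
    case True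
    show ?thesis
    proof (cases "\<bar>y\<bar> \<le> R")
      case True
      then have "norm (f x y) = \<bar>\<phi>' x\<bar> * (\<bar>step_kernel x y\<bar> * norm (G y))"
        by (simp add: f_def G_def indicator_def abs_le_iff abs_mult)
      also have "\<dots> \<le> \<bar>\<phi>' x\<bar> * norm (G y)"
        using step_kernel_bound(1)[of x y] by (intro mult_left_mono mult_left_le_one_le) auto
      finally show ?thesis .
    next
      case False
      then show ?thesis using True step_kernel_bound(2)[of x R y] by (simp add: f_def)
    qed
  next
    case False
    then show ?thesis using R(3)[of x] by (simp add: f_def)
  qed
  have fm: "case_prod f \<in> borel_measurable (lborel \<Otimes>\<^sub>M lborel)"
    unfolding f_def by measurable
  have "integrable (lborel \<Otimes>\<^sub>M lborel) (\<lambda>(x, y). \<bar>\<phi>' x\<bar> * norm (G y))"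
  proof (rule lborel_pair.Fubini_integrable)
    show "(\<lambda>(x, y). \<bar>\<phi>' x\<bar> * norm (G y)) \<in> borel_measurable (lborel \<Otimes>\<^sub>M lborel)"
      unfolding G_def by measurable
    show "integrable lborel (\<lambda>x. LBINT y. norm (case (x, y) of (x, y) \<Rightarrow> \<bar>\<phi>' x\<bar> * norm (G y)))"
      using \<phi>' by (simp add: abs_mult integrable_abs)
    show "AE x in lborel. integrable lborel (\<lambda>y. case (x, y) of (x, y) \<Rightarrow> \<bar>\<phi>' x\<bar> * norm (G y))"
      using G by simp
  qed
  then have "integrable (lborel \<Otimes>\<^sub>M lborel) (case_prod f)"
    by (rule Bochner_Integration.integrable_bound[OF _ fm]) (use bound in \<open>auto simp: case_prod_beta\<close>)
  from lborel_pair.Fubini_integral[OF this]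
  have fub: "(LBINT y. LBINT x. f x y) = (LBINT x. LBINT y. f x y)" .
  have "(LBINT x. \<phi>' x *\<^sub>R indef_integral g x) = (LBINT x. LBINT y. f x y)"
    unfolding f_def indef_integral_def by (simp del: scaleR_scaleR)
  also have "\<dots> = (LBINT y. LBINT x. f x y)" by (simp only: fub)
  also have "\<dots> = (LBINT y. - (\<phi> y *\<^sub>R g y))"
  proof (rule Bochner_Integration.integral_cong)
    fix y
    have "(\<lambda>x. f x y) = (\<lambda>x. (\<phi>' x * step_kernel x y) *\<^sub>R g y)" by (simp add: f_def)
    moreover have "(LBINT x. (\<phi>' x * step_kernel x y) *\<^sub>R g y) = (LBINT x. \<phi>' x * step_kernel x y) *\<^sub>R g y"
      by (rule integral_scaleR_left)
         (use step_kernel_bound in \<open>auto intro!: Bochner_Integration.integrable_bound[OF \<phi>'] simp: abs_mult mult_left_le\<close>)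
    ultimately show "(LBINT x. f x y) = - (\<phi> y *\<^sub>R g y)"
      by (simp add: c1_test_integral_step_kernel[OF t])
  qed simp
  finally show "(LBINT x. \<phi>' x *\<^sub>R indef_integral g x) = - (LBINT x. \<phi> x *\<^sub>R g x)" by simp
qed

section \<open>The Sobolev space of order two\<close>

lemma wderiv_zero_const:
  assumes "wderiv u (\<lambda>x. 0)" shows "\<exists>c. AE x in lborel. u x = c"
  using assms test_function_c1 by (intro du_Bois_Reymond) (auto simp: wderiv_def)

lemma wderiv_representative:
  assumes "wderiv u g" shows "\<exists>c. AE x in lborel. u x = indef_integral g x + c"
proof -
  have g: "loc_int g" using assms by (simp add: wderiv_def)
  have "wderiv (\<lambda>x. u x - indef_integral g x) (\<lambda>x. 0)"
    using wderiv_diff[OF assms wderiv_indef_integral[OF g]] by simp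
  from wderiv_zero_const[OF this] obtain c where "AE x in lborel. u x - indef_integral g x = c" ..
  then have "AE x in lborel. u x = indef_integral g x + c" by eventually_elim (simp add: algebra_simps)
  then show ?thesis ..
qed

lemma wderiv_const: "wderiv (\<lambda>x. c) (\<lambda>x. 0)"
  by (rule wderiv_classical[where S = "{}"]) (auto intro: loc_int_continuous)

text \<open>
  A weak derivative tested against smooth functions is one tested against
  \<open>C\<^sup>1\<close> functions: \<open>u\<close> and the primitive of \<open>g\<close> have
  the same smooth weak derivative, so they differ by a constant, and the primitive admits all
  \<open>C\<^sup>1\<close> test functions.
\<close>

lemma has_weak_deriv_1_iff:
  assumes "loc_int u" "loc_int g"
  shows "has_weak_deriv 1 u g \<longleftrightarrow> wderiv u g"
proof
  assume weak: "has_weak_deriv 1 u g"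
  note W = wderiv_indef_integral[OF assms(2)]
  have li: "loc_int (\<lambda>x. u x - indef_integral g x)"
    using W assms(1) by (intro loc_int_diff) (auto simp: wderiv_def)
  have "\<exists>c. AE x in lborel. u x - indef_integral g x = c"
  proof (rule du_Bois_Reymond[OF li])
    fix \<phi> assume \<phi>: "\<phi> \<in> test_functions"
    note t = test_function_c1[OF \<phi>]
    have "(LBINT x. deriv \<phi> x *\<^sub>R (u x - indef_integral g x)) =
       (LBINT x. deriv \<phi> x *\<^sub>R u x) - (LBINT x. deriv \<phi> x *\<^sub>R indef_integral g x)"
      using c1_test_integrable'(2)[OF t] assms W by (simp add: scaleR_right_diff_distrib wderiv_def)
    also have "(LBINT x. deriv \<phi> x *\<^sub>R u x) = - (LBINT x. \<phi> x *\<^sub>R g x)"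
      using weak \<phi> by (simp add: has_weak_deriv_def)
    also have "(LBINT x. deriv \<phi> x *\<^sub>R indef_integral g x) = - (LBINT x. \<phi> x *\<^sub>R g x)"
      using W t by (simp add: wderiv_def)
    finally show "(LBINT x. deriv \<phi> x *\<^sub>R (u x - indef_integral g x)) = 0" by simp
  qed
  then obtain c where c: "AE x in lborel. u x - indef_integral g x = c" ..
  have "wderiv (\<lambda>x. indef_integral g x + c) (\<lambda>x. g x + 0)"
    by (rule wderiv_add[OF W wderiv_const])
  moreover have "AE x in lborel. indef_integral g x + c = u x"
    using c by eventually_elim (simp add: algebra_simps)
  ultimately show "wderiv u g"
    using wderiv_cong[of "\<lambda>x. indef_integral g x + c" "\<lambda>x. g x + 0" u g]
      assms[THEN loc_int_measurable] by (simp add: ae_eq_def)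
next
  assume W: "wderiv u g"
  show "has_weak_deriv 1 u g"
    unfolding has_weak_deriv_def
  proof
    fix \<phi> assume "\<phi> \<in> test_functions"
    with W test_function_c1[OF this]
    show "(LBINT x. (deriv ^^ 1) \<phi> x *\<^sub>R u x) = (- 1) ^ 1 * (LBINT x. \<phi> x *\<^sub>R g x)"
      by (simp add: wderiv_def)
  qed
qed

lemma has_weak_deriv_2:
  assumes "wderiv u v" shows "has_weak_deriv 2 u g \<longleftrightarrow> has_weak_deriv 1 v g"
proof -
  have "(LBINT x. (deriv ^^ 2) \<phi> x *\<^sub>R u x) = - (LBINT x. (deriv ^^ 1) \<phi> x *\<^sub>R v x)" if \<phi>: "\<phi> \<in> test_functions" for \<phi>
    using assms test_function_c1[OF test_function_deriv[OF \<phi>]] by (simp add: wderiv_def numeral_2_eq_2)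
  then show ?thesis unfolding has_weak_deriv_def
    by (intro ball_cong refl) (simp, metis minus_minus)
qed

lemma has_weak_deriv_unique:
  assumes "has_weak_deriv k u g" "has_weak_deriv k u h" "loc_int g" "loc_int h"
  shows "ae_eq g h"
proof -
  have "AE x in lborel. g x - h x = 0"
  proof (rule fundamental_lemma_variations)
    show "loc_int (\<lambda>x. g x - h x)" using assms by (intro loc_int_diff)
    fix \<phi> assume \<phi>: "\<phi> \<in> test_functions"
    then have "(- 1) ^ k * (LBINT x. \<phi> x *\<^sub>R g x) = (- 1) ^ k * (LBINT x. \<phi> x *\<^sub>R h x)"
      using assms(1,2) unfolding has_weak_deriv_def by metis
    then have "(LBINT x. \<phi> x *\<^sub>R g x) = (LBINT x. \<phi> x *\<^sub>R h x)" by simp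
    then show "(LBINT x. \<phi> x *\<^sub>R (g x - h x)) = 0"
      using test_function_integrable[OF \<phi>] assms(3,4) by (simp add: scaleR_right_diff_distrib)
  qed
  then show ?thesis unfolding ae_eq_def by eventually_elim simp
qed

lemma sobolev_H2_D:
  assumes "u \<in> sobolev_H 2"
  obtains v where "u \<in> L2" "v \<in> L2" "weak_deriv 2 u \<in> L2" "wderiv u v" "wderiv v (weak_deriv 2 u)"
proof -
  from assms have u: "u \<in> L2" and ex: "\<And>k. k \<le> 2 \<Longrightarrow> \<exists>g\<in>L2. has_weak_deriv k u g"
    by (auto simp: sobolev_H_def)
  from ex[of 1] obtain v where v: "v \<in> L2" "has_weak_deriv 1 u v" by auto
  have "\<exists>g. g \<in> L2 \<and> has_weak_deriv 2 u g" using ex[of 2] by auto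
  from someI_ex[OF this] have w: "weak_deriv 2 u \<in> L2" "has_weak_deriv 2 u (weak_deriv 2 u)"
    by (auto simp: weak_deriv_def)
  have W: "wderiv u v" using v u by (simp add: has_weak_deriv_1_iff loc_int_L2 del: One_nat_def)
  with w v have "wderiv v (weak_deriv 2 u)" by (simp add: has_weak_deriv_2 has_weak_deriv_1_iff loc_int_L2 del: One_nat_def)
  with u v w W show ?thesis by (intro that)
qed

text \<open>
  The second conclusion identifies the representative chosen by \<open>weak_deriv\<close>, so the
  action of the operator can be computed from any explicit second derivative.
\<close>

lemma sobolev_H2_I:
  assumes "u \<in> L2" "v \<in> L2" "g \<in> L2" "wderiv u v" "wderiv v g"
  shows "u \<in> sobolev_H 2" "ae_eq (weak_deriv 2 u) g"
proof -
  have w: "has_weak_deriv 1 u v" "has_weak_deriv 2 u g"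
    using assms by (simp_all add: has_weak_deriv_2 has_weak_deriv_1_iff loc_int_L2 del: One_nat_def)
  have "has_weak_deriv 0 u u" by (simp add: has_weak_deriv_def)
  with assms w show *: "u \<in> sobolev_H 2"
    by (auto simp: sobolev_H_def le_Suc_eq numeral_2_eq_2)
  from sobolev_H2_D[OF *] obtain v' where "v' \<in> L2" "weak_deriv 2 u \<in> L2" "wderiv u v'" "wderiv v' (weak_deriv 2 u)"
    by metis
  then have "has_weak_deriv 2 u (weak_deriv 2 u)" by (simp add: has_weak_deriv_2 has_weak_deriv_1_iff loc_int_L2 del: One_nat_def)
  from has_weak_deriv_unique[OF this w(2)] show "ae_eq (weak_deriv 2 u) g"
    using \<open>weak_deriv 2 u \<in> L2\<close> assms(3) by (simp add: loc_int_L2)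
qed

section \<open>Square-integrable functions\<close>

lemma L2_measurable: "u \<in> L2 \<Longrightarrow> u \<in> borel_measurable borel"
  by (simp add: L2_def)

lemma L2_norm_power2: "(L2_norm u)\<^sup>2 = (LBINT x. (cmod (u x))\<^sup>2)"
  by (simp add: L2_norm_def)

lemma L2_norm_nonneg: "L2_norm u \<ge> 0"
  by (simp add: L2_norm_def)

lemma L2_bound:
  assumes "u \<in> L2" "v \<in> borel_measurable borel" "AE x in lborel. cmod (v x) \<le> B * cmod (u x)" "B \<ge> 0"
  shows "v \<in> L2" "L2_norm v \<le> B * L2_norm u"
proof -
  have [measurable]: "u \<in> borel_measurable borel" "v \<in> borel_measurable borel"
    using assms by (auto simp: L2_measurable)
  have *: "AE x in lborel. (cmod (v x))\<^sup>2 \<le> B\<^sup>2 * (cmod (u x))\<^sup>2"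
    using assms(3) by eventually_elim (metis norm_ge_zero power_mono power_mult_distrib)
  have i: "integrable lborel (\<lambda>x. B\<^sup>2 * (cmod (u x))\<^sup>2)" using assms(1) by (simp add: L2_def)
  have j: "integrable lborel (\<lambda>x. (cmod (v x))\<^sup>2)"
    by (rule Bochner_Integration.integrable_bound[OF i]) (use * in \<open>auto simp: abs_mult\<close>)
  then show "v \<in> L2" by (simp add: L2_def)
  have "(LBINT x. (cmod (v x))\<^sup>2) \<le> (LBINT x. B\<^sup>2 * (cmod (u x))\<^sup>2)"
    by (rule integral_mono_AE[OF j i *])
  then have "(L2_norm v)\<^sup>2 \<le> (B * L2_norm u)\<^sup>2" by (simp add: L2_norm_power2 power_mult_distrib)
  then show "L2_norm v \<le> B * L2_norm u"
    by (rule power2_le_imp_le) (use assms(4) L2_norm_nonneg in simp)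
qed

lemma L2_cong:
  assumes "u \<in> L2" "ae_eq u v" "v \<in> borel_measurable borel"
  shows "v \<in> L2" "L2_norm v = L2_norm u"
proof -
  have 1: "AE x in lborel. cmod (v x) \<le> 1 * cmod (u x)" "AE x in lborel. cmod (u x) \<le> 1 * cmod (v x)"
    using assms(2) unfolding ae_eq_def by (auto elim: eventually_mono)
  show v: "v \<in> L2" using L2_bound(1)[OF assms(1,3) 1(1)] by simp
  show "L2_norm v = L2_norm u"
    using L2_bound(2)[OF assms(1,3) 1(1)] L2_bound(2)[OF v L2_measurable[OF assms(1)] 1(2)] by simp
qed

lemma L2_add:
  assumes "u \<in> L2" "v \<in> L2" shows "(\<lambda>x. u x + v x) \<in> L2"
proof -
  have [measurable]: "u \<in> borel_measurable borel" "v \<in> borel_measurable borel"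
    using assms by (auto simp: L2_measurable)
  have "(cmod (u x + v x))\<^sup>2 \<le> 2 * (cmod (u x))\<^sup>2 + 2 * (cmod (v x))\<^sup>2" for x
  proof -
    have "(cmod (u x + v x))\<^sup>2 \<le> (cmod (u x) + cmod (v x))\<^sup>2"
      by (intro power_mono norm_triangle_ineq) simp
    then show ?thesis using sum_squares_bound[of "cmod (u x)" "cmod (v x)"] by (simp add: power2_sum)
  qed
  note le = this
  have i: "integrable lborel (\<lambda>x. 2 * (cmod (u x))\<^sup>2 + 2 * (cmod (v x))\<^sup>2)"
    using assms by (simp add: L2_def)
  have "integrable lborel (\<lambda>x. (cmod (u x + v x))\<^sup>2)"
    by (rule Bochner_Integration.integrable_bound[OF i]) (use le in \<open>auto intro!: AE_I2\<close>)
  then show ?thesis by (simp add: L2_def)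
qed

lemma L2_cmult: "u \<in> L2 \<Longrightarrow> (\<lambda>x. c * u x) \<in> L2"
  using L2_bound(1)[of u "\<lambda>x. c * u x" "cmod c"] by (auto simp: L2_def norm_mult)

lemma L2_diff: "u \<in> L2 \<Longrightarrow> v \<in> L2 \<Longrightarrow> (\<lambda>x. u x - v x) \<in> L2"
  using L2_add[of u "\<lambda>x. (-1) * v x"] L2_cmult[of v "-1"] by simp

lemma L2_scale:
  fixes c :: "real \<Rightarrow> real"
  assumes u: "u \<in> L2" and c: "c \<in> borel_measurable borel" "\<And>x. \<bar>c x\<bar> \<le> B"
  shows "(\<lambda>x. c x *\<^sub>R u x) \<in> L2" "L2_norm (\<lambda>x. c x *\<^sub>R u x) \<le> B * L2_norm u"
proof -
  have B: "B \<ge> 0" using c(2)[of 0] by simp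
  have m: "(\<lambda>x. c x *\<^sub>R u x) \<in> borel_measurable borel"
    using L2_measurable[OF u] c(1) by measurable
  have "AE x in lborel. cmod (c x *\<^sub>R u x) \<le> B * cmod (u x)"
    using c(2) by (intro AE_I2) (auto intro: mult_right_mono)
  from L2_bound[OF u m this B] show "(\<lambda>x. c x *\<^sub>R u x) \<in> L2" "L2_norm (\<lambda>x. c x *\<^sub>R u x) \<le> B * L2_norm u" .
qed

text \<open>This excludes the growing solution on a half-line.\<close>

lemma not_L2_lower_bound:
  assumes u: "u \<in> L2" and A: "A \<in> sets borel" "emeasure lborel A = \<infinity>"
    and \<delta>: "\<delta> > 0" "AE x in lborel. x \<in> A \<longrightarrow> \<delta> \<le> cmod (u x)"
  shows False
proof -
  have i: "integrable lborel (\<lambda>x. (cmod (u x))\<^sup>2)" using u by (simp add: L2_def)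
  have "integrable lborel (\<lambda>x. \<delta>\<^sup>2 * indicator A x)"
  proof (rule Bochner_Integration.integrable_bound[OF i])
    show "(\<lambda>x. \<delta>\<^sup>2 * indicator A x) \<in> borel_measurable lborel" using A by measurable
    show "AE x in lborel. norm (\<delta>\<^sup>2 * indicat_real A x) \<le> norm ((cmod (u x))\<^sup>2)"
      using \<delta>(2) by eventually_elim (use \<delta>(1) in \<open>auto simp: indicator_def intro!: power_mono\<close>)
  qed
  then have "integrable lborel (indicat_real A)" using \<delta>(1) by simp
  then show False using A by (simp add: integrable_indicator_iff)
qed

lemma L2_norm_zero:
  assumes "u \<in> L2" "L2_norm u = 0" shows "ae_eq u (\<lambda>x. 0)"
proof -
  have "(LBINT x. (cmod (u x))\<^sup>2) = 0" using assms(2) by (metis L2_norm_power2 power_zero_numeral)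
  then have "AE x in lborel. (cmod (u x))\<^sup>2 = 0"
    using assms(1) by (subst (asm) integral_nonneg_eq_0_iff_AE) (auto simp: L2_def)
  then show ?thesis by (simp add: ae_eq_def)
qed

lemma loc_int_reflect: "loc_int u \<Longrightarrow> loc_int (\<lambda>x. u (- x))"
  unfolding loc_int_def set_integrable_def
proof
  fix R assume "\<forall>R. integrable lborel (\<lambda>x. indicat_real {- R..R} x *\<^sub>R u x)"
  then have "integrable lborel (\<lambda>x. indicat_real {- R..R} x *\<^sub>R u x)" ..
  from lborel_integrable_real_affine[OF this, of "-1" 0]
  show "integrable lborel (\<lambda>x. indicat_real {- R..R} x *\<^sub>R u (- x))"
    by (rule back_subst[of "integrable lborel"]) (auto simp: indicator_def fun_eq_iff)
qed

lemma c1_test_reflect: "c1_test \<phi> \<phi>' \<Longrightarrow> c1_test (\<lambda>x. \<phi> (- x)) (\<lambda>x. - \<phi>' (- x))"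
  unfolding c1_test_def using DERIV_mirror[of \<phi>]
  by (auto intro!: continuous_intros intro: continuous_on_compose2[of UNIV \<phi>'])
     (metis abs_minus_cancel)

lemma wderiv_reflect:
  assumes "wderiv u g" shows "wderiv (\<lambda>x. u (- x)) (\<lambda>x. - g (- x))"
  unfolding wderiv_def
proof (intro conjI allI impI)
  have li: "loc_int u" "loc_int g" using assms by (auto simp: wderiv_def)
  show "loc_int (\<lambda>x. u (- x))" by (rule loc_int_reflect[OF li(1)])
  show "loc_int (\<lambda>x. - g (- x))" using loc_int_cmult[OF loc_int_reflect[OF li(2)], of "-1"] by simp
  have refl: "(LBINT x. f (- x)) = (LBINT x. f x)" for f :: "real \<Rightarrow> complex"
    using lborel_integral_real_affine[of "-1" f 0] by simp
  fix \<phi> \<phi>' assume "c1_test \<phi> \<phi>'"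
  note t = c1_test_reflect[OF this]
  have "(LBINT x. \<phi>' x *\<^sub>R u (- x)) = (LBINT x. \<phi>' (- x) *\<^sub>R u x)"
    using refl[of "\<lambda>x. \<phi>' (- x) *\<^sub>R u x"] by simp
  also have "\<dots> = (LBINT x. \<phi> (- x) *\<^sub>R g x)"
    using assms t unfolding wderiv_def by fastforce
  also have "\<dots> = (LBINT x. \<phi> x *\<^sub>R g (- x))"
    using refl[of "\<lambda>x. \<phi> (- x) *\<^sub>R g x"] by simp
  finally show "(LBINT x. \<phi>' x *\<^sub>R u (- x)) = - (LBINT x. \<phi> x *\<^sub>R - g (- x))" by simp
qed

lemma L2_reflect:
  assumes "u \<in> L2" shows "(\<lambda>x. u (- x)) \<in> L2" "L2_norm (\<lambda>x. u (- x)) = L2_norm u"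
proof -
  have "integrable lborel (\<lambda>x. (cmod (u x))\<^sup>2)" using assms by (simp add: L2_def)
  from lborel_integrable_real_affine[OF this, of "-1" 0]
  show "(\<lambda>x. u (- x)) \<in> L2" using L2_measurable[OF assms] by (simp add: L2_def)
  show "L2_norm (\<lambda>x. u (- x)) = L2_norm u"
    unfolding L2_norm_def using lborel_integral_real_affine[of "-1" "\<lambda>x. (cmod (u x))\<^sup>2" 0] by simp
qed

section \<open>First-order equations on the line\<close>

lemma nn_integral_exp_right:
  assumes "\<alpha> > 0"
  shows "(\<integral>\<^sup>+x. ennreal (exp (\<alpha> * (y - x))) * indicator {y..} x \<partial>lborel) = ennreal (1 / \<alpha>)"
proof -
  have "(\<integral>\<^sup>+x. ennreal (exp (\<alpha> * (y - x))) * indicator {y..} x \<partial>lborel) = ennreal (0 - (- exp (\<alpha> * (y - y)) / \<alpha>))"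
  proof (rule nn_integral_FTC_atLeast[where F = "\<lambda>x. - exp (\<alpha> * (y - x)) / \<alpha>"])
    fix x
    show "((\<lambda>x. - exp (\<alpha> * (y - x)) / \<alpha>) has_real_derivative exp (\<alpha> * (y - x))) (at x)"
      using assms by (auto intro!: derivative_eq_intros)
  next
    have "filterlim (\<lambda>x. \<alpha> * x) at_top at_top"
      by (rule filterlim_tendsto_pos_mult_at_top[OF tendsto_const assms filterlim_ident])
    from filterlim_compose[OF exp_at_bot filterlim_compose[OF filterlim_uminus_at_bot_at_top this]]
    have "((\<lambda>x. - (exp (\<alpha> * y) * exp (- (\<alpha> * x))) / \<alpha>) \<longlongrightarrow> - (exp (\<alpha> * y) * 0) / \<alpha>) at_top"
      using assms by (intro tendsto_intros) auto
    then show "((\<lambda>x. - exp (\<alpha> * (y - x)) / \<alpha>) \<longlongrightarrow> 0) at_top"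
      by (simp add: right_diff_distrib exp_diff exp_minus divide_inverse)
  qed auto
  then show ?thesis by simp
qed

lemma nn_integral_exp_left:
  assumes "\<alpha> > 0"
  shows "(\<integral>\<^sup>+y. ennreal (exp (\<alpha> * (y - x))) * indicator {..x} y \<partial>lborel) = ennreal (1 / \<alpha>)"
proof -
  have "(\<integral>\<^sup>+y. ennreal (exp (\<alpha> * (y - x))) * indicator {..x} y \<partial>lborel) =
     (\<integral>\<^sup>+y. ennreal (exp (\<alpha> * (- y - x))) * indicator {..x} (- y) \<partial>lborel)"
    using nn_integral_real_affine[of "\<lambda>y. ennreal (exp (\<alpha> * (y - x))) * indicator {..x} y" "-1" 0] by simp
  also have "\<dots> = (\<integral>\<^sup>+y. ennreal (exp (\<alpha> * (- x - y))) * indicator {- x..} y \<partial>lborel)"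
    by (intro nn_integral_cong) (auto simp: indicator_def algebra_simps)
  finally show ?thesis using nn_integral_exp_right[OF assms, of "- x"] by simp
qed

lemma L2_nn_integral:
  assumes "u \<in> L2" shows "(\<integral>\<^sup>+x. ennreal ((cmod (u x))\<^sup>2) \<partial>lborel) = ennreal ((L2_norm u)\<^sup>2)"
  unfolding L2_norm_power2 using assms by (intro nn_integral_eq_integral) (auto simp: L2_def)

lemma L2_I_nn_integral:
  assumes "u \<in> borel_measurable borel" "(\<integral>\<^sup>+x. ennreal ((cmod (u x))\<^sup>2) \<partial>lborel) \<le> ennreal (B\<^sup>2)" "B \<ge> 0"
  shows "u \<in> L2" "L2_norm u \<le> B"
proof -
  have "integrable lborel (\<lambda>x. (cmod (u x))\<^sup>2)"
    using assms by (intro integrableI_bounded) (auto intro: le_less_trans)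
  then show u: "u \<in> L2" using assms by (simp add: L2_def)
  have "ennreal ((L2_norm u)\<^sup>2) \<le> ennreal (B\<^sup>2)" using assms(2) L2_nn_integral[OF u] by simp
  then have "(L2_norm u)\<^sup>2 \<le> B\<^sup>2" by (simp add: ennreal_le_iff)
  then show "L2_norm u \<le> B" using assms(3) by (rule power2_le_imp_le)
qed

text \<open>
  The solution is the convolution of \<open>g\<close> with \<open>exp (- \<alpha> x)\<close> on
  \<open>x \<ge> 0\<close>. The kernel has mass \<open>1/\<alpha>\<close> in each variable, so
  the Cauchy-Schwarz inequality and Tonelli's theorem give the norm bound (Schur's test).
\<close>

lemma decay_equation_solution:
  assumes \<alpha>: "\<alpha> > 0" and g: "g \<in> L2"
  shows "\<exists>w\<in>L2. wderiv w (\<lambda>x. - \<alpha> *\<^sub>R w x + g x) \<and> L2_norm w \<le> L2_norm g / \<alpha>"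
proof -
  have gm[measurable]: "g \<in> borel_measurable borel" by (rule L2_measurable[OF g])
  define k where "k x y = exp (\<alpha> * (y - x)) * indicator {..x} y" for x y
  have k0: "k x y \<ge> 0" for x y by (simp add: k_def)
  have [measurable]: "(\<lambda>(x, y). k x y) \<in> borel_measurable (borel \<Otimes>\<^sub>M borel)" 
    "k x \<in> borel_measurable borel" "(\<lambda>x. k x y) \<in> borel_measurable borel" for x y
  proof -
    have eq: "k = (\<lambda>x y. exp (\<alpha> * (y - x)) * (if y \<le> x then 1 else 0))"
      by (auto simp: k_def fun_eq_iff indicator_def)
    show "(\<lambda>(x, y). k x y) \<in> borel_measurable (borel \<Otimes>\<^sub>M borel)" 
      "k x \<in> borel_measurable borel" "(\<lambda>x. k x y) \<in> borel_measurable borel" for x y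
      unfolding eq by measurable
  qed
  have k1: "(\<integral>\<^sup>+y. ennreal (k x y) \<partial>lborel) = ennreal (1 / \<alpha>)" for x
    using nn_integral_exp_left[OF \<alpha>, of x] by (simp add: k_def ennreal_mult ennreal_indicator)
  have k2: "(\<integral>\<^sup>+x. ennreal (k x y) \<partial>lborel) = ennreal (1 / \<alpha>)" for y
    using nn_integral_exp_right[OF \<alpha>, of y]
    by (simp add: k_def ennreal_mult ennreal_indicator indicator_def of_bool_def if_distrib cong: if_cong)
  have ik: "integrable lborel (k x)" for x
    using k1[of x] k0 by (intro integrableI_bounded) auto
  have ikg: "integrable lborel (\<lambda>y. k x y *\<^sub>R g y)" for x
  proof (rule Bochner_Integration.integrable_bound)
    show "integrable lborel (\<lambda>y. k x y + (cmod (g y))\<^sup>2)" using ik g by (simp add: L2_def)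
    show "AE y in lborel. norm (k x y *\<^sub>R g y) \<le> norm (k x y + (cmod (g y))\<^sup>2)"
    proof (rule AE_I2)
      fix y
      have "k x y \<le> 1" using \<alpha> by (auto simp: k_def indicator_def mult_le_0_iff)
      have "k x y * cmod (g y) \<le> k x y * (1 + (cmod (g y))\<^sup>2)"
      proof (rule mult_left_mono[OF _ k0])
        have "2 * cmod (g y) \<le> 1 + (cmod (g y))\<^sup>2" using sum_squares_bound[of 1 "cmod (g y)"] by simp
        then show "cmod (g y) \<le> 1 + (cmod (g y))\<^sup>2" using norm_ge_zero[of "g y"] by linarith
      qed
      also have "\<dots> \<le> k x y + (cmod (g y))\<^sup>2"
        using \<open>k x y \<le> 1\<close> k0[of x y] by (simp add: distrib_left mult_left_le_one_le)
      finally show "norm (k x y *\<^sub>R g y) \<le> norm (k x y + (cmod (g y))\<^sup>2)" using k0[of x y] by simp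
    qed
  qed measurable
  define w where "w x = (LBINT y. k x y *\<^sub>R g y)" for x
  define h where "h y = exp (\<alpha> * y) *\<^sub>R g y" for y
  have h: "loc_int h" unfolding h_def
    by (intro loc_int_continuous_mult loc_int_L2 g continuous_intros)
  define C where "C = (LBINT y. k 0 y *\<^sub>R g y)"
  have w_eq: "w x = exp (- \<alpha> * x) *\<^sub>R (indef_integral h x + C)" for x
  proof -
    have "w x = (LBINT y. exp (- \<alpha> * x) *\<^sub>R (step_kernel x y *\<^sub>R h y + k 0 y *\<^sub>R g y))"
      unfolding w_def
    proof (rule integral_cong_AE)
      show "AE y in lborel. k x y *\<^sub>R g y = exp (- \<alpha> * x) *\<^sub>R (step_kernel x y *\<^sub>R h y + k 0 y *\<^sub>R g y)"
        \<comment> \<open>Only at the end point \<open>y = x\<close> can the two kernels differ.\<close>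
        using AE_lborel_singleton[of x]
      proof eventually_elim
        case (elim y)
        have "k x y = exp (- \<alpha> * x) * (step_kernel x y * exp (\<alpha> * y) + k 0 y)"
          using elim by (auto simp: k_def step_kernel_def indicator_def right_diff_distrib exp_diff exp_minus field_simps)
        then show ?case by (simp add: h_def scaleR_right_distrib scaleR_left_distrib distrib_left)
      qed
    qed (use loc_int_measurable[OF h] in measurable)
    also have "\<dots> = exp (- \<alpha> * x) *\<^sub>R (LBINT y. step_kernel x y *\<^sub>R h y + k 0 y *\<^sub>R g y)" by simp
    also have "(LBINT y. step_kernel x y *\<^sub>R h y + k 0 y *\<^sub>R g y) = indef_integral h x + C"
      unfolding indef_integral_def C_def
    proof (rule Bochner_Integration.integral_add[OF _ ikg])
      have "integrable lborel (\<lambda>y. indicator {-\<bar>x\<bar>..\<bar>x\<bar>} y *\<^sub>R h y)" using h by (simp add: loc_int_def set_integrable_def)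
      then show "integrable lborel (\<lambda>y. step_kernel x y *\<^sub>R h y)"
      proof (rule Bochner_Integration.integrable_bound)
        show "(\<lambda>y. step_kernel x y *\<^sub>R h y) \<in> borel_measurable lborel" using loc_int_measurable[OF h] by measurable
        show "AE y in lborel. norm (step_kernel x y *\<^sub>R h y) \<le> norm (indicat_real {- \<bar>x\<bar>..\<bar>x\<bar>} y *\<^sub>R h y)"
          by (rule AE_I2) (auto simp: step_kernel_def indicator_def)
      qed
    qed
    finally show ?thesis .
  qed
  have "wderiv (\<lambda>x. indef_integral h x + C) (\<lambda>x. h x + 0)"
    by (intro wderiv_add wderiv_indef_integral h wderiv_const)
  then have "wderiv (\<lambda>x. exp (- \<alpha> * x) *\<^sub>R (indef_integral h x + C))
     (\<lambda>x. (- \<alpha> * exp (- \<alpha> * x)) *\<^sub>R (indef_integral h x + C) + exp (- \<alpha> * x) *\<^sub>R (h x + 0))"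
    by (rule wderiv_mult) (auto intro!: derivative_eq_intros continuous_intros)
  moreover have "(\<lambda>x. exp (- \<alpha> * x) *\<^sub>R (indef_integral h x + C)) = w" using w_eq by auto
  moreover have "(- \<alpha> * exp (- \<alpha> * x)) *\<^sub>R (indef_integral h x + C) + exp (- \<alpha> * x) *\<^sub>R (h x + 0) = - \<alpha> *\<^sub>R w x + g x" for x
    by (simp add: w_eq h_def exp_minus)
  ultimately have W: "wderiv w (\<lambda>x. - \<alpha> *\<^sub>R w x + g x)" by simp
  have wm: "w \<in> borel_measurable borel" using W by (auto simp: wderiv_def loc_int_measurable)
  have pt: "ennreal ((cmod (w x))\<^sup>2) \<le> ennreal (1 / \<alpha>) * (\<integral>\<^sup>+y. ennreal (k x y) * ennreal ((cmod (g y))\<^sup>2) \<partial>lborel)" for x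
  proof -
    have "ennreal (cmod (w x)) \<le> (\<integral>\<^sup>+y. norm (k x y *\<^sub>R g y) \<partial>lborel)"
      unfolding w_def by (rule integral_norm_bound_ennreal[OF ikg])
    also have "\<dots> = (\<integral>\<^sup>+y. ennreal (sqrt (k x y)) * ennreal (sqrt (k x y) * cmod (g y)) \<partial>lborel)"
      using k0 by (intro nn_integral_cong) (simp flip: ennreal_mult' mult.assoc)
    finally have "(ennreal (cmod (w x)))\<^sup>2 \<le> (\<integral>\<^sup>+y. ennreal (sqrt (k x y)) * ennreal (sqrt (k x y) * cmod (g y)) \<partial>lborel)\<^sup>2"
      by (rule power_mono) simp
    also have "\<dots> \<le> (\<integral>\<^sup>+y. (ennreal (sqrt (k x y)))\<^sup>2 \<partial>lborel) * (\<integral>\<^sup>+y. (ennreal (sqrt (k x y) * cmod (g y)))\<^sup>2 \<partial>lborel)"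
      by (rule Cauchy_Schwarz_nn_integral) measurable
    also have "(\<integral>\<^sup>+y. (ennreal (sqrt (k x y)))\<^sup>2 \<partial>lborel) = ennreal (1 / \<alpha>)"
      using k0 by (simp add: ennreal_power k1)
    also have "(\<integral>\<^sup>+y. (ennreal (sqrt (k x y) * cmod (g y)))\<^sup>2 \<partial>lborel) = (\<integral>\<^sup>+y. ennreal (k x y) * ennreal ((cmod (g y))\<^sup>2) \<partial>lborel)"
      using k0 by (intro nn_integral_cong) (simp add: ennreal_power power_mult_distrib ennreal_mult)
    finally show ?thesis by (simp add: ennreal_power)
  qed
  have "(\<integral>\<^sup>+x. ennreal ((cmod (w x))\<^sup>2) \<partial>lborel) \<le>
      (\<integral>\<^sup>+x. ennreal (1 / \<alpha>) * (\<integral>\<^sup>+y. ennreal (k x y) * ennreal ((cmod (g y))\<^sup>2) \<partial>lborel) \<partial>lborel)"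
    by (intro nn_integral_mono pt)
  also have "\<dots> = ennreal (1 / \<alpha>) * (\<integral>\<^sup>+x. \<integral>\<^sup>+y. ennreal (k x y) * ennreal ((cmod (g y))\<^sup>2) \<partial>lborel \<partial>lborel)"
    by (intro nn_integral_cmult) measurable
  also have "(\<integral>\<^sup>+x. \<integral>\<^sup>+y. ennreal (k x y) * ennreal ((cmod (g y))\<^sup>2) \<partial>lborel \<partial>lborel)
      = (\<integral>\<^sup>+y. \<integral>\<^sup>+x. ennreal (k x y) * ennreal ((cmod (g y))\<^sup>2) \<partial>lborel \<partial>lborel)"
    by (rule lborel_pair.Fubini') measurable
  also have "\<dots> = (\<integral>\<^sup>+y. ennreal (1 / \<alpha>) * ennreal ((cmod (g y))\<^sup>2) \<partial>lborel)"
    by (simp add: nn_integral_multc k2)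
  also have "\<dots> = ennreal (1 / \<alpha>) * ennreal ((L2_norm g)\<^sup>2)"
    by (simp add: nn_integral_cmult L2_nn_integral[OF g])
  also have "ennreal (1 / \<alpha>) * (ennreal (1 / \<alpha>) * ennreal ((L2_norm g)\<^sup>2)) = ennreal ((L2_norm g / \<alpha>)\<^sup>2)"
    using \<alpha> by (simp add: power2_eq_square flip: ennreal_mult)
  finally have "(\<integral>\<^sup>+x. ennreal ((cmod (w x))\<^sup>2) \<partial>lborel) \<le> ennreal ((L2_norm g / \<alpha>)\<^sup>2)" .
  from L2_I_nn_integral[OF wm this] W show ?thesis
    using \<alpha> L2_norm_nonneg[of g] by auto
qed

lemma emeasure_lborel_half_line:
  "emeasure lborel {a::real..} = \<infinity>" "emeasure lborel {..a::real} = \<infinity>"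
proof -
  have top: "x = \<infinity>" if "\<And>n::nat. of_nat n \<le> x" for x :: ennreal
    using SUP_least[of UNIV of_nat x] that by (simp add: ennreal_SUP_of_nat_eq_top top_unique)
  show "emeasure lborel {a..} = \<infinity>"
  proof (rule top)
    fix n :: nat
    have "emeasure lborel {a..a + real n} \<le> emeasure lborel {a..}" by (intro emeasure_mono) auto
    then show "of_nat n \<le> emeasure lborel {a..}" by (simp add: ennreal_of_nat_eq_real_of_nat)
  qed
  show "emeasure lborel {..a} = \<infinity>"
  proof (rule top)
    fix n :: nat
    have "emeasure lborel {a - real n..a} \<le> emeasure lborel {..a}" by (intro emeasure_mono) auto
    then show "of_nat n \<le> emeasure lborel {..a}" by (simp add: ennreal_of_nat_eq_real_of_nat)
  qed
qed

text \<open>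
  The solutions are the multiples of \<open>exp (\<sigma> x)\<close>, and these are bounded away
  from zero on a half-line.
\<close>

lemma exp_equation_unique:
  assumes w: "w \<in> L2" and W: "wderiv w (\<lambda>x. \<sigma> *\<^sub>R w x)" and \<sigma>: "\<sigma> \<noteq> 0"
  shows "ae_eq w (\<lambda>x. 0)"
proof -
  have "wderiv (\<lambda>x. exp (- \<sigma> * x) *\<^sub>R w x) (\<lambda>x. (- \<sigma> * exp (- \<sigma> * x)) *\<^sub>R w x + exp (- \<sigma> * x) *\<^sub>R (\<sigma> *\<^sub>R w x))"
    by (rule wderiv_mult[OF W]) (auto intro!: derivative_eq_intros continuous_intros)
  then have "wderiv (\<lambda>x. exp (- \<sigma> * x) *\<^sub>R w x) (\<lambda>x. 0)" by (simp add: mult.commute)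
  from wderiv_zero_const[OF this] obtain c where c: "AE x in lborel. exp (- \<sigma> * x) *\<^sub>R w x = c" ..
  then have we: "AE x in lborel. w x = exp (\<sigma> * x) *\<^sub>R c"
  proof eventually_elim
    case (elim x)
    then have "exp (\<sigma> * x) *\<^sub>R c = exp (\<sigma> * x) *\<^sub>R exp (- \<sigma> * x) *\<^sub>R w x" by simp
    then show ?case by (simp flip: exp_add)
  qed
  have "c = 0"
  proof (rule ccontr)
    assume "c \<noteq> 0"
    define A where "A = (if \<sigma> > 0 then {0..} else {..0::real})"
    have "emeasure lborel A = \<infinity>" "A \<in> sets borel" by (auto simp: A_def emeasure_lborel_half_line)
    moreover have "AE x in lborel. x \<in> A \<longrightarrow> cmod c \<le> cmod (w x)"
      using we
    proof eventually_elim
      case (elim x)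
      have "\<sigma> * x \<ge> 0" if "x \<in> A" using that by (auto simp: A_def zero_le_mult_iff split: if_splits)
      then show ?case using elim by (auto simp: mult_left_le intro!: mult_le_cancel_right1[THEN iffD2])
    qed
    ultimately show False using not_L2_lower_bound[OF w, of A "cmod c"] \<open>c \<noteq> 0\<close> by auto
  qed
  with we show ?thesis by (simp add: ae_eq_def)
qed

lemma exp_equation_solution:
  assumes \<sigma>: "\<sigma> \<noteq> 0" and g: "g \<in> L2"
  shows "\<exists>w\<in>L2. wderiv w (\<lambda>x. \<sigma> *\<^sub>R w x + g x) \<and> L2_norm w \<le> L2_norm g / \<bar>\<sigma>\<bar>"
proof (cases "\<sigma> < 0")
  case True
  then show ?thesis using decay_equation_solution[of "- \<sigma>" g] g by simp
next
  case False
  with \<sigma> have s: "\<sigma> > 0" by simp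
  have g': "(\<lambda>x. - g (- x)) \<in> L2" "L2_norm (\<lambda>x. - g (- x)) = L2_norm g"
    using L2_cmult[OF L2_reflect(1)[OF g], of "-1"] L2_reflect(2)[OF g] by (simp_all add: L2_norm_def)
  from decay_equation_solution[OF s g'(1)] obtain w where w: "w \<in> L2" "wderiv w (\<lambda>x. - \<sigma> *\<^sub>R w x - g (- x))"
    "L2_norm w \<le> L2_norm g / \<sigma>" using g'(2) by auto
  from wderiv_reflect[OF w(2)] L2_reflect[OF w(1)] w(3) s show ?thesis
    by (intro bexI[of _ "\<lambda>x. w (- x)"]) (auto simp: algebra_simps)
qed

lemma exp_equation_bound:
  assumes \<sigma>: "\<sigma> \<noteq> 0" and wg: "w \<in> L2" "g \<in> L2" "wderiv w (\<lambda>x. \<sigma> *\<^sub>R w x + g x)"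
  shows "L2_norm w \<le> L2_norm g / \<bar>\<sigma>\<bar>"
proof -
  from exp_equation_solution[OF \<sigma> wg(2)] obtain v where v: "v \<in> L2" "wderiv v (\<lambda>x. \<sigma> *\<^sub>R v x + g x)"
    "L2_norm v \<le> L2_norm g / \<bar>\<sigma>\<bar>" by blast
  have "wderiv (\<lambda>x. w x - v x) (\<lambda>x. \<sigma> *\<^sub>R (w x - v x))"
    using wderiv_diff[OF wg(3) v(2)] by (simp add: algebra_simps)
  from exp_equation_unique[OF L2_diff[OF wg(1) v(1)] this \<sigma>]
  have "ae_eq w v" by (simp add: ae_eq_def)
  from L2_cong(2)[OF wg(1) this L2_measurable[OF v(1)]] v(3) show ?thesis by simp
qed

text \<open>
  Bounded invertibility of the operator \<open>u' - \<mu> u\<close> on \<open>L\<^sup>2\<close>,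
  stated without reference to a domain.
\<close>

definition well_posed :: "(real \<Rightarrow> real) \<Rightarrow> bool" where
  "well_posed \<mu> \<longleftrightarrow>
     (\<forall>v\<in>L2. \<exists>u\<in>L2. wderiv u (\<lambda>x. \<mu> x *\<^sub>R u x + v x)) \<and>
     (\<exists>K\<ge>0. \<forall>u\<in>L2. \<forall>v\<in>L2. wderiv u (\<lambda>x. \<mu> x *\<^sub>R u x + v x) \<longrightarrow> L2_norm u \<le> K * L2_norm v)"

lemma well_posed_solvable:
  "well_posed \<mu> \<Longrightarrow> v \<in> L2 \<Longrightarrow> \<exists>u\<in>L2. wderiv u (\<lambda>x. \<mu> x *\<^sub>R u x + v x)"
  by (simp add: well_posed_def)

lemma well_posed_const:
  assumes "\<sigma> \<noteq> 0" shows "well_posed (\<lambda>_. \<sigma>)"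
  unfolding well_posed_def
proof
  show "\<forall>v\<in>L2. \<exists>u\<in>L2. wderiv u (\<lambda>x. \<sigma> *\<^sub>R u x + v x)"
    using exp_equation_solution[OF assms] by blast
  have "\<forall>u\<in>L2. \<forall>v\<in>L2. wderiv u (\<lambda>x. \<sigma> *\<^sub>R u x + v x) \<longrightarrow> L2_norm u \<le> (1 / \<bar>\<sigma>\<bar>) * L2_norm v"
    using exp_equation_bound[OF assms] by simp
  then show "\<exists>K\<ge>0. \<forall>u\<in>L2. \<forall>v\<in>L2. wderiv u (\<lambda>x. \<sigma> *\<^sub>R u x + v x) \<longrightarrow> L2_norm u \<le> K * L2_norm v"
    by (intro exI[of _ "1 / \<bar>\<sigma>\<bar>"]) simp
qed

text \<open>
  Multiplication by \<open>c\<close> maps solutions of the equation with coefficient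
  \<open>\<mu>\<close> to solutions of the one with coefficient \<open>\<nu>\<close>, and it is
  bounded in both directions.
\<close>

lemma well_posed_gauge:
  fixes c \<mu> \<nu> :: "real \<Rightarrow> real"
  assumes wp: "well_posed \<nu>"
    and c': "\<And>x. (c has_real_derivative (\<nu> x - \<mu> x) * c x) (at x)"
    and cont: "continuous_on UNIV \<nu>" "continuous_on UNIV \<mu>" and pos: "\<And>x. c x > 0"
    and B: "\<And>x. c x \<le> B" "\<And>x. 1 / c x \<le> B"
  shows "well_posed \<mu>"
proof -
  have cc: "continuous_on UNIV c" by (rule DERIV_continuous_on[OF c'])
  have B0: "B \<ge> 0" using pos[of 0] B(1)[of 0] by linarith
  have ic: "continuous_on UNIV (\<lambda>x. 1 / c x)"
    using cc pos by (intro continuous_intros) (auto simp: less_imp_neq[symmetric])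
  have ic': "((\<lambda>x. 1 / c x) has_real_derivative - (\<nu> x - \<mu> x) * (1 / c x)) (at x)" for x
    using pos[of x] by (auto intro!: derivative_eq_intros c' simp: field_simps)
  have m: "c \<in> borel_measurable borel" "(\<lambda>x. 1 / c x) \<in> borel_measurable borel"
    using cc ic by (auto intro: borel_measurable_continuous_onI)
  have b: "\<bar>c x\<bar> \<le> B" "\<bar>1 / c x\<bar> \<le> B" for x using pos[of x] B[of x] by auto
  have solve: "\<exists>u\<in>L2. wderiv u (\<lambda>x. \<mu> x *\<^sub>R u x + v x)" if v: "v \<in> L2" for v
  proof -
    obtain w where w: "w \<in> L2" "wderiv w (\<lambda>x. \<nu> x *\<^sub>R w x + c x *\<^sub>R v x)"
      using well_posed_solvable[OF wp L2_scale(1)[OF v m(1) b(1)]] by blast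
    have "wderiv (\<lambda>x. (1 / c x) *\<^sub>R w x)
       (\<lambda>x. (- (\<nu> x - \<mu> x) * (1 / c x)) *\<^sub>R w x + (1 / c x) *\<^sub>R (\<nu> x *\<^sub>R w x + c x *\<^sub>R v x))"
      using cont ic by (intro wderiv_mult[OF w(2) ic'] continuous_on_mult continuous_on_minus continuous_on_diff)
    also have "(\<lambda>x. (- (\<nu> x - \<mu> x) * (1 / c x)) *\<^sub>R w x + (1 / c x) *\<^sub>R (\<nu> x *\<^sub>R w x + c x *\<^sub>R v x))
       = (\<lambda>x. \<mu> x *\<^sub>R ((1 / c x) *\<^sub>R w x) + v x)"
    proof
      fix x
      have "c x \<noteq> 0" using pos[of x] by simp
      then show "(- (\<nu> x - \<mu> x) * (1 / c x)) *\<^sub>R w x + (1 / c x) *\<^sub>R (\<nu> x *\<^sub>R w x + c x *\<^sub>R v x)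
        = \<mu> x *\<^sub>R ((1 / c x) *\<^sub>R w x) + v x"
        by (simp add: scaleR_conv_of_real field_simps)
    qed
    finally show ?thesis using L2_scale(1)[OF w(1) m(2) b(2)] by blast
  qed
  obtain K where K: "K \<ge> 0" "\<And>u v. u \<in> L2 \<Longrightarrow> v \<in> L2 \<Longrightarrow>
      wderiv u (\<lambda>x. \<nu> x *\<^sub>R u x + v x) \<Longrightarrow> L2_norm u \<le> K * L2_norm v"
    using wp unfolding well_posed_def by blast
  have bound: "L2_norm u \<le> (B * K * B) * L2_norm v"
    if u: "u \<in> L2" and v: "v \<in> L2" and W: "wderiv u (\<lambda>x. \<mu> x *\<^sub>R u x + v x)" for u v
  proof -
    have "wderiv (\<lambda>x. c x *\<^sub>R u x) (\<lambda>x. ((\<nu> x - \<mu> x) * c x) *\<^sub>R u x + c x *\<^sub>R (\<mu> x *\<^sub>R u x + v x))"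
      using cont cc by (intro wderiv_mult[OF W c'] continuous_on_mult continuous_on_diff)
    then have W': "wderiv (\<lambda>x. c x *\<^sub>R u x) (\<lambda>x. \<nu> x *\<^sub>R (c x *\<^sub>R u x) + c x *\<^sub>R v x)"
      by (simp add: scaleR_conv_of_real algebra_simps)
    note cu = L2_scale(1)[OF u m(1) b(1)] and cv = L2_scale[OF v m(1) b(1)]
    have "u = (\<lambda>x. (1 / c x) *\<^sub>R (c x *\<^sub>R u x))" using pos by (simp add: less_imp_neq[symmetric])
    then have "L2_norm u \<le> B * L2_norm (\<lambda>x. c x *\<^sub>R u x)"
      using L2_scale(2)[OF cu m(2) b(2)] by simp
    also have "\<dots> \<le> B * (K * L2_norm (\<lambda>x. c x *\<^sub>R v x))"
      using K(2)[OF cu cv(1) W'] B0 by (intro mult_left_mono)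
    also have "\<dots> \<le> B * (K * (B * L2_norm v))"
      using cv(2) B0 K(1) by (intro mult_left_mono) auto
    finally show ?thesis by (simp add: mult.assoc)
  qed
  have "B * K * B \<ge> 0" using B0 K(1) by simp
  with solve bound show ?thesis unfolding well_posed_def by blast
qed

section \<open>The ground state of an even periodic potential\<close>

locale even_periodic =
  fixes d :: real and V :: "real \<Rightarrow> real"
  assumes d_pos: "d > 0"
    and V_cont: "continuous_on UNIV V"
    and V_even: "\<And>x. V (- x) = V x"
    and V_period: "\<And>x. V (x + d) = V x"
begin

lemma int_shift_iff:
  assumes "\<And>x. P (x + d) \<longleftrightarrow> P x" shows "P (x + of_int k * d) \<longleftrightarrow> P x"
proof (induction k rule: int_induct[where k=0])
  case (step1 i)
  then show ?case using assms[of "x + of_int i * d"] by (simp add: algebra_simps)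
next
  case (step2 i)
  then show ?case using assms[of "x + of_int (i - 1) * d"] by (simp add: algebra_simps)
qed simp

lemma shift_into_cell: "\<exists>k. \<bar>x + of_int k * d\<bar> \<le> d / 2"
proof -
  \<comment> \<open>Shifting by the lattice point nearest to \<open>x\<close>.\<close>
  define k where "k = - round (x / d)"
  have "\<bar>of_int (round (x / d)) - x / d\<bar> \<le> 1 / 2" by (rule of_int_round_abs_le)
  then have "\<bar>x / d + of_int k\<bar> \<le> 1 / 2" by (simp add: k_def abs_minus_commute)
  then have "\<bar>x / d + of_int k\<bar> * d \<le> 1 / 2 * d" using d_pos by (intro mult_right_mono) auto
  moreover have "\<bar>x / d + of_int k\<bar> * d = \<bar>(x / d + of_int k) * d\<bar>" using d_pos by (simp add: abs_mult)
  moreover have "(x / d + of_int k) * d = x + of_int k * d" using d_pos by (simp add: field_simps)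
  ultimately show ?thesis by auto
qed

lemma periodic_bounded:
  fixes f :: "real \<Rightarrow> real"
  assumes f: "continuous_on UNIV f" "\<And>x. f (x + d) = f x"
  shows "\<exists>B. \<forall>x. \<bar>f x\<bar> \<le> B"
proof -
  have "bounded (f ` {- (d / 2)..d / 2})"
    by (intro compact_imp_bounded compact_continuous_image continuous_on_subset[OF f(1)]) auto
  then obtain B where B: "\<forall>x\<in>{- (d / 2)..d / 2}. \<bar>f x\<bar> \<le> B" by (auto simp: bounded_iff)
  have "\<bar>f x\<bar> \<le> B" for x
  proof -
    obtain k where k: "\<bar>x + of_int k * d\<bar> \<le> d / 2" using shift_into_cell by blast
    have "\<bar>f (x + of_int k * d)\<bar> \<le> B \<longleftrightarrow> \<bar>f x\<bar> \<le> B"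
      by (rule int_shift_iff[of "\<lambda>x. \<bar>f x\<bar> \<le> B"]) (simp add: f(2))
    moreover have "x + of_int k * d \<in> {- (d / 2)..d / 2}" using k by (simp only: abs_le_iff atLeastAtMost_iff minus_le_iff)
    ultimately show ?thesis using B by blast
  qed
  then show ?thesis by (intro exI[of _ B] allI)
qed

definition V_bound :: real where "V_bound = (SOME B. \<forall>x. \<bar>V x\<bar> \<le> B)"

lemma V_bound: "\<bar>V x\<bar> \<le> V_bound"
  using someI_ex[OF periodic_bounded[OF V_cont V_period]] by (simp add: V_bound_def)

lemma q_bound: "\<bar>V x - l\<bar> \<le> V_bound + \<bar>l\<bar>"
  using V_bound[of x] by linarith

text \<open>
  The solution with value \<open>a\<close> and slope \<open>b\<close> at \<open>0\<close>, paired
  with its derivative.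
\<close>

definition fund :: "real \<Rightarrow> real \<Rightarrow> real \<Rightarrow> (real \<Rightarrow> real) \<times> (real \<Rightarrow> real)" where
  "fund a b l = (SOME p. ode_solution (\<lambda>x. V x - l) (fst p) (snd p) \<and> fst p 0 = a \<and> snd p 0 = b)"

lemma fund:
  "ode_solution (\<lambda>x. V x - l) (fst (fund a b l)) (snd (fund a b l))"
  "fst (fund a b l) 0 = a" "snd (fund a b l) 0 = b"
proof -
  have c: "continuous_on UNIV (\<lambda>x. V x - l)" using V_cont by (intro continuous_intros)
  obtain u w where "ode_solution (\<lambda>x. V x - l) u w" "u 0 = a" "w 0 = b"
    using linear_ode_exists[OF c q_bound] unfolding ode_solution_def by metis
  then have "\<exists>p. ode_solution (\<lambda>x. V x - l) (fst p) (snd p) \<and> fst p 0 = a \<and> snd p 0 = b"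
    by (intro exI[of _ "(u, w)"]) simp
  from someI_ex[OF this] show
    "ode_solution (\<lambda>x. V x - l) (fst (fund a b l)) (snd (fund a b l))"
    "fst (fund a b l) 0 = a" "snd (fund a b l) 0 = b" by (auto simp: fund_def)
qed

lemma solution_unique:
  assumes "ode_solution (\<lambda>x. V x - l) u w" "ode_solution (\<lambda>x. V x - l) u' w'" "u c = u' c" "w c = w' c"
  shows "u x = u' x" "w x = w' x"
  using ode_solution_unique[OF assms(1,2) q_bound assms(3,4)] by auto

lemma solution_cont:
  assumes "ode_solution q u w" shows "continuous_on A u" "continuous_on A w"
  using DERIV_continuous_on[OF DERIV_subset[OF ode_solution_D(1)[OF assms]]]
    DERIV_continuous_on[OF DERIV_subset[OF ode_solution_D(2)[OF assms]]] by auto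

text \<open>
  Solutions depend on the spectral parameter in a locally Lipschitz way, uniformly on bounded
  intervals. Uniformity is needed to preserve positivity on a whole interval under a small change
  of the parameter.
\<close>

lemma fund_lipschitz:
  assumes X: "X \<ge> 0"
  shows "\<exists>L\<ge>0. \<forall>l x. \<bar>l - \<mu>\<bar> \<le> 1 \<longrightarrow> 0 \<le> x \<longrightarrow> x \<le> X \<longrightarrow>
     \<bar>fst (fund a b l) x - fst (fund a b \<mu>) x\<bar> \<le> L * \<bar>l - \<mu>\<bar> \<and>
     \<bar>snd (fund a b l) x - snd (fund a b \<mu>) x\<bar> \<le> L * \<bar>l - \<mu>\<bar>"
proof -
  have "bounded (fst (fund a b \<mu>) ` {0..X})"
    by (intro compact_imp_bounded compact_continuous_image solution_cont[OF fund(1)]) auto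
  then obtain B where B: "\<forall>x\<in>{0..X}. \<bar>fst (fund a b \<mu>) x\<bar> \<le> B" by (auto simp: bounded_iff)
  then have B0: "B \<ge> 0" using X abs_ge_zero order_trans by (metis atLeastAtMost_iff order_refl)
  define Q where "Q = V_bound + \<bar>\<mu>\<bar> + 1"
  have Q0: "Q \<ge> 0" using V_bound[of 0] by (simp add: Q_def)
  define L where "L = exp ((Q + 2) * X / 2) * B"
  have "\<bar>fst (fund a b l) x - fst (fund a b \<mu>) x\<bar> \<le> L * \<bar>l - \<mu>\<bar> \<and>
     \<bar>snd (fund a b l) x - snd (fund a b \<mu>) x\<bar> \<le> L * \<bar>l - \<mu>\<bar>"
    if l: "\<bar>l - \<mu>\<bar> \<le> 1" and x: "0 \<le> x" "x \<le> X" for l x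
  proof -
    define D where "D x = fst (fund a b l) x - fst (fund a b \<mu>) x" for x
    define E where "E x = snd (fund a b l) x - snd (fund a b \<mu>) x" for x
    define r where "r x = (\<mu> - l) * fst (fund a b \<mu>) x" for x
    note s = ode_solution_D[OF fund(1)]
    have "(D x)\<^sup>2 + (E x)\<^sup>2 \<le> exp ((Q + 2) * x) * ((D 0)\<^sup>2 + (E 0)\<^sup>2 + (B * \<bar>l - \<mu>\<bar>)\<^sup>2)"
    proof (rule gronwall_square[OF _ _ _ _ x])
      show "(D has_real_derivative E x) (at x)" for x
        unfolding D_def E_def by (intro DERIV_diff s)
      show "(E has_real_derivative (V x - l) * D x + r x) (at x)" for x
        unfolding D_def[abs_def] E_def[abs_def] r_def
        by (rule DERIV_cong[OF DERIV_diff[OF s(2) s(2)]]) (simp add: algebra_simps)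
      show "\<bar>V x - l\<bar> \<le> Q" for x using V_bound[of x] l by (simp add: Q_def)
      show "\<bar>r x\<bar> \<le> B * \<bar>l - \<mu>\<bar>" if "0 \<le> x" "x \<le> X" for x
        using that B mult_right_mono[of "\<bar>fst (fund a b \<mu>) x\<bar>" B "\<bar>l - \<mu>\<bar>"]
        by (simp add: r_def abs_mult abs_minus_commute mult.commute)
    qed
    also have "\<dots> = exp ((Q + 2) * x) * (B * \<bar>l - \<mu>\<bar>)\<^sup>2"
      by (simp add: D_def E_def fund)
    also have "\<dots> \<le> exp ((Q + 2) * X) * (B * \<bar>l - \<mu>\<bar>)\<^sup>2"
      using x Q0 by (intro mult_right_mono) (auto intro: mult_left_mono)
    also have "\<dots> = (L * \<bar>l - \<mu>\<bar>)\<^sup>2"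
      by (simp add: L_def power_mult_distrib exp_double[symmetric] flip: mult.assoc)
    finally have *: "(D x)\<^sup>2 + (E x)\<^sup>2 \<le> (L * \<bar>l - \<mu>\<bar>)\<^sup>2" .
    then have "(D x)\<^sup>2 \<le> (L * \<bar>l - \<mu>\<bar>)\<^sup>2" "(E x)\<^sup>2 \<le> (L * \<bar>l - \<mu>\<bar>)\<^sup>2"
      using zero_le_power2[of "D x"] zero_le_power2[of "E x"] by linarith+
    moreover have "L * \<bar>l - \<mu>\<bar> \<ge> 0" using B0 by (simp add: L_def)
    ultimately show ?thesis unfolding D_def E_def
      using abs_le_square_iff[of _ "L * \<bar>l - \<mu>\<bar>"] by auto
  qed
  moreover have "L \<ge> 0" using B0 by (simp add: L_def)
  ultimately show ?thesis by blast
qed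

definition even_sol where "even_sol l = fst (fund 1 0 l)"
definition even_sol' where "even_sol' l = snd (fund 1 0 l)"
definition odd_sol where "odd_sol l = fst (fund 0 1 l)"
definition odd_sol' where "odd_sol' l = snd (fund 0 1 l)"

lemma even_sol: "ode_solution (\<lambda>x. V x - l) (even_sol l) (even_sol' l)" "even_sol l 0 = 1" "even_sol' l 0 = 0"
  by (auto simp: even_sol_def even_sol'_def fund)

lemma odd_sol: "ode_solution (\<lambda>x. V x - l) (odd_sol l) (odd_sol' l)" "odd_sol l 0 = 0" "odd_sol' l 0 = 1"
  by (auto simp: odd_sol_def odd_sol'_def fund)

lemma parity:
  "even_sol l (- x) = even_sol l x" "even_sol' l (- x) = - even_sol' l x"
  "odd_sol l (- x) = - odd_sol l x" "odd_sol' l (- x) = odd_sol' l x"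
proof -
  have "ode_solution (\<lambda>x. V x - l) (\<lambda>x. even_sol l (- x)) (\<lambda>x. - even_sol' l (- x))"
    using ode_solution_reflect[OF even_sol(1)[of l]] by (simp add: V_even)
  from solution_unique[OF this even_sol(1), of 0 x]
  show "even_sol l (- x) = even_sol l x" "even_sol' l (- x) = - even_sol' l x"
    by (auto simp: even_sol)
  have "ode_solution (\<lambda>x. V x - l) (\<lambda>x. odd_sol l (- x)) (\<lambda>x. - odd_sol' l (- x))"
    using ode_solution_reflect[OF odd_sol(1)[of l]] by (simp add: V_even)
  from ode_solution_combine[OF this this, of "-1" 0]
  have "ode_solution (\<lambda>x. V x - l) (\<lambda>x. - odd_sol l (- x)) (\<lambda>x. odd_sol' l (- x))" by simp
  from solution_unique[OF this odd_sol(1), of 0 x]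
  show "odd_sol l (- x) = - odd_sol l x" "odd_sol' l (- x) = odd_sol' l x"
    by (auto simp: odd_sol)
qed

lemma wronskian_one: "even_sol l x * odd_sol' l x - even_sol' l x * odd_sol l x = 1"
proof -
  have "((\<lambda>x. even_sol l x * odd_sol' l x - even_sol' l x * odd_sol l x) has_real_derivative 0) (at x)" for x
    using wronskian_deriv[OF even_sol(1)[of l] odd_sol(1)[of l], of x] by simp
  from DERIV_isconst_all[OF allI, OF this, of x 0] show ?thesis
    by (simp add: even_sol odd_sol)
qed

lemma fund_continuous_nonneg:
  assumes "x \<ge> 0" shows "isCont (\<lambda>l. fst (fund a b l) x) \<mu>" "isCont (\<lambda>l. snd (fund a b l) x) \<mu>"
proof -
  from fund_lipschitz[OF assms, of \<mu> a b] obtain L where L: "L \<ge> 0" 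
     "\<And>l. \<bar>l - \<mu>\<bar> \<le> 1 \<Longrightarrow> \<bar>fst (fund a b l) x - fst (fund a b \<mu>) x\<bar> \<le> L * \<bar>l - \<mu>\<bar>"
     "\<And>l. \<bar>l - \<mu>\<bar> \<le> 1 \<Longrightarrow> \<bar>snd (fund a b l) x - snd (fund a b \<mu>) x\<bar> \<le> L * \<bar>l - \<mu>\<bar>"
    using assms by blast
  have *: "isCont f \<mu>" if f: "\<And>l. \<bar>l - \<mu>\<bar> \<le> 1 \<Longrightarrow> \<bar>f l - f \<mu>\<bar> \<le> L * \<bar>l - \<mu>\<bar>" for f :: "real \<Rightarrow> real"
  proof -
    have "\<forall>\<^sub>F l in at \<mu>. \<bar>l - \<mu>\<bar> \<le> 1"
      unfolding eventually_at by (intro exI[of _ 1]) (auto simp: dist_real_def)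
    then have ev: "\<forall>\<^sub>F l in at \<mu>. norm (f l - f \<mu>) \<le> L * \<bar>l - \<mu>\<bar>"
      by eventually_elim (simp add: f)
    have "((\<lambda>l. L * \<bar>l - \<mu>\<bar>) \<longlongrightarrow> L * \<bar>\<mu> - \<mu>\<bar>) (at \<mu>)" by (intro tendsto_intros)
    then have "((\<lambda>l. f l - f \<mu>) \<longlongrightarrow> 0) (at \<mu>)"
      by (intro Lim_null_comparison[OF ev]) simp
    then show ?thesis by (simp add: isCont_def Lim_null[of f])
  qed
  show "isCont (\<lambda>l. fst (fund a b l) x) \<mu>" "isCont (\<lambda>l. snd (fund a b l) x) \<mu>"
    by (rule *, rule L, assumption)+
qed

lemma sol_continuous:
  "continuous_on A (\<lambda>l. even_sol l x)" "continuous_on A (\<lambda>l. even_sol' l x)"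
  "continuous_on A (\<lambda>l. odd_sol l x)" "continuous_on A (\<lambda>l. odd_sol' l x)"
proof -
  have *: "continuous_on A (\<lambda>l. even_sol l x)" "continuous_on A (\<lambda>l. even_sol' l x)"
    "continuous_on A (\<lambda>l. odd_sol l x)" "continuous_on A (\<lambda>l. odd_sol' l x)" if "x \<ge> 0" for x
    using fund_continuous_nonneg[OF that] 
    by (auto simp: even_sol_def even_sol'_def odd_sol_def odd_sol'_def intro: continuous_at_imp_continuous_on)
  show "continuous_on A (\<lambda>l. even_sol l x)" "continuous_on A (\<lambda>l. even_sol' l x)"
    "continuous_on A (\<lambda>l. odd_sol l x)" "continuous_on A (\<lambda>l. odd_sol' l x)"
  proof -
    consider "x \<ge> 0" | "- x \<ge> 0" by linarith
    then have "continuous_on A (\<lambda>l. even_sol l x) \<and> continuous_on A (\<lambda>l. even_sol' l x) \<and>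
      continuous_on A (\<lambda>l. odd_sol l x) \<and> continuous_on A (\<lambda>l. odd_sol' l x)"
    proof cases
      case 2
      show ?thesis
        using *[OF 2] continuous_on_minus[OF *(2)[OF 2]] continuous_on_minus[OF *(3)[OF 2]]
        by (simp add: parity)
    qed (use * in auto)
    then show "continuous_on A (\<lambda>l. even_sol l x)" "continuous_on A (\<lambda>l. even_sol' l x)"
    "continuous_on A (\<lambda>l. odd_sol l x)" "continuous_on A (\<lambda>l. odd_sol' l x)" by auto
  qed
qed

text \<open>
  These are the parameters that do not exceed the lowest eigenvalue of the Neumann problem on
  half a period. For an even potential that eigenvalue is also the lowest periodic one.
\<close>

definition subcritical :: "real set" where
  "subcritical = {l. (\<forall>x\<in>{0..d/2}. even_sol l x > 0) \<and> even_sol' l (d/2) \<ge> 0}"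

definition bottom :: real where "bottom = Sup subcritical"

lemma subcritical_below_V:
  assumes "\<And>x. l \<le> V x" shows "l \<in> subcritical"
proof -
  note s = ode_solution_D[OF even_sol(1)[of l]]
  have "even_sol l x \<ge> even_sol l 0 \<and> even_sol' l x \<ge> even_sol' l 0" if x: "0 \<le> x" "x \<le> d/2" for x
    using cooperative_system_nonneg[where r = "even_sol l" and w = "even_sol' l" and \<alpha> = "\<lambda>_. 1"
        and \<beta> = "\<lambda>x. V x - l" and X = "d/2" and x=x] s x assms by (auto simp: even_sol)
  then show ?thesis using d_pos by (force simp: subcritical_def even_sol)
qed

text \<open>
  Sturm comparison on half a period: the quotient \<open>r\<close> of the two even solutions and
  their Wronskian \<open>W\<close> form a cooperative system.
\<close>

lemma subcritical_down:
  assumes \<mu>: "\<mu> \<in> subcritical" and l: "l < \<mu>" shows "l \<in> subcritical" "even_sol' l (d/2) > 0"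
proof -
  define W where "W x = even_sol \<mu> x * even_sol' l x - even_sol' \<mu> x * even_sol l x" for x
  define r where "r x = even_sol l x / even_sol \<mu> x" for x
  have pos: "even_sol \<mu> x > 0" if "0 \<le> x" "x \<le> d/2" for x using \<mu> that by (auto simp: subcritical_def)
  have W': "(W has_real_derivative (\<mu> - l) * (even_sol \<mu> x * even_sol l x)) (at x)" for x
    unfolding W_def using wronskian_deriv[OF even_sol(1)[of \<mu>] even_sol(1)[of l], of x] by simp
  have r': "(r has_real_derivative (1 / (even_sol \<mu> x)\<^sup>2) * W x) (at x)" if "0 \<le> x" "x \<le> d/2" for x
    unfolding r_def W_def using pos[OF that]
    by (auto intro!: derivative_eq_intros ode_solution_D[OF even_sol(1)] simp: power2_eq_square field_simps)
  have W'': "(W has_real_derivative ((\<mu> - l) * (even_sol \<mu> x)\<^sup>2) * r x) (at x)" if "0 \<le> x" "x \<le> d/2" for x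
    by (rule DERIV_cong[OF W']) (use pos[OF that] in \<open>simp add: r_def power2_eq_square\<close>)
  have coop: "r x \<ge> r 0" "W x \<ge> W 0" if "0 \<le> x" "x \<le> d/2" for x
    using cooperative_system_nonneg[where r = r and w = W and \<alpha> = "\<lambda>x. 1 / (even_sol \<mu> x)\<^sup>2"
        and \<beta> = "\<lambda>x. (\<mu> - l) * (even_sol \<mu> x)\<^sup>2" and X = "d/2" and x=x, OF r' W''] l that
    by (auto simp: r_def W_def even_sol)
  have r1: "r x \<ge> 1" if "0 \<le> x" "x \<le> d/2" for x using coop(1)[OF that] by (simp add: r_def even_sol)
  have lpos: "even_sol l x > 0" if "0 \<le> x" "x \<le> d/2" for x
    using r1[OF that] pos[OF that] by (simp add: r_def field_simps split: if_splits)
  have "W 0 < W (d/2)"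
  proof (rule DERIV_pos_imp_increasing[of 0 "d/2" W])
    show "0 < d/2" using d_pos by simp
    fix x assume "0 \<le> x" "x \<le> d/2"
    then show "\<exists>y. (W has_real_derivative y) (at x) \<and> 0 < y"
      using W' pos lpos l by (meson diff_gt_0_iff_gt mult_pos_pos)
  qed
  then have "even_sol \<mu> (d/2) * even_sol' l (d/2) > even_sol' \<mu> (d/2) * even_sol l (d/2)"
    by (simp add: W_def even_sol)
  moreover have "even_sol' \<mu> (d/2) * even_sol l (d/2) \<ge> 0"
    using \<mu> lpos[of "d/2"] d_pos by (auto simp: subcritical_def)
  ultimately have "even_sol \<mu> (d/2) * even_sol' l (d/2) > 0" by linarith
  then show *: "even_sol' l (d/2) > 0" using pos[of "d/2"] d_pos by (simp add: zero_less_mult_iff)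
  then show "l \<in> subcritical" using lpos by (auto simp: subcritical_def)
qed

lemma subcritical_bounded:
  assumes "l \<in> subcritical" shows "l \<le> V_bound"
proof (rule ccontr)
  assume l: "\<not> l \<le> V_bound"
  have "even_sol' l (d/2) < even_sol' l 0"
  proof (rule DERIV_neg_imp_decreasing[of 0 "d/2" "even_sol' l"])
    show "0 < d/2" using d_pos by simp
    fix x assume x: "0 \<le> x" "x \<le> d/2"
    have "V x - l < 0" using l V_bound[of x] by linarith
    then show "\<exists>y. (even_sol' l has_real_derivative y) (at x) \<and> y < 0"
      using assms x ode_solution_D(2)[OF even_sol(1)[of l]] by (auto simp: subcritical_def intro!: exI mult_neg_pos)
  qed
  then show False using assms by (simp add: subcritical_def even_sol)
qed

lemma subcritical_nonempty: "- V_bound \<in> subcritical"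
proof (rule subcritical_below_V)
  show "- V_bound \<le> V x" for x using V_bound[of x] by linarith
qed

lemma bottom_upper: "l \<in> subcritical \<Longrightarrow> l \<le> bottom"
  unfolding bottom_def by (intro cSup_upper bdd_aboveI[of _ V_bound] subcritical_bounded)

lemma below_bottom:
  assumes "l < bottom" shows "l \<in> subcritical" "even_sol' l (d/2) > 0"
proof -
  obtain \<mu> where "\<mu> \<in> subcritical" "l < \<mu>"
    using less_cSupD[of subcritical l] assms subcritical_nonempty unfolding bottom_def by blast
  then show "l \<in> subcritical" "even_sol' l (d/2) > 0" by (rule subcritical_down)+
qed

text \<open>
  In the limit the even solution is at least non-negative. A zero in \<open>[0, d/2]\<close>
  would force its derivative to vanish there as well, using the sign condition on the derivative
  when the zero is the right end point; then the solution would be identically zero.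
\<close>

lemma bottom_subcritical: "bottom \<in> subcritical"
proof -
  define f where "f = even_sol bottom"
  define f' where "f' = even_sol' bottom"
  have f: "(f has_real_derivative f' x) (at x)" for x
    unfolding f_def f'_def by (rule ode_solution_D[OF even_sol(1)])
  have lim: "((\<lambda>l. even_sol l x) \<longlongrightarrow> f x) (at_left bottom)" "((\<lambda>l. even_sol' l x) \<longlongrightarrow> f' x) (at_left bottom)" for x
    using sol_continuous(1,2)[of UNIV x] unfolding f_def f'_def continuous_on_eq_continuous_at[OF open_UNIV]
    by (auto simp: isCont_def intro: tendsto_within_subset)
  have ev: "\<forall>\<^sub>F l in at_left bottom. l \<in> subcritical"
    using below_bottom(1) by (auto simp: eventually_at_filter)
  have nn: "f x \<ge> 0" if "x \<in> {0..d/2}" for x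
    by (rule tendsto_lowerbound[OF lim(1)])
       (use that in \<open>auto intro!: eventually_mono[OF ev] simp: subcritical_def less_imp_le\<close>)
  have nn': "f' (d/2) \<ge> 0"
    by (rule tendsto_lowerbound[OF lim(2)]) (auto intro!: eventually_mono[OF ev] simp: subcritical_def)
  have nz: "\<not> (f x = 0 \<and> f' x = 0)" for x
    using ode_solution_zero[OF even_sol(1)[of bottom] q_bound, of x 0] even_sol(2)[of bottom]
    by (auto simp: f_def f'_def)
  have "f x > 0" if x: "x \<in> {0..d/2}" for x
  proof (rule ccontr)
    assume "\<not> f x > 0"
    then have x0: "f x = 0" using nn[OF x] by simp
    have "x \<noteq> 0" using x0 even_sol(2)[of bottom] by (auto simp: f_def)
    have "f' x = 0"
    proof (rule ccontr)
      assume nz: "f' x \<noteq> 0"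
      show False
      proof (cases "f' x > 0")
        case True
        from DERIV_pos_inc_left[OF f this] obtain e where e: "e > 0" "\<And>h. 0 < h \<Longrightarrow> h < e \<Longrightarrow> f (x - h) < f x" by blast
        define h where "h = min (e / 2) x"
        have "0 < h" "h < e" "x - h \<in> {0..d/2}" using e x \<open>x \<noteq> 0\<close> by (auto simp: h_def)
        then show False using e(2)[of h] nn[of "x - h"] x0 by simp
      next
        case False
        then have neg: "f' x < 0" using nz by simp
        then have "x \<noteq> d/2" using nn' by auto
        from DERIV_neg_dec_right[OF f neg] obtain e where e: "e > 0" "\<And>h. 0 < h \<Longrightarrow> h < e \<Longrightarrow> f (x + h) < f x" by blast
        define h where "h = min (e / 2) (d/2 - x)"
        have "0 < h" "h < e" "x + h \<in> {0..d/2}" using e x \<open>x \<noteq> d/2\<close> by (auto simp: h_def min_def)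
        then show False using e(2)[of h] nn[of "x + h"] x0 by simp
      qed
    qed
    then show False using nz x0 by blast
  qed
  then show ?thesis using nn' by (auto simp: subcritical_def f_def f'_def)
qed

text \<open>
  If the derivative at \<open>d/2\<close> were positive, both defining conditions of
  \<open>subcritical\<close> would survive a small increase of the parameter.
\<close>

lemma bottom_neumann: "even_sol' bottom (d/2) = 0"
proof (rule ccontr)
  assume "even_sol' bottom (d/2) \<noteq> 0"
  then have b: "even_sol' bottom (d/2) > 0" using bottom_subcritical by (simp add: subcritical_def)
  have X: "d/2 \<ge> 0" using d_pos by simp
  from fund_lipschitz[OF X, of bottom 1 0] obtain L where L: "L \<ge> 0"
    "\<And>l x. \<bar>l - bottom\<bar> \<le> 1 \<Longrightarrow> 0 \<le> x \<Longrightarrow> x \<le> d/2 \<Longrightarrow> \<bar>even_sol l x - even_sol bottom x\<bar> \<le> L * \<bar>l - bottom\<bar>"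
    "\<And>l x. \<bar>l - bottom\<bar> \<le> 1 \<Longrightarrow> 0 \<le> x \<Longrightarrow> x \<le> d/2 \<Longrightarrow> \<bar>even_sol' l x - even_sol' bottom x\<bar> \<le> L * \<bar>l - bottom\<bar>"
    unfolding even_sol_def even_sol'_def by blast
  obtain y where y: "y \<in> {0..d/2}" "\<And>x. x \<in> {0..d/2} \<Longrightarrow> even_sol bottom y \<le> even_sol bottom x"
    using continuous_attains_inf[OF compact_Icc[of 0 "d/2"] _ solution_cont(1)[OF even_sol(1)[of bottom]]] d_pos by auto
  define m where "m = min (even_sol bottom y) (even_sol' bottom (d/2))"
  have m: "m > 0" using b y bottom_subcritical by (simp add: m_def subcritical_def)
  \<comment> \<open>A step that changes the solution on \<open>[0, d/2]\<close> by less than the minimum \<open>m\<close> of the margins.\<close>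
  define e where "e = min 1 (m / (2 * (L + 1)))"
  have e: "e > 0" "e \<le> 1" using m L by (auto simp: e_def)
  have "L * e \<le> (L + 1) * (m / (2 * (L + 1)))" using L e by (intro mult_mono) (auto simp: e_def)
  also have "\<dots> = m / 2" using L by (simp add: field_simps)
  finally have Le: "L * e < m" using m by simp
  have "bottom + e \<in> subcritical"
  proof -
    have "even_sol (bottom + e) x > 0" if "x \<in> {0..d/2}" for x
      
    proof -
      have "\<bar>even_sol (bottom + e) x - even_sol bottom x\<bar> \<le> L * e"
        using L(2)[of "bottom + e" x] e that by simp
      moreover have "m \<le> even_sol bottom x" using y(2)[OF that] by (simp add: m_def)
      ultimately show ?thesis using Le by linarith
    qed
    moreover have "even_sol' (bottom + e) (d/2) > 0"
      
    proof -
      have "\<bar>even_sol' (bottom + e) (d/2) - even_sol' bottom (d/2)\<bar> \<le> L * e"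
        using L(3)[of "bottom + e" "d/2"] e X by simp
      moreover have "m \<le> even_sol' bottom (d/2)" by (simp add: m_def)
      ultimately show ?thesis using Le by linarith
    qed
    ultimately show ?thesis by (simp add: subcritical_def less_imp_le)
  qed
  then show False using bottom_upper e by fastforce
qed

end

section \<open>The decaying Floquet solution\<close>

context even_periodic
begin

lemma subcritical_iff: "l \<in> subcritical \<longleftrightarrow> l \<le> bottom"
  using bottom_upper below_bottom(1) bottom_subcritical by (cases "l = bottom") force+

lemma even_sol_pos: "l \<le> bottom \<Longrightarrow> 0 \<le> x \<Longrightarrow> x \<le> d/2 \<Longrightarrow> even_sol l x > 0"
  using subcritical_iff[of l] by (auto simp: subcritical_def)

lemma even_sol'_half_nonneg: "l \<le> bottom \<Longrightarrow> even_sol' l (d/2) \<ge> 0"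
  using subcritical_iff[of l] by (auto simp: subcritical_def)

lemma quotient_increasing:
  assumes l: "l \<le> bottom" and xy: "0 \<le> x" "x < y" "y \<le> d/2"
  shows "odd_sol l x / even_sol l x < odd_sol l y / even_sol l y"
proof (rule DERIV_pos_imp_increasing[OF xy(2), of "\<lambda>x. odd_sol l x / even_sol l x"])
  fix z assume z: "x \<le> z" "z \<le> y"
  then have p: "even_sol l z > 0" using even_sol_pos[OF l, of z] xy by simp
  have "((\<lambda>x. odd_sol l x / even_sol l x) has_real_derivative
      (odd_sol' l z * even_sol l z - odd_sol l z * even_sol' l z) / (even_sol l z * even_sol l z)) (at z)"
    using p by (intro DERIV_divide ode_solution_D[OF even_sol(1)] ode_solution_D[OF odd_sol(1)]) simp
  also have "odd_sol' l z * even_sol l z - odd_sol l z * even_sol' l z = 1"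
    using wronskian_one[of l z] by (simp add: mult.commute)
  finally show "\<exists>D. ((\<lambda>x. odd_sol l x / even_sol l x) has_real_derivative D) (at z) \<and> D > 0"
    using p by (intro exI[of _ "1 / (even_sol l z * even_sol l z)"] conjI) auto
qed

lemma odd_sol_half_pos:
  assumes l: "l \<le> bottom" shows "odd_sol l (d/2) > 0" "odd_sol' l (d/2) > 0"
proof -
  have h: "0 < d/2" using d_pos by simp
  have a: "even_sol l (d/2) > 0" using even_sol_pos[OF l] h by simp
  show e: "odd_sol l (d/2) > 0"
    using quotient_increasing[OF l order_refl h order_refl] a by (simp add: odd_sol zero_less_divide_iff)
  have "even_sol l (d/2) * odd_sol' l (d/2) = 1 + even_sol' l (d/2) * odd_sol l (d/2)"
    using wronskian_one[of l "d/2"] by simp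
  also have "\<dots> > 0" using e even_sol'_half_nonneg[OF l] by (simp add: add_pos_nonneg)
  finally show "odd_sol' l (d/2) > 0" using a by (simp add: zero_less_mult_iff)
qed

text \<open>
  The slope at \<open>0\<close> of the decaying solution is \<open>- kappa\<close>. The formula
  is what \<open>psi_shift\<close> requires: the vectors of values and slopes of
  \<open>psi\<close> at \<open>-d/2\<close> and \<open>d/2\<close> must be parallel.
\<close>

definition kappa :: "real \<Rightarrow> real" where
  "kappa l = sqrt ((even_sol l (d/2) * even_sol' l (d/2)) / (odd_sol l (d/2) * odd_sol' l (d/2)))"

definition psi :: "real \<Rightarrow> real \<Rightarrow> real" where
  "psi l x = even_sol l x - kappa l * odd_sol l x"

definition psi' :: "real \<Rightarrow> real \<Rightarrow> real" where
  "psi' l x = even_sol' l x - kappa l * odd_sol' l x"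

definition rho :: "real \<Rightarrow> real" where
  "rho l = psi l (d/2) / psi l (- (d/2))"

lemma kappa_nonneg: "l \<le> bottom \<Longrightarrow> kappa l \<ge> 0"
  using even_sol'_half_nonneg[of l] even_sol_pos[of l "d/2"] odd_sol_half_pos[of l] d_pos by (simp add: kappa_def)

lemma kappa_pos: "l < bottom \<Longrightarrow> kappa l > 0"
  using below_bottom(2)[of l] even_sol_pos[of l "d/2"] odd_sol_half_pos[of l] d_pos by (simp add: kappa_def)

lemma kappa_bottom: "kappa bottom = 0"
  by (simp add: kappa_def bottom_neumann)

lemma psi_solution: "ode_solution (\<lambda>x. V x - l) (psi l) (psi' l)"
  using ode_solution_combine[OF even_sol(1) odd_sol(1), of l 1 "- kappa l"]
  by (simp add: psi_def[abs_def] psi'_def[abs_def])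

lemma psi_0: "psi l 0 = 1" "psi' l 0 = - kappa l"
  by (simp_all add: psi_def psi'_def even_sol odd_sol)

text \<open>
  The quotient of the odd and the even solution increases, so it suffices to compare at the end
  point \<open>d/2\<close>. There \<open>kappa s < c\<close> holds because the Wronskian is
  \<open>1\<close>.
\<close>

lemma psi_pos_half:
  assumes l: "l \<le> bottom" and x: "0 \<le> x" "x \<le> d/2" shows "psi l x > 0"
proof -
  define a where "a = even_sol l (d/2)"
  define b where "b = even_sol' l (d/2)"
  define e where "e = odd_sol l (d/2)"
  define f where "f = odd_sol' l (d/2)"
  have pos: "a > 0" "b \<ge> 0" "e > 0" "f > 0" and w: "a * f - b * e = 1"
    using even_sol_pos[OF l, of "d/2"] even_sol'_half_nonneg[OF l] odd_sol_half_pos[OF l] d_pos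
      wronskian_one[of l "d/2"] by (auto simp: a_def b_def e_def f_def)
  have k2: "(kappa l)\<^sup>2 = (a * b) / (e * f)"
    using pos by (simp add: kappa_def a_def b_def e_def f_def)
  have "(kappa l * e)\<^sup>2 = a * (b * e) / f"
    using pos by (simp add: power_mult_distrib k2) (simp add: power2_eq_square)
  also have "\<dots> < a * (a * f) / f"
    using pos w by (intro divide_strict_right_mono mult_strict_left_mono) auto
  also have "\<dots> = a\<^sup>2" using pos by (simp add: power2_eq_square)
  finally have ke: "kappa l * e < a" by (rule power2_less_imp_less) (use pos in simp)
  have c: "even_sol l x > 0" by (rule even_sol_pos[OF l x])
  have "odd_sol l x / even_sol l x \<le> e / a"
    using quotient_increasing[OF l x(1), of "d/2"] x(2)
    by (cases "x = d/2") (auto simp: e_def a_def)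
  then have "kappa l * (odd_sol l x / even_sol l x) \<le> kappa l * (e / a)"
    using kappa_nonneg[OF l] by (rule mult_left_mono)
  also have "\<dots> < 1" using ke pos by simp
  finally show ?thesis using c by (simp add: psi_def field_simps)
qed

lemma psi_pos_cell:
  assumes l: "l \<le> bottom" and x: "\<bar>x\<bar> \<le> d/2" shows "psi l x > 0"
proof (cases "x \<ge> 0")
  case True
  then show ?thesis using psi_pos_half[OF l, of x] x by simp
next
  case False
  have "psi l x = even_sol l (- x) + kappa l * odd_sol l (- x)"
    by (simp add: psi_def parity)
  moreover have "odd_sol l (- x) \<ge> 0"
    using quotient_increasing[OF l order_refl, of "- x"] False x even_sol_pos[OF l, of "- x"]
    by (simp add: odd_sol zero_less_divide_iff)
  moreover have "even_sol l (- x) > 0" using even_sol_pos[OF l, of "- x"] x False by simp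
  ultimately show ?thesis using kappa_nonneg[OF l] by (simp add: add_pos_nonneg)
qed

text \<open>
  Both sides solve the same equation, so it is enough that values and slopes agree at the single
  point \<open>- d/2\<close>.
\<close>

lemma psi_shift:
  assumes l: "l \<le> bottom"
  shows "psi l (x + d) = rho l * psi l x" "psi' l (x + d) = rho l * psi' l x"
proof -
  define a where "a = even_sol l (d/2)"
  define b where "b = even_sol' l (d/2)"
  define e where "e = odd_sol l (d/2)"
  define f where "f = odd_sol' l (d/2)"
  define k where "k = kappa l"
  have pos: "a > 0" "b \<ge> 0" "e > 0" "f > 0"
    using even_sol_pos[OF l, of "d/2"] even_sol'_half_nonneg[OF l] odd_sol_half_pos[OF l] d_pos
    by (auto simp: a_def b_def e_def f_def)
  have k2: "k\<^sup>2 * (e * f) = a * b"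
    using pos by (simp add: k_def kappa_def a_def b_def e_def f_def)
  have vals: "psi l (d/2) = a - k * e" "psi l (- (d/2)) = a + k * e"
     "psi' l (d/2) = b - k * f" "psi' l (- (d/2)) = - b - k * f"
    unfolding psi_def psi'_def parity a_def b_def e_def f_def k_def by simp_all
  have nz: "a + k * e > 0" using pos kappa_nonneg[OF l] by (simp add: k_def add_pos_nonneg)
  have r: "rho l = (a - k * e) / (a + k * e)" by (simp add: rho_def vals)
  have 1: "rho l * psi l (- (d/2)) = psi l (d/2)" using nz by (simp add: r vals)
  have "(a - k * e) * (- b - k * f) = (b - k * f) * (a + k * e)"
    using k2 by (simp add: algebra_simps power2_eq_square)
  then have 2: "rho l * psi' l (- (d/2)) = psi' l (d/2)" using nz by (simp add: r vals field_simps)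
  have "ode_solution (\<lambda>x. V x - l) (\<lambda>x. psi l (x + d)) (\<lambda>x. psi' l (x + d))"
    using ode_solution_shift[OF psi_solution[of l], of d] by (simp add: V_period)
  moreover have "ode_solution (\<lambda>x. V x - l) (\<lambda>x. rho l * psi l x) (\<lambda>x. rho l * psi' l x)"
    using ode_solution_combine[OF psi_solution psi_solution, of l "rho l" 0] by simp
  ultimately show "psi l (x + d) = rho l * psi l x" "psi' l (x + d) = rho l * psi' l x"
    using solution_unique[of l "\<lambda>x. psi l (x + d)" "\<lambda>x. psi' l (x + d)"
        "\<lambda>x. rho l * psi l x" "\<lambda>x. rho l * psi' l x" "- (d/2)" x] 1 2 by auto
qed

lemma rho_pos: "l \<le> bottom \<Longrightarrow> rho l > 0"
  using psi_pos_cell[of l "d/2"] psi_pos_cell[of l "- (d/2)"] d_pos by (simp add: rho_def)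

lemma rho_less_1:
  assumes "l < bottom" shows "rho l < 1"
proof -
  have l: "l \<le> bottom" using assms by simp
  have "psi l (d/2) < psi l (- (d/2))"
    using kappa_pos[OF assms] odd_sol_half_pos[OF l] by (simp add: psi_def parity)
  then show ?thesis using psi_pos_cell[OF l, of "- (d/2)"] d_pos by (simp add: rho_def)
qed

lemma rho_bottom: "rho bottom = 1"
  using psi_pos_cell[of bottom "- (d/2)"] d_pos by (simp add: rho_def psi_def kappa_bottom parity)

lemma psi_pos:
  assumes l: "l \<le> bottom" shows "psi l x > 0"
proof -
  obtain k where k: "\<bar>x + of_int k * d\<bar> \<le> d/2" using shift_into_cell by blast
  have "psi l (x + d) > 0 \<longleftrightarrow> psi l x > 0" for x
    using rho_pos[OF l] by (simp add: psi_shift(1)[OF l] zero_less_mult_iff)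
  then have "psi l (x + of_int k * d) > 0 \<longleftrightarrow> psi l x > 0" by (rule int_shift_iff)
  then show ?thesis using psi_pos_cell[OF l k] by simp
qed

text \<open>
  The Wronskian \<open>W\<close> of the two Floquet solutions decreases strictly, while over one
  period it is multiplied by \<open>rho l * rho \<mu> < 1\<close>. Only a positive function can
  do both.
\<close>

lemma log_deriv_strict_mono:
  assumes "l < \<mu>" "\<mu> \<le> bottom"
  shows "psi' l x / psi l x < psi' \<mu> x / psi \<mu> x"
proof -
  have l: "l < bottom" "l \<le> bottom" using assms by auto
  define W where "W x = psi l x * psi' \<mu> x - psi' l x * psi \<mu> x" for x
  have "W (x + d) < W x"
  proof (rule DERIV_neg_imp_decreasing[of x "x + d" W])
    fix y
    have "(W has_real_derivative (l - \<mu>) * (psi l y * psi \<mu> y)) (at y)"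
      unfolding W_def using wronskian_deriv[OF psi_solution[of l] psi_solution[of \<mu>], of y] by simp
    moreover have "(l - \<mu>) * (psi l y * psi \<mu> y) < 0"
      using assms psi_pos[OF l(2)] psi_pos[OF assms(2)] by (intro mult_neg_pos mult_pos_pos) auto
    ultimately show "\<exists>D. (W has_real_derivative D) (at y) \<and> D < 0" by blast
  qed (use d_pos in simp)
  moreover have "W (x + d) = rho l * rho \<mu> * W x"
    unfolding W_def psi_shift[OF l(2)] psi_shift[OF assms(2)] by (simp add: algebra_simps)
  moreover have "rho l * rho \<mu> < 1"
  proof -
    have "rho \<mu> \<le> 1" using rho_less_1[of \<mu>] rho_bottom assms(2) by (cases "\<mu> = bottom") auto
    then have "rho l * rho \<mu> \<le> rho l" using rho_pos[OF l(2)] by (simp add: mult_left_le)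
    then show ?thesis using rho_less_1[OF l(1)] by simp
  qed
  ultimately have "(1 - rho l * rho \<mu>) * W x > 0" "1 - rho l * rho \<mu> > 0" by (simp_all add: algebra_simps)
  then have "W x > 0" by (simp add: zero_less_mult_iff)
  then show ?thesis using psi_pos[OF l(2), of x] psi_pos[OF assms(2), of x]
    by (simp add: W_def field_simps)
qed

text \<open>
  Up to the positive factor \<open>psi l t\<close> this is the sum of the logarithmic derivatives
  of \<open>psi l\<close> at \<open>t\<close> and at \<open>0\<close>.
\<close>

definition matching :: "real \<Rightarrow> real \<Rightarrow> real" where
  "matching t l = psi' l t - kappa l * psi l t"

lemma kappa_continuous: "continuous_on {..bottom} kappa"
proof -
  have "odd_sol l (d/2) * odd_sol' l (d/2) \<noteq> 0" if "l \<in> {..bottom}" for l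
    using odd_sol_half_pos[of l] that by simp
  then show ?thesis unfolding kappa_def[abs_def]
    by (intro continuous_on_real_sqrt continuous_on_divide continuous_on_mult sol_continuous) auto
qed

lemma matching_continuous: "continuous_on {..bottom} (matching t)"
  unfolding matching_def[abs_def] psi_def psi'_def
  by (intro continuous_on_diff continuous_on_mult kappa_continuous sol_continuous)

lemma matching_zero_iff:
  assumes "l \<le> bottom"
  shows "matching t l = 0 \<longleftrightarrow> psi' l t / psi l t + psi' l 0 / psi l 0 = 0"
  using psi_pos[OF assms, of t] by (auto simp: matching_def psi_0 field_simps)

lemma matching_strict:
  assumes "l < \<mu>" "\<mu> \<le> bottom" "matching t l = 0" shows "matching t \<mu> > 0"
proof -
  have "psi' l t / psi l t + psi' l 0 / psi l 0 = 0"
    using assms by (subst matching_zero_iff[symmetric]) auto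
  then have "psi' \<mu> t / psi \<mu> t + psi' \<mu> 0 / psi \<mu> 0 > 0"
    using log_deriv_strict_mono[OF assms(1,2), of t] log_deriv_strict_mono[OF assms(1,2), of 0] by linarith
  then show ?thesis using psi_pos[OF assms(2), of t] by (auto simp: matching_def psi_0 field_simps)
qed

text \<open>
  Below the potential the positive solution \<open>psi\<close> is convex. It decays over a
  period, so its slope is negative everywhere.
\<close>

lemma matching_neg:
  assumes "\<And>x. l < V x" shows "l < bottom" "matching t l < 0"
proof -
  have lx: "\<And>x. l \<le> V x" using assms less_imp_le by blast
  have lb: "l \<le> bottom" using subcritical_below_V[of l] lx by (simp add: subcritical_iff)
  have even': "even_sol' l (d/2) > even_sol' l 0"
  proof (rule DERIV_pos_imp_increasing[of 0 "d/2" "even_sol' l"])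
    fix x assume "0 \<le> x" "x \<le> d/2"
    then show "\<exists>y. (even_sol' l has_real_derivative y) (at x) \<and> 0 < y"
      using ode_solution_D(2)[OF even_sol(1)[of l], of x] even_sol_pos[OF lb] assms[of x]
      by (intro exI[of _ "(V x - l) * even_sol l x"]) auto
  qed (use d_pos in simp)
  then have "l \<noteq> bottom" using bottom_neumann by (auto simp: even_sol)
  then show l: "l < bottom" using lb by simp
  have "psi' l x < 0" for x
  proof (rule ccontr)
    assume *: "\<not> psi' l x < 0"
    have inc: "psi' l x \<le> psi' l y" if "x \<le> y" for y
    proof (rule DERIV_nonneg_imp_nondecreasing[OF that])
      fix z
      show "\<exists>y. (psi' l has_real_derivative y) (at z) \<and> 0 \<le> y"
        using ode_solution_D(2)[OF psi_solution[of l], of z] psi_pos[OF lb, of z] lx[of z]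
        by (intro exI[of _ "(V z - l) * psi l z"]) auto
    qed
    have "psi l x \<le> psi l (x + d)"
    proof (rule DERIV_nonneg_imp_nondecreasing[of x "x + d" "psi l"])
      fix z assume "x \<le> z"
      show "\<exists>y. (psi l has_real_derivative y) (at z) \<and> 0 \<le> y"
        using ode_solution_D(1)[OF psi_solution[of l], of z] inc[OF \<open>x \<le> z\<close>] * by force
    qed (use d_pos in simp)
    then show False
      using psi_shift(1)[OF lb, of x] rho_less_1[OF l] psi_pos[OF lb, of x] by (simp add: mult_le_cancel_right1)
  qed
  moreover have "kappa l * psi l t \<ge> 0" using kappa_nonneg[OF lb] psi_pos[OF lb, of t] by simp
  ultimately show "matching t l < 0" unfolding matching_def by (metis diff_less_0_iff_less less_le_trans)
qed

lemma matching_bottom: "matching t bottom = even_sol' bottom t"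
  by (simp add: matching_def kappa_bottom psi'_def)

lemma matching_zero_exists:
  assumes "even_sol' bottom t > 0" shows "\<exists>!l. l < bottom \<and> matching t l = 0"
proof -
  \<comment> \<open>Below the potential, where \<open>matching\<close> is negative.\<close>
  define l0 where "l0 = - V_bound - 1"
  have l0: "l0 < V x" for x using V_bound[of x] by (simp add: l0_def)
  note neg = matching_neg(1)[OF l0] matching_neg(2)[OF l0, of t]
  have "\<exists>l\<ge>l0. l \<le> bottom \<and> matching t l = 0"
    
    by (rule IVT'[of "matching t"])
       (use neg assms matching_bottom[of t] in \<open>auto intro: continuous_on_subset[OF matching_continuous]\<close>)
  then obtain l where l: "l \<le> bottom" "matching t l = 0" by blast
  then have "l \<noteq> bottom" using assms matching_bottom by auto
  with l have l': "l < bottom" by simp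
  show ?thesis
  proof (rule ex1I[of _ l])
    show "l < bottom \<and> matching t l = 0" using l l' by simp
    fix \<mu> assume "\<mu> < bottom \<and> matching t \<mu> = 0"
    then show "\<mu> = l" using matching_strict[of l \<mu> t] matching_strict[of \<mu> l t] l l' 
      by (cases \<mu> l rule: linorder_cases) auto
  qed
qed

lemma matching_zero_none:
  assumes "even_sol' bottom t \<le> 0" "l < bottom" shows "matching t l \<noteq> 0"
  using matching_strict[OF assms(2) order_refl, of t] matching_bottom assms(1) by auto

lemma ground_state_reflect: "even_sol' bottom (d - t) = - even_sol' bottom t"
proof -
  have "psi' bottom (- t + d) = psi' bottom (- t)"
    using psi_shift(2)[of bottom "- t"] by (simp add: rho_bottom)
  then show ?thesis by (simp add: psi'_def kappa_bottom parity add.commute)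
qed

lemma ground_state_pos: "even_sol bottom x > 0"
  using psi_pos[of bottom x] by (simp add: psi_def kappa_bottom)

text \<open>
  On \<open>[0, d/2]\<close> the function \<open>F\<close> vanishes at both ends, and the sign of
  its derivative is that of \<open>\<sigma> (V - bottom)\<close>, which is decreasing. So
  \<open>F\<close> first increases and then decreases. The two cases compare \<open>F t\<close>
  with the end point on the side of \<open>t\<close> on which the sign of the derivative is
  known. The parameter \<open>\<sigma>\<close> covers decreasing and increasing potentials at
  once.
\<close>

lemma ground_state_deriv_sign:
  fixes \<sigma> :: real
  assumes dec: "\<And>x y. 0 \<le> x \<Longrightarrow> x < y \<Longrightarrow> y \<le> d/2 \<Longrightarrow> \<sigma> * V y < \<sigma> * V x"
    and t: "0 < t" "t < d/2"
  shows "\<sigma> * even_sol' bottom t > 0"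
proof -
  define F where "F x = \<sigma> * even_sol' bottom x" for x
  have F': "(F has_real_derivative \<sigma> * (V x - bottom) * even_sol bottom x) (at x)" for x
    unfolding F_def[abs_def] mult.assoc by (rule DERIV_cmult[OF ode_solution_D(2)[OF even_sol(1)]])
  have Fc: "continuous_on A F" for A by (rule DERIV_continuous_on[OF DERIV_subset[OF F']]) simp
  have "F t > 0"
  proof (cases "\<sigma> * V t \<ge> \<sigma> * bottom")
    case True
    have "F 0 < F t"
    proof (rule DERIV_pos_imp_increasing_open[OF t(1) _ Fc])
      fix x assume "0 < x" "x < t"
      then have "\<sigma> * V t < \<sigma> * V x" using dec t by simp
      with True have "\<sigma> * (V x - bottom) > 0" by (simp add: right_diff_distrib)
      then show "\<exists>y. (F has_real_derivative y) (at x) \<and> y > 0"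
        using F'[of x] ground_state_pos[of x] by (meson mult_pos_pos)
    qed
    then show ?thesis by (simp add: F_def even_sol)
  next
    case False
    have "F (d/2) < F t"
    proof (rule DERIV_neg_imp_decreasing_open[OF t(2) _ Fc])
      fix x assume "t < x" "x < d/2"
      then have "\<sigma> * V x < \<sigma> * V t" using dec t by simp
      with False have "\<sigma> * (V x - bottom) < 0" by (simp add: right_diff_distrib)
      then show "\<exists>y. (F has_real_derivative y) (at x) \<and> y < 0"
        using F'[of x] ground_state_pos[of x] by (meson mult_neg_pos)
    qed
    then show ?thesis by (simp add: F_def bottom_neumann)
  qed
  then show ?thesis by (simp add: F_def)
qed

lemma ground_state_deriv_pos:
  assumes "strict_antimono_on {0..d/2} V" "0 < t" "t < d/2"
  shows "even_sol' bottom t > 0"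
  using ground_state_deriv_sign[of 1 t] monotone_onD[OF assms(1)] assms(2,3) by simp

lemma ground_state_deriv_neg:
  assumes "strict_mono_on {0..d/2} V" "0 < t" "t < d/2"
  shows "even_sol' bottom t < 0"
  using ground_state_deriv_sign[of "-1" t] monotone_onD[OF assms(1)] assms(2,3) by simp

end

section \<open>The resolvent below the ground state energy\<close>

lemma wderiv_of_real:
  assumes "\<And>x. (f has_real_derivative f' x) (at x)" "continuous_on UNIV f'"
  shows "wderiv (\<lambda>x. complex_of_real (f x)) (\<lambda>x. complex_of_real (f' x))"
proof (rule wderiv_classical[where S = "{}"])
  show "continuous_on UNIV (\<lambda>x. complex_of_real (f x))"
    by (intro continuous_intros DERIV_continuous_on[OF assms(1)])
  show "loc_int (\<lambda>x. complex_of_real (f' x))"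
    by (intro loc_int_continuous continuous_intros assms(2))
  show "((\<lambda>x. complex_of_real (f x)) has_vector_derivative complex_of_real (f' x)) (at x)" for x
    using assms(1)[of x] by (intro has_vector_derivative_of_real) (simp add: has_real_derivative_iff_has_vector_derivative)
qed simp

lemma integrable_inverse_square: "integrable lborel (\<lambda>x::real. inverse (1 + x\<^sup>2))"
proof -
  define f :: "real \<Rightarrow> real" where "f x = inverse (1 + x\<^sup>2)" for x
  have f0: "f x \<ge> 0" for x by (simp add: f_def)
  have fm: "f \<in> borel_measurable borel" unfolding f_def[abs_def] by measurable
  have "(\<integral>\<^sup>+x. ennreal (f x) * indicator {0..} x \<partial>lborel) = pi / 2 - arctan 0"
    using tendsto_arctan_at_top
    by (intro nn_integral_FTC_atLeast fm f0) (auto simp: f_def intro!: derivative_eq_intros)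
  then have R: "(\<integral>\<^sup>+x. ennreal (f x) * indicator {0..} x \<partial>lborel) < \<infinity>" by simp
  have "(\<integral>\<^sup>+x. ennreal (f x) * indicator {..0} x \<partial>lborel) = (\<integral>\<^sup>+x. ennreal (f (- x)) * indicator {..0} (- x) \<partial>lborel)"
    using nn_integral_real_affine[of "\<lambda>x. ennreal (f x) * indicator {..0} x" "-1" 0] fm by simp
  also have "\<dots> = (\<integral>\<^sup>+x. ennreal (f x) * indicator {0..} x \<partial>lborel)"
    by (intro nn_integral_cong) (auto simp: f_def indicator_def)
  finally have L: "(\<integral>\<^sup>+x. ennreal (f x) * indicator {..0} x \<partial>lborel) < \<infinity>" using R by simp
  have "(\<integral>\<^sup>+x. ennreal (f x) \<partial>lborel) \<le>
     (\<integral>\<^sup>+x. ennreal (f x) * indicator {0..} x + ennreal (f x) * indicator {..0} x \<partial>lborel)"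
    by (intro nn_integral_mono) (auto simp: indicator_def)
  also have "\<dots> = (\<integral>\<^sup>+x. ennreal (f x) * indicator {0..} x \<partial>lborel) + (\<integral>\<^sup>+x. ennreal (f x) * indicator {..0} x \<partial>lborel)"
    using fm by (intro nn_integral_add borel_measurable_times_ennreal borel_measurable_indicator) auto
  also have "\<dots> < \<infinity>" using L R by simp
  finally have "integrable lborel f" using fm f0 by (intro integrableI_nonneg) auto
  then show ?thesis by (simp add: f_def[abs_def])
qed

context even_periodic
begin

definition log_psi' :: "real \<Rightarrow> real \<Rightarrow> real" where
  "log_psi' l x = psi' l x / psi l x"

lemma psi_cont: "continuous_on A (psi l)" "continuous_on A (psi' l)"
  by (rule solution_cont[OF psi_solution])+

text \<open>The Riccati equation.\<close>

lemma log_psi'_deriv: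
  assumes l: "l \<le> bottom"
  shows "(log_psi' l has_real_derivative V x - l - (log_psi' l x)\<^sup>2) (at x)"
proof -
  have "((\<lambda>x. psi' l x / psi l x) has_real_derivative
      (((V x - l) * psi l x) * psi l x - psi' l x * psi' l x) / (psi l x * psi l x)) (at x)"
    using psi_pos[OF l, of x] by (intro DERIV_divide ode_solution_D[OF psi_solution]) simp
  then show ?thesis
    unfolding log_psi'_def[abs_def] using psi_pos[OF l, of x]
    by (simp add: power2_eq_square diff_divide_distrib)
qed

lemma log_psi'_cont: "l \<le> bottom \<Longrightarrow> continuous_on UNIV (log_psi' l)"
  by (rule DERIV_continuous_on[OF log_psi'_deriv])

lemma log_psi'_bounded: "l \<le> bottom \<Longrightarrow> \<exists>B. \<forall>x. \<bar>log_psi' l x\<bar> \<le> B"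
  using rho_pos[of l]
  by (intro periodic_bounded log_psi'_cont) (simp_all add: log_psi'_def psi_shift)

definition decay_rate :: "real \<Rightarrow> real" where "decay_rate l = - ln (rho l) / d"

text \<open>The periodic part of \<open>psi\<close>.\<close>

definition floquet_factor :: "real \<Rightarrow> real \<Rightarrow> real" where
  "floquet_factor l x = exp (decay_rate l * x) * psi l x"

lemma decay_rate_pos: "l < bottom \<Longrightarrow> decay_rate l > 0"
  using rho_pos[of l] rho_less_1[of l] d_pos by (simp add: decay_rate_def divide_neg_pos)

lemma floquet_factor_pos: "l \<le> bottom \<Longrightarrow> floquet_factor l x > 0"
  by (simp add: floquet_factor_def psi_pos)

lemma floquet_factor_deriv:
  assumes l: "l \<le> bottom"
  shows "(floquet_factor l has_real_derivative (decay_rate l + log_psi' l x) * floquet_factor l x) (at x)"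
proof -
  have "((\<lambda>x. exp (decay_rate l * x) * psi l x) has_real_derivative
      (exp (decay_rate l * x) * decay_rate l) * psi l x + psi' l x * exp (decay_rate l * x)) (at x)"
    by (intro DERIV_mult ode_solution_D[OF psi_solution]) (auto intro!: derivative_eq_intros)
  also have "(exp (decay_rate l * x) * decay_rate l) * psi l x + psi' l x * exp (decay_rate l * x)
      = (decay_rate l + psi' l x / psi l x) * (exp (decay_rate l * x) * psi l x)"
    using psi_pos[OF l, of x] by (simp add: field_simps)
  finally show ?thesis unfolding floquet_factor_def[abs_def] log_psi'_def .
qed

lemma floquet_factor_period:
  assumes l: "l \<le> bottom" shows "floquet_factor l (x + d) = floquet_factor l x"
proof -
  have "exp (decay_rate l * d) * rho l = 1"
    using rho_pos[OF l] d_pos by (simp add: decay_rate_def exp_minus)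
  moreover have "floquet_factor l (x + d) = (exp (decay_rate l * d) * rho l) * floquet_factor l x"
    unfolding floquet_factor_def psi_shift[OF l] by (simp add: distrib_left exp_add)
  ultimately show ?thesis by simp
qed

lemma floquet_factor_bounded:
  assumes l: "l \<le> bottom"
  shows "\<exists>B. \<forall>x. floquet_factor l x \<le> B \<and> 1 / floquet_factor l x \<le> B"
proof -
  have c: "continuous_on UNIV (floquet_factor l)"
    by (rule DERIV_continuous_on[OF floquet_factor_deriv[OF l]])
  obtain B1 where B1: "\<forall>x. \<bar>floquet_factor l x\<bar> \<le> B1"
    using periodic_bounded[OF c floquet_factor_period[OF l]] by blast
  have "continuous_on UNIV (\<lambda>x. 1 / floquet_factor l x)"
    using c floquet_factor_pos[OF l] by (intro continuous_intros) (auto simp: less_imp_neq[symmetric])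
  then obtain B2 where B2: "\<forall>x. \<bar>1 / floquet_factor l x\<bar> \<le> B2"
    using periodic_bounded[of "\<lambda>x. 1 / floquet_factor l x"] floquet_factor_period[OF l] by auto
  have "floquet_factor l x \<le> max B1 B2 \<and> 1 / floquet_factor l x \<le> max B1 B2" for x
    using B1[rule_format, of x] B2[rule_format, of x] floquet_factor_pos[OF l, of x]
    by (simp add: le_max_iff_disj)
  then show ?thesis by blast
qed

lemma psi_eq_floquet: "psi l x = exp (- decay_rate l * x) * floquet_factor l x"
  by (simp add: floquet_factor_def exp_minus)

text \<open>
  Multiplication by the periodic part of \<open>psi\<close>, or by its reciprocal, removes the
  periodic oscillation of the coefficient and leaves the constant
  \<open>\<plusminus> decay_rate l\<close>.
\<close>

lemma first_order_well_posed:
  assumes l: "l < bottom"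
  shows "well_posed (log_psi' l)" "well_posed (\<lambda>x. - log_psi' l x)"
proof -
  have l': "l \<le> bottom" using l by simp
  obtain B where B: "\<And>x. floquet_factor l x \<le> B" "\<And>x. 1 / floquet_factor l x \<le> B"
    using floquet_factor_bounded[OF l'] by blast
  note pos = floquet_factor_pos[OF l'] and cont = log_psi'_cont[OF l']
  have s: "decay_rate l \<noteq> 0" "- decay_rate l \<noteq> 0" using decay_rate_pos[OF l] by auto
  have "((\<lambda>x. 1 / floquet_factor l x) has_real_derivative
      (- decay_rate l - log_psi' l x) * (1 / floquet_factor l x)) (at x)" for x
    using pos[of x] by (auto intro!: derivative_eq_intros floquet_factor_deriv[OF l'] simp: field_simps)
  then show "well_posed (log_psi' l)"
    by (rule well_posed_gauge[OF well_posed_const[OF s(2)]]) (use pos B cont in auto)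
  have "(floquet_factor l has_real_derivative
      (decay_rate l - (- log_psi' l x)) * floquet_factor l x) (at x)" for x
    using floquet_factor_deriv[OF l', of x] by simp
  then show "well_posed (\<lambda>x. - log_psi' l x)"
    by (rule well_posed_gauge[OF well_posed_const[OF s(1)]])
       (use pos B in \<open>auto intro: continuous_on_minus cont\<close>)
qed

lemma wderiv_log_psi'_mult:
  assumes l: "l \<le> bottom" and W: "wderiv u u1"
  shows "wderiv (\<lambda>x. log_psi' l x *\<^sub>R u x)
    (\<lambda>x. (V x - l - (log_psi' l x)\<^sup>2) *\<^sub>R u x + log_psi' l x *\<^sub>R u1 x)"
  by (rule wderiv_mult[OF W log_psi'_deriv[OF l]])
     (intro continuous_intros V_cont log_psi'_cont[OF l])

lemma L2_V_mult: "u \<in> L2 \<Longrightarrow> (\<lambda>x. (V x - l) *\<^sub>R u x) \<in> L2"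
  by (rule L2_scale(1)[OF _ _ q_bound]) (intro borel_measurable_continuous_onI continuous_intros V_cont | simp)+

lemma L2_log_psi'_mult:
  assumes "l \<le> bottom" "u \<in> L2" shows "(\<lambda>x. log_psi' l x *\<^sub>R u x) \<in> L2"
proof -
  obtain B where "\<And>x. \<bar>log_psi' l x\<bar> \<le> B" using log_psi'_bounded[OF assms(1)] by blast
  then show ?thesis
    by (intro L2_scale(1)[OF assms(2)] borel_measurable_continuous_onI log_psi'_cont assms(1))
qed

text \<open>
  With \<open>v = u' - m u\<close> the second-order equation splits into the two first-order
  equations \<open>v' = - m v - f\<close> and \<open>u' = m u + v\<close>.
\<close>

lemma schroedinger_bound:
  assumes l: "l < bottom"
  shows "\<exists>K. \<forall>u u1 f. u \<in> L2 \<longrightarrow> u1 \<in> L2 \<longrightarrow> f \<in> L2 \<longrightarrow> wderiv u u1 \<longrightarrow>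
     wderiv u1 (\<lambda>x. (V x - l) *\<^sub>R u x - f x) \<longrightarrow> L2_norm u \<le> K * L2_norm f"
proof -
  have l': "l \<le> bottom" using l by simp
  obtain K1 where K1: "K1 \<ge> 0" "\<And>u v. u \<in> L2 \<Longrightarrow> v \<in> L2 \<Longrightarrow>
      wderiv u (\<lambda>x. log_psi' l x *\<^sub>R u x + v x) \<Longrightarrow> L2_norm u \<le> K1 * L2_norm v"
    using first_order_well_posed(1)[OF l] unfolding well_posed_def by blast
  obtain K2 where K2: "K2 \<ge> 0" "\<And>u v. u \<in> L2 \<Longrightarrow> v \<in> L2 \<Longrightarrow>
      wderiv u (\<lambda>x. - log_psi' l x *\<^sub>R u x + v x) \<Longrightarrow> L2_norm u \<le> K2 * L2_norm v"
    using first_order_well_posed(2)[OF l] unfolding well_posed_def by blast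
  have "L2_norm u \<le> (K1 * K2) * L2_norm f"
    if u: "u \<in> L2" "u1 \<in> L2" "f \<in> L2" and W: "wderiv u u1" "wderiv u1 (\<lambda>x. (V x - l) *\<^sub>R u x - f x)" for u u1 f
  proof -
    define v where "v x = u1 x - log_psi' l x *\<^sub>R u x" for x
    have v: "v \<in> L2" unfolding v_def[abs_def] by (intro L2_diff u L2_log_psi'_mult l')
    have "wderiv v (\<lambda>x. ((V x - l) *\<^sub>R u x - f x) - ((V x - l - (log_psi' l x)\<^sup>2) *\<^sub>R u x + log_psi' l x *\<^sub>R u1 x))"
      unfolding v_def[abs_def] by (intro wderiv_diff W wderiv_log_psi'_mult l')
    also have "(\<lambda>x. ((V x - l) *\<^sub>R u x - f x) - ((V x - l - (log_psi' l x)\<^sup>2) *\<^sub>R u x + log_psi' l x *\<^sub>R u1 x))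
      = (\<lambda>x. - log_psi' l x *\<^sub>R v x + - f x)"
      by (auto simp: v_def scaleR_conv_of_real algebra_simps power2_eq_square)
    finally have Wv: "wderiv v (\<lambda>x. - log_psi' l x *\<^sub>R v x + - f x)" .
    have f': "(\<lambda>x. - f x) \<in> L2" using L2_cmult[OF u(3), of "-1"] by simp
    have "wderiv u (\<lambda>x. log_psi' l x *\<^sub>R u x + v x)" using W(1) by (simp add: v_def)
    then have "L2_norm u \<le> K1 * L2_norm v" by (rule K1(2)[OF u(1) v])
    also have "\<dots> \<le> K1 * (K2 * L2_norm (\<lambda>x. - f x))"
      using K2(2)[OF v f' Wv] K1(1) by (rule mult_left_mono)
    finally show ?thesis by (simp add: L2_norm_def)
  qed
  then show ?thesis by (intro exI[of _ "K1 * K2"]) auto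
qed

text \<open>The same factorisation as in the bound, read in the other direction.\<close>

lemma schroedinger_solve:
  assumes l: "l < bottom" and f: "f \<in> L2"
  shows "\<exists>u\<in>L2. \<exists>u1\<in>L2. wderiv u u1 \<and> wderiv u1 (\<lambda>x. (V x - l) *\<^sub>R u x - f x)"
proof -
  have l': "l \<le> bottom" using l by simp
  have f': "(\<lambda>x. - f x) \<in> L2" using L2_cmult[OF f, of "-1"] by simp
  obtain v where v: "v \<in> L2" "wderiv v (\<lambda>x. - log_psi' l x *\<^sub>R v x + - f x)"
    using well_posed_solvable[OF first_order_well_posed(2)[OF l] f'] by blast
  obtain u where u: "u \<in> L2" "wderiv u (\<lambda>x. log_psi' l x *\<^sub>R u x + v x)"
    using well_posed_solvable[OF first_order_well_posed(1)[OF l] v(1)] by blast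
  define u1 where "u1 x = log_psi' l x *\<^sub>R u x + v x" for x
  have u1: "u1 \<in> L2" unfolding u1_def[abs_def] by (intro L2_add L2_log_psi'_mult l' u v)
  have Wu: "wderiv u u1" using u(2) by (simp add: u1_def[abs_def])
  have "wderiv u1 (\<lambda>x. ((V x - l - (log_psi' l x)\<^sup>2) *\<^sub>R u x + log_psi' l x *\<^sub>R u1 x) + (- log_psi' l x *\<^sub>R v x + - f x))"
    unfolding u1_def[abs_def] using wderiv_log_psi'_mult[OF l' Wu] v(2)
    by (intro wderiv_add) (simp_all add: u1_def[abs_def])
  also have "(\<lambda>x. ((V x - l - (log_psi' l x)\<^sup>2) *\<^sub>R u x + log_psi' l x *\<^sub>R u1 x) + (- log_psi' l x *\<^sub>R v x + - f x))
     = (\<lambda>x. (V x - l) *\<^sub>R u x - f x)"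
    by (auto simp: u1_def scaleR_conv_of_real algebra_simps power2_eq_square)
  finally show ?thesis using u(1) u1 Wu by blast
qed

lemma below_bottom_resolvent:
  assumes l: "l < bottom"
  shows "complex_of_real l \<in> resolvent_set (sobolev_H 2) (schroedinger V)"
proof -
  obtain K where K: "\<And>u u1 f. u \<in> L2 \<Longrightarrow> u1 \<in> L2 \<Longrightarrow> f \<in> L2 \<Longrightarrow> wderiv u u1 \<Longrightarrow>
     wderiv u1 (\<lambda>x. (V x - l) *\<^sub>R u x - f x) \<Longrightarrow> L2_norm u \<le> K * L2_norm f"
    using schroedinger_bound[OF l] by metis
  define T where "T u = (\<lambda>x. schroedinger V u x - complex_of_real l * u x)" for u
  have T: "T u \<in> L2 \<and> (\<lambda>x. (V x - l) *\<^sub>R u x - T u x) = weak_deriv 2 u" if "u \<in> sobolev_H 2" for u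
  proof -
    from sobolev_H2_D[OF that] have u: "u \<in> L2" "weak_deriv 2 u \<in> L2" by metis+
    have "T u = (\<lambda>x. (V x - l) *\<^sub>R u x - weak_deriv 2 u x)"
      by (auto simp: T_def schroedinger_def scaleR_conv_of_real algebra_simps)
    then show ?thesis using L2_diff[OF L2_V_mult[OF u(1)] u(2)] by simp
  qed
  have D: "\<exists>u1\<in>L2. u \<in> L2 \<and> wderiv u u1 \<and> wderiv u1 (\<lambda>x. (V x - l) *\<^sub>R u x - T u x)" if u: "u \<in> sobolev_H 2" for u
    using sobolev_H2_D[OF u] T[OF u] by metis
  have 1: "\<exists>u\<in>sobolev_H 2. ae_eq (T u) f" if f: "f \<in> L2" for f
  proof -
    obtain u u1 where u: "u \<in> L2" "u1 \<in> L2" "wderiv u u1" "wderiv u1 (\<lambda>x. (V x - l) *\<^sub>R u x - f x)"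
      using schroedinger_solve[OF l f] by blast
    note H = sobolev_H2_I[OF u(1,2) L2_diff[OF L2_V_mult[OF u(1)] f] u(3,4)]
    have "AE x in lborel. T u x = f x"
      using H(2) unfolding ae_eq_def
      by eventually_elim (simp add: T_def schroedinger_def scaleR_conv_of_real algebra_simps)
    with H(1) show ?thesis by (auto simp: ae_eq_def)
  qed
  have 2: "ae_eq u v" if uv: "u \<in> sobolev_H 2" "v \<in> sobolev_H 2" and eq: "ae_eq (T u) (T v)" for u v
  proof -
    obtain u1 where u: "u \<in> L2" "u1 \<in> L2" "wderiv u u1" "wderiv u1 (\<lambda>x. (V x - l) *\<^sub>R u x - T u x)"
      using D[OF uv(1)] by blast
    obtain v1 where v: "v \<in> L2" "v1 \<in> L2" "wderiv v v1" "wderiv v1 (\<lambda>x. (V x - l) *\<^sub>R v x - T v x)"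
      using D[OF uv(2)] by blast
    have fL: "(\<lambda>x. T u x - T v x) \<in> L2" using T uv by (intro L2_diff) auto
    have "wderiv (\<lambda>x. u1 x - v1 x) (\<lambda>x. (V x - l) *\<^sub>R (u x - v x) - (T u x - T v x))"
      using wderiv_diff[OF u(4) v(4)] by (simp add: scaleR_right_diff_distrib algebra_simps)
    from K[OF L2_diff[OF u(1) v(1)] L2_diff[OF u(2) v(2)] fL wderiv_diff[OF u(3) v(3)] this]
    have "L2_norm (\<lambda>x. u x - v x) \<le> K * L2_norm (\<lambda>x. T u x - T v x)" .
    moreover have "L2_norm (\<lambda>x. T u x - T v x) = 0"
    proof -
      have "ae_eq (\<lambda>x. T u x - T v x) (\<lambda>x. 0)" using eq by (simp add: ae_eq_def)
      from L2_cong(2)[OF fL this] show ?thesis by (simp add: L2_norm_def)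
    qed
    ultimately have "L2_norm (\<lambda>x. u x - v x) = 0" using L2_norm_nonneg[of "\<lambda>x. u x - v x"] by simp
    from L2_norm_zero[OF L2_diff[OF u(1) v(1)] this] show ?thesis by (simp add: ae_eq_def)
  qed
  have 3: "L2_norm u \<le> K * L2_norm (T u)" if "u \<in> sobolev_H 2" for u
    using D[OF that] T[OF that] K by blast
  show ?thesis unfolding resolvent_set_def
    using 1 2 3 unfolding T_def by blast
qed

end

section \<open>The minimum of the periodic spectrum\<close>

context even_periodic
begin

lemma bottom_log_deriv_bounded: "\<exists>B\<ge>0. \<forall>x. \<bar>even_sol' bottom x\<bar> \<le> B * even_sol bottom x"
proof -
  have eq: "psi bottom = even_sol bottom" "psi' bottom = even_sol' bottom"
    by (auto simp: psi_def psi'_def kappa_bottom)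
  obtain B where B: "\<And>x. \<bar>log_psi' bottom x\<bar> \<le> B" using log_psi'_bounded[OF order_refl] by blast
  have "\<bar>even_sol' bottom x\<bar> \<le> B * even_sol bottom x" for x
    using B[of x] ground_state_pos[of x] by (simp add: log_psi'_def eq abs_divide divide_le_eq)
  moreover have "B \<ge> 0" using B[of 0] by linarith
  ultimately show ?thesis by blast
qed

text \<open>
  Multiply the ground state \<open>p\<close> by the slowly varying cut-off
  \<open>g = 1 / (1 + (e x)\<^sup>2)\<close>. Then
  \<open>(L - bottom) (p g) = - 2 p' g' - p g''\<close>, and since \<open>|p'| \<le> B p\<close>,
  \<open>|g'| \<le> e g\<close> and \<open>|g''| \<le> 10 e g\<close>, the error is pointwise
  small relative to \<open>p g\<close>; no norm has to be computed.
\<close>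

lemma bottom_approximate_eigenfunction:
  "\<exists>M. \<forall>e>0. e \<le> 1 \<longrightarrow> (\<exists>u\<in>sobolev_H 2. L2_norm u > 0 \<and>
     L2_norm (\<lambda>x. schroedinger V u x - complex_of_real bottom * u x) \<le> M * e * L2_norm u)"
proof -
  define p where "p = even_sol bottom"
  define p' where "p' = even_sol' bottom"
  note p_deriv = ode_solution_D[OF even_sol(1)[of bottom], folded p_def p'_def]
  have p_cont: "continuous_on UNIV p" "continuous_on UNIV p'"
    using solution_cont[OF even_sol(1)[of bottom]] by (auto simp: p_def p'_def)
  have p_pos: "p x > 0" for x by (simp add: p_def ground_state_pos)
  obtain B where B: "B \<ge> 0" "\<And>x. \<bar>p' x\<bar> \<le> B * p x"
    using bottom_log_deriv_bounded unfolding p_def p'_def by blast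
  have "psi bottom (x + d) = psi bottom x" for x by (simp add: psi_shift rho_bottom)
  then have "p (x + d) = p x" for x by (simp add: p_def psi_def kappa_bottom)
  then obtain Bp where Bp: "\<And>x. \<bar>p x\<bar> \<le> Bp" using periodic_bounded[OF p_cont(1)] by blast
  have "\<exists>u\<in>sobolev_H 2. L2_norm u > 0 \<and>
     L2_norm (\<lambda>x. schroedinger V u x - complex_of_real bottom * u x) \<le> (2 * B + 10) * e * L2_norm u"
    if e: "0 < e" "e \<le> 1" for e :: real
  proof -
    define s where "s x = 1 + (e * x)\<^sup>2" for x
    define g where "g x = 1 / s x" for x
    define g' where "g' x = - 2 * e\<^sup>2 * x / (s x)\<^sup>2" for x
    define g'' where "g'' x = (8 * e^4 * x\<^sup>2) / (s x)^3 - 2 * e\<^sup>2 / (s x)\<^sup>2" for x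
    have s1: "s x \<ge> 1" for x by (simp add: s_def)
    have s_pos: "s x > 0" for x using s1[of x] by linarith
    have s_nz: "s x \<noteq> 0" for x using s_pos[of x] by simp
    have s': "(s has_real_derivative 2 * e\<^sup>2 * x) (at x)" for x
      unfolding s_def[abs_def] by (auto intro!: derivative_eq_intros simp: power2_eq_square)
    have s_cont: "continuous_on UNIV s" by (rule DERIV_continuous_on[OF s'])
    have gd: "(g has_real_derivative g' x) (at x)" for x
      unfolding g_def[abs_def] g'_def using s_nz[of x]
      by (auto intro!: derivative_eq_intros s' simp: power2_eq_square)
    have gd': "(g' has_real_derivative g'' x) (at x)" for x
    proof -
      have "((\<lambda>x. - 2 * e\<^sup>2 * x / (s x)\<^sup>2) has_real_derivative
         (- 2 * e\<^sup>2 * (s x)\<^sup>2 - (- 2 * e\<^sup>2 * x) * (2 * s x * (2 * e\<^sup>2 * x))) / ((s x)\<^sup>2 * (s x)\<^sup>2)) (at x)"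
        using s_nz[of x] by (intro DERIV_divide) (auto intro!: derivative_eq_intros s')
      also have "(- 2 * e\<^sup>2 * (s x)\<^sup>2 - (- 2 * e\<^sup>2 * x) * (2 * s x * (2 * e\<^sup>2 * x))) / ((s x)\<^sup>2 * (s x)\<^sup>2) = g'' x"
        using s_nz[of x] by (simp add: g''_def field_simps power2_eq_square power3_eq_cube power4_eq_xxxx)
      finally show ?thesis unfolding g'_def[abs_def] .
    qed
    have gc: "continuous_on UNIV g" "continuous_on UNIV g'" by (rule DERIV_continuous_on[OF gd], rule DERIV_continuous_on[OF gd'])
    have gc'': "continuous_on UNIV g''" unfolding g''_def[abs_def]
      by (intro continuous_intros s_cont) (auto simp: s_nz)
    have g_pos: "g x > 0" for x using s_pos[of x] by (simp add: g_def)
    have ex: "2 * (e * \<bar>x\<bar>) \<le> s x" for x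
      using sum_squares_bound[of 1 "e * \<bar>x\<bar>"] e by (simp add: s_def power_mult_distrib)
    have ex2: "(e * x)\<^sup>2 \<le> s x" for x by (simp add: s_def)
    have g'_le: "\<bar>g' x\<bar> \<le> e * g x" for x
    proof -
      have "\<bar>g' x\<bar> = e * (2 * (e * \<bar>x\<bar>)) / (s x)\<^sup>2"
        using e by (simp add: g'_def abs_mult power2_eq_square)
      also have "\<dots> \<le> e * s x / (s x)\<^sup>2" using ex[of x] e by (intro divide_right_mono mult_left_mono) auto
      also have "\<dots> = e * g x" using s_nz[of x] by (simp add: g_def power2_eq_square)
      finally show ?thesis .
    qed
    have g''_le: "\<bar>g'' x\<bar> \<le> 10 * e * g x" for x
    proof -
      have "\<bar>g'' x\<bar> \<le> \<bar>(8 * e^4 * x\<^sup>2) / (s x)^3\<bar> + \<bar>2 * e\<^sup>2 / (s x)\<^sup>2\<bar>"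
        unfolding g''_def by (rule abs_triangle_ineq4)
      also have "\<dots> = 8 * e\<^sup>2 * (e * x)\<^sup>2 / (s x)^3 + 2 * e\<^sup>2 / (s x)\<^sup>2"
        using s_pos[of x] by (simp add: power_mult_distrib power2_eq_square power4_eq_xxxx abs_mult abs_divide)
      also have "\<dots> \<le> 8 * e\<^sup>2 * s x / (s x)^3 + 2 * e\<^sup>2 / (s x)\<^sup>2"
        using s_pos[of x] ex2[of x] by (intro add_mono divide_right_mono mult_left_mono) auto
      also have "\<dots> = 10 * e\<^sup>2 / (s x)\<^sup>2" using s_nz[of x] by (simp add: power2_eq_square power3_eq_cube)
      also have "\<dots> \<le> 10 * e / s x"
      proof (rule frac_le)
        show "10 * e\<^sup>2 \<le> 10 * e" using e by (simp add: power2_eq_square)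
        show "s x \<le> (s x)\<^sup>2" using s1[of x] by (simp add: power2_eq_square)
      qed (use e s_pos[of x] in auto)
      finally show ?thesis by (simp add: g_def)
    qed
    define U where "U x = p x * g x" for x
    define U' where "U' x = p' x * g x + g' x * p x" for x
    define U'' where "U'' x = (V x - bottom) * p x * g x + 2 * p' x * g' x + p x * g'' x" for x
    have Ud: "(U has_real_derivative U' x) (at x)" for x
      unfolding U_def[abs_def] U'_def by (intro DERIV_mult p_deriv gd)
    have Ud': "(U' has_real_derivative U'' x) (at x)" for x
      unfolding U'_def[abs_def]
      by (rule DERIV_cong[OF DERIV_add[OF DERIV_mult[OF p_deriv(2) gd] DERIV_mult[OF gd' p_deriv(1)]]])
         (simp add: U''_def algebra_simps)
    have Uc: "continuous_on UNIV U" "continuous_on UNIV U'" by (rule DERIV_continuous_on[OF Ud], rule DERIV_continuous_on[OF Ud'])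
    have Uc'': "continuous_on UNIV U''" unfolding U''_def[abs_def]
      by (intro continuous_intros V_cont p_cont gc gc'')
    have U_pos: "U x > 0" for x by (simp add: U_def p_pos g_pos)
    have pg': "\<bar>p' x * g' x\<bar> \<le> B * e * U x" for x
    proof -
      have "\<bar>p' x\<bar> * \<bar>g' x\<bar> \<le> (B * p x) * (e * g x)"
        using B g'_le[of x] p_pos[of x] by (intro mult_mono) auto
      then show ?thesis by (simp add: U_def abs_mult mult_ac)
    qed
    have pg'': "\<bar>p x * g'' x\<bar> \<le> 10 * e * U x" for x
    proof -
      have "p x * \<bar>g'' x\<bar> \<le> p x * (10 * e * g x)"
        using g''_le[of x] p_pos[of x] by (intro mult_left_mono) auto
      then show ?thesis using p_pos[of x] by (simp add: U_def abs_mult mult_ac)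
    qed
    have U'_le: "\<bar>U' x\<bar> \<le> (B + 1) * U x" for x
    proof -
      have "\<bar>p' x * g x\<bar> \<le> B * U x"
        using mult_right_mono[OF B(2)[of x], of "g x"] g_pos[of x] by (simp add: U_def abs_mult mult_ac)
      moreover have "\<bar>g' x * p x\<bar> \<le> U x"
      proof -
        have "\<bar>g' x\<bar> \<le> 1 * g x" using g'_le[of x] e g_pos[of x] mult_right_mono[of e 1 "g x"] by linarith
        then show ?thesis using p_pos[of x] mult_right_mono[of "\<bar>g' x\<bar>" "g x" "p x"] by (simp add: U_def abs_mult mult_ac)
      qed
      ultimately show ?thesis unfolding U'_def by (simp add: distrib_right)
    qed
    define u where "u x = complex_of_real (U x)" for x
    have "integrable lborel (\<lambda>x. inverse (1 + (0 + e * x)\<^sup>2))"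
      by (rule lborel_integrable_real_affine[OF integrable_inverse_square]) (use e in simp)
    then have ig: "integrable lborel g" by (simp add: g_def[abs_def] s_def inverse_eq_divide)
    have uL: "u \<in> L2"
    proof -
      have "integrable lborel (\<lambda>x. (cmod (u x))\<^sup>2)"
      proof (rule Bochner_Integration.integrable_bound)
        show "integrable lborel (\<lambda>x. Bp\<^sup>2 * g x)" using ig by simp
        show "(\<lambda>x. (cmod (u x))\<^sup>2) \<in> borel_measurable lborel"
          using borel_measurable_continuous_onI[OF Uc(1)] by (simp add: u_def)
        show "AE x in lborel. norm ((cmod (u x))\<^sup>2) \<le> norm (Bp\<^sup>2 * g x)"
        proof (rule AE_I2)
          fix x
          have "g x \<le> 1" using s1[of x] by (simp add: g_def)
          then have "(g x)\<^sup>2 \<le> g x" using g_pos[of x] by (simp add: power2_eq_square mult_left_le)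
          moreover have "(p x)\<^sup>2 \<le> Bp\<^sup>2" using Bp[of x] p_pos[of x] by (intro power_mono) auto
          ultimately have "(p x)\<^sup>2 * (g x)\<^sup>2 \<le> Bp\<^sup>2 * g x" by (intro mult_mono) auto
          moreover have "cmod (u x) = p x * g x"
            using U_pos[of x] by (simp only: u_def norm_of_real) (simp add: U_def)
          ultimately show "norm ((cmod (u x))\<^sup>2) \<le> norm (Bp\<^sup>2 * g x)"
            using g_pos[of x] by (simp add: power_mult_distrib abs_mult)
        qed
      qed
      then show ?thesis using borel_measurable_continuous_onI[OF Uc(1)] by (simp add: L2_def u_def[abs_def])
    qed
    have u'L: "(\<lambda>x. complex_of_real (U' x)) \<in> L2"
    proof (rule L2_bound(1)[OF uL])
      show "(\<lambda>x. complex_of_real (U' x)) \<in> borel_measurable borel"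
        using borel_measurable_continuous_onI[OF Uc(2)] by measurable
      have "\<bar>U x\<bar> = U x" for x using U_pos[of x] by simp
      then show "AE x in lborel. cmod (complex_of_real (U' x)) \<le> (B + 1) * cmod (u x)"
        using U'_le by (intro AE_I2) (simp add: u_def)
    qed (use B in simp)
    define f where "f x = complex_of_real (- 2 * p' x * g' x - p x * g'' x)" for x
    have fm: "f \<in> borel_measurable borel" unfolding f_def[abs_def]
      by (intro borel_measurable_continuous_onI continuous_intros p_cont gc gc'')
    have f_le: "cmod (f x) \<le> (2 * B + 10) * e * cmod (u x)" for x
    proof -
      have "\<bar>- 2 * p' x * g' x - p x * g'' x\<bar> \<le> 2 * \<bar>p' x * g' x\<bar> + \<bar>p x * g'' x\<bar>"
        using abs_triangle_ineq4[of "- 2 * p' x * g' x" "p x * g'' x"] by (simp add: abs_mult)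
      also have "\<dots> \<le> (2 * B + 10) * e * U x" using pg'[of x] pg''[of x] by (simp add: algebra_simps)
      finally show ?thesis using U_pos[of x] unfolding f_def u_def norm_of_real by simp
    qed
    have fL: "f \<in> L2" "L2_norm f \<le> (2 * B + 10) * e * L2_norm u"
      using L2_bound[OF uL fm, of "(2 * B + 10) * e"] f_le B(1) e by auto
    have U''_eq: "complex_of_real (U'' x) = (V x - bottom) *\<^sub>R u x - f x" for x
      by (simp add: U''_def u_def f_def U_def scaleR_conv_of_real mult_ac)
    have u''L: "(\<lambda>x. complex_of_real (U'' x)) \<in> L2"
      unfolding U''_eq by (intro L2_diff L2_V_mult uL fL)
    note H = sobolev_H2_I[OF uL u'L u''L wderiv_of_real[OF Ud Uc(2), folded u_def] wderiv_of_real[OF Ud' Uc'']]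
    have "ae_eq f (\<lambda>x. schroedinger V u x - complex_of_real bottom * u x)"
      using H(2) unfolding ae_eq_def U''_eq
      by eventually_elim (simp add: schroedinger_def scaleR_conv_of_real algebra_simps)
    moreover have "(\<lambda>x. schroedinger V u x - complex_of_real bottom * u x) \<in> borel_measurable borel"
    proof -
      obtain v where "weak_deriv 2 u \<in> L2" using sobolev_H2_D[OF H(1)] by metis
      note [measurable] = L2_measurable[OF this] L2_measurable[OF uL] borel_measurable_continuous_onI[OF V_cont]
      show ?thesis unfolding schroedinger_def by measurable
    qed
    ultimately have "L2_norm (\<lambda>x. schroedinger V u x - complex_of_real bottom * u x) = L2_norm f"
      using L2_cong(2)[OF fL(1)] by blast
    moreover have "L2_norm u > 0"
    proof (rule ccontr)
      assume "\<not> L2_norm u > 0"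
      then have "L2_norm u = 0" using L2_norm_nonneg[of u] by linarith
      from L2_norm_zero[OF uL this] have "AE x in lborel. x \<in> ({}::real set)"
        unfolding ae_eq_def by eventually_elim (use U_pos in \<open>auto simp: u_def less_imp_neq[symmetric]\<close>)
      then show False
        using AE_iff_measurable[of UNIV lborel "\<lambda>x. x \<in> ({}::real set)"] by simp
    qed
    ultimately show ?thesis using H(1) fL(2) by (intro bexI[of _ u]) auto
  qed
  then show ?thesis by (intro exI[of _ "2 * B + 10"]) blast
qed

lemma bottom_in_spectrum: "complex_of_real bottom \<in> spectrum (sobolev_H 2) (schroedinger V)"
proof (rule ccontr)
  assume "\<not> ?thesis"
  then have "complex_of_real bottom \<in> resolvent_set (sobolev_H 2) (schroedinger V)"
    by (simp add: spectrum_def)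
  then obtain C where C: "\<And>u. u \<in> sobolev_H 2 \<Longrightarrow>
      L2_norm u \<le> C * L2_norm (\<lambda>x. schroedinger V u x - complex_of_real bottom * u x)"
    unfolding resolvent_set_def by blast
  obtain M where M: "\<And>e. 0 < e \<Longrightarrow> e \<le> 1 \<Longrightarrow> \<exists>u\<in>sobolev_H 2. L2_norm u > 0 \<and>
     L2_norm (\<lambda>x. schroedinger V u x - complex_of_real bottom * u x) \<le> M * e * L2_norm u"
    using bottom_approximate_eigenfunction by blast
  define D where "D = \<bar>C\<bar> * \<bar>M\<bar> + 1"
  \<comment> \<open>Small enough that \<open>C M e < 1\<close>.\<close>
  define e where "e = 1 / (2 * D)"
  have D: "D \<ge> 1" by (simp add: D_def)
  have e: "0 < e" "e \<le> 1" using D by (auto simp: e_def)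
  obtain u where u: "u \<in> sobolev_H 2" "L2_norm u > 0"
    "L2_norm (\<lambda>x. schroedinger V u x - complex_of_real bottom * u x) \<le> M * e * L2_norm u"
    using M[OF e] by blast
  define n where "n = L2_norm (\<lambda>x. schroedinger V u x - complex_of_real bottom * u x)"
  have n: "n \<ge> 0" "n \<le> M * e * L2_norm u" using u(3) by (auto simp: n_def L2_norm_nonneg)
  have "L2_norm u \<le> C * n" using C[OF u(1)] by (simp add: n_def)
  also have "\<dots> \<le> \<bar>C\<bar> * n" using n by (intro mult_right_mono) auto
  also have "\<dots> \<le> \<bar>C\<bar> * (M * e * L2_norm u)" using n by (intro mult_left_mono) auto
  also have "\<dots> \<le> \<bar>C\<bar> * (\<bar>M\<bar> * e * L2_norm u)"
    using e u(2) by (intro mult_left_mono mult_right_mono) auto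
  also have "\<dots> = (\<bar>C\<bar> * \<bar>M\<bar>) * e * L2_norm u" by simp
  also have "\<dots> \<le> D * e * L2_norm u" using e u(2) by (intro mult_right_mono) (auto simp: D_def)
  also have "\<dots> = L2_norm u / 2" using D by (simp add: e_def)
  finally show False using u(2) by simp
qed

theorem spectrum_min_eq: "spectrum_min V = bottom"
  unfolding spectrum_min_def
proof (rule Least_equality, rule bottom_in_spectrum)
  fix y assume "complex_of_real y \<in> spectrum (sobolev_H 2) (schroedinger V)"
  then show "bottom \<le> y" using below_bottom_resolvent[of y] by (force simp: spectrum_def)
qed

end

section \<open>Dislocation eigenvalues and the matching condition\<close>

lemma continuous_ae_eq_imp_eq:
  fixes f g :: "real \<Rightarrow> complex"
  assumes "continuous_on UNIV f" "continuous_on UNIV g" "ae_eq f g"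
  shows "f x = g x"
proof (rule ccontr)
  assume "f x \<noteq> g x"
  define S where "S = {x. f x \<noteq> g x}"
  have "open S" unfolding S_def using assms(1,2) by (intro open_Collect_neq)
  have "S \<in> null_sets lborel"
    using assms(3) \<open>open S\<close> by (simp add: ae_eq_def AE_iff_null_sets S_def)
  then have "negligible S" by (simp add: negligible_iff_null_sets null_sets_completionI)
  with \<open>open S\<close> have "S = {}" using open_not_negligible by blast
  then show False using \<open>f x \<noteq> g x\<close> by (auto simp: S_def)
qed

lemma wderiv_continuous_classical:
  assumes W: "wderiv u u1" and u1: "continuous_on UNIV u1"
  obtains U where "ae_eq u U" "\<And>x. (U has_vector_derivative u1 x) (at x)"
proof -
  obtain A where A: "\<And>x. (A has_vector_derivative u1 x) (at x)" "A (0::real) = 0"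
    using antiderivative_exists[OF u1] by metis
  have Ac: "continuous_on UNIV A"
    by (intro continuous_at_imp_continuous_on ballI has_vector_derivative_continuous[OF A(1)])
  have "wderiv A u1" by (rule wderiv_classical[OF Ac, of "{}"]) (use A W in \<open>auto simp: wderiv_def\<close>)
  from wderiv_diff[OF W this] have "wderiv (\<lambda>x. u x - A x) (\<lambda>x. 0)" by simp
  from wderiv_zero_const[OF this] obtain c where c: "AE x in lborel. u x - A x = c" ..
  show ?thesis
  proof (rule that)
    show "ae_eq u (\<lambda>x. A x + c)" using c unfolding ae_eq_def by eventually_elim (simp add: algebra_simps)
    show "((\<lambda>x. A x + c) has_vector_derivative u1 x) (at x)" for x
      using has_vector_derivative_add[OF A(1) has_vector_derivative_const] by simp
  qed
qed

lemma half_line_constant: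
  fixes w :: "real \<Rightarrow> complex"
  assumes "continuous_on {0..} w" "\<And>x. x > 0 \<Longrightarrow> (w has_vector_derivative 0) (at x)" "x \<ge> 0"
  shows "w x = w 0"
proof -
  have "((\<lambda>_. 0) has_integral (w x - w 0)) {0..x}"
    using assms by (intro fundamental_theorem_of_calculus_interior) (auto intro: continuous_on_subset)
  then have "w x - w 0 = 0" using has_integral_unique has_integral_0 by blast
  then show ?thesis by simp
qed

lemma L2_exp_decay:
  assumes u: "u \<in> borel_measurable borel" "\<And>x. cmod (u x) \<le> C * exp (- (\<alpha> * \<bar>x\<bar>))" and \<alpha>: "\<alpha> > 0"
  shows "u \<in> L2"
proof -
  have C: "C \<ge> 0" using order_trans[OF norm_ge_zero u(2)[of 0]] by simp
  have pt: "ennreal ((cmod (u x))\<^sup>2) \<le> ennreal (C\<^sup>2) *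
     (ennreal (exp ((2 * \<alpha>) * (0 - x))) * indicator {0..} x + ennreal (exp ((2 * \<alpha>) * (x - 0))) * indicator {..0} x)" for x
  proof -
    have "(cmod (u x))\<^sup>2 \<le> (C * exp (- (\<alpha> * \<bar>x\<bar>)))\<^sup>2" by (intro power_mono u(2)) simp
    also have "\<dots> = C\<^sup>2 * exp (- (2 * \<alpha> * \<bar>x\<bar>))" by (simp add: power_mult_distrib flip: exp_double)
    finally have "ennreal ((cmod (u x))\<^sup>2) \<le> ennreal (C\<^sup>2) * ennreal (exp (- (2 * \<alpha> * \<bar>x\<bar>)))"
      by (simp add: ennreal_leI flip: ennreal_mult)
    also have "\<dots> \<le> ennreal (C\<^sup>2) *
     (ennreal (exp ((2 * \<alpha>) * (0 - x))) * indicator {0..} x + ennreal (exp ((2 * \<alpha>) * (x - 0))) * indicator {..0} x)"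
      by (intro mult_left_mono) (auto simp: indicator_def)
    finally show ?thesis .
  qed
  have "(\<integral>\<^sup>+x. ennreal ((cmod (u x))\<^sup>2) \<partial>lborel) \<le> (\<integral>\<^sup>+x. ennreal (C\<^sup>2) *
     (ennreal (exp ((2 * \<alpha>) * (0 - x))) * indicator {0..} x + ennreal (exp ((2 * \<alpha>) * (x - 0))) * indicator {..0} x) \<partial>lborel)"
    by (intro nn_integral_mono pt)
  also have "\<dots> = ennreal (C\<^sup>2) * ((\<integral>\<^sup>+x. ennreal (exp ((2 * \<alpha>) * (0 - x))) * indicator {0..} x \<partial>lborel) +
      (\<integral>\<^sup>+x. ennreal (exp ((2 * \<alpha>) * (x - 0))) * indicator {..0} x \<partial>lborel))"
    by (subst nn_integral_cmult, simp, subst nn_integral_add) auto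
  also have "\<dots> = ennreal (C\<^sup>2) * (ennreal (1 / (2 * \<alpha>)) + ennreal (1 / (2 * \<alpha>)))"
    using \<alpha> by (simp only: nn_integral_exp_right[of "2 * \<alpha>"] nn_integral_exp_left[of "2 * \<alpha>"] mult_pos_pos zero_less_numeral)
  also have "\<dots> < \<infinity>" by (simp add: ennreal_mult_less_top)
  finally have "integrable lborel (\<lambda>x. (cmod (u x))\<^sup>2)"
    using u(1) by (intro integrableI_bounded) auto
  then show ?thesis using u(1) by (simp add: L2_def)
qed

context even_periodic
begin

lemma psi_decay:
  assumes l: "l < bottom"
  shows "\<exists>C\<ge>0. \<forall>x. \<bar>psi l x\<bar> \<le> C * exp (- (decay_rate l * x)) \<and> \<bar>psi' l x\<bar> \<le> C * exp (- (decay_rate l * x))"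
proof -
  have l': "l \<le> bottom" using l by simp
  obtain B where B: "\<And>x. floquet_factor l x \<le> B" using floquet_factor_bounded[OF l'] by blast
  obtain M where M: "\<And>x. \<bar>log_psi' l x\<bar> \<le> M" using log_psi'_bounded[OF l'] by blast
  have B0: "B \<ge> 0" using B[of 0] floquet_factor_pos[OF l', of 0] by linarith
  have M0: "M \<ge> 0" using M[of 0] by linarith
  have 1: "\<bar>psi l x\<bar> \<le> B * exp (- (decay_rate l * x))" for x
    using B[of x] floquet_factor_pos[OF l', of x] by (simp add: psi_eq_floquet abs_mult mult.commute)
  have 2: "\<bar>psi' l x\<bar> \<le> M * \<bar>psi l x\<bar>" for x
    using M[of x] psi_pos[OF l', of x] by (simp add: log_psi'_def abs_divide divide_le_eq)
  have "\<bar>psi l x\<bar> \<le> (max 1 M * B) * exp (- (decay_rate l * x)) \<and> \<bar>psi' l x\<bar> \<le> (max 1 M * B) * exp (- (decay_rate l * x))" for x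
  proof
    have "1 * (B * exp (- (decay_rate l * x))) \<le> max 1 M * (B * exp (- (decay_rate l * x)))"
      using B0 by (intro mult_right_mono) auto
    then show "\<bar>psi l x\<bar> \<le> (max 1 M * B) * exp (- (decay_rate l * x))" using 1[of x] by (simp add: mult.assoc)
    have "M * \<bar>psi l x\<bar> \<le> max 1 M * (B * exp (- (decay_rate l * x)))"
      using 1[of x] M0 by (intro mult_mono) auto
    then show "\<bar>psi' l x\<bar> \<le> (max 1 M * B) * exp (- (decay_rate l * x))" using 2[of x] by (simp add: mult.assoc)
  qed
  moreover have "max 1 M * B \<ge> 0" using B0 by simp
  ultimately show ?thesis by blast
qed

text \<open>
  The Wronskian \<open>w\<close> of \<open>U\<close> and the decaying solution is constant. Were
  it non-zero, \<open>U' - m U = w / psi\<close> would stay away from zero on the half-line,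
  although it is square-integrable. Hence \<open>w = 0\<close> and \<open>U\<close> is a multiple
  of \<open>psi\<close>.
\<close>

lemma half_line_solution:
  fixes U U1 :: "real \<Rightarrow> complex"
  assumes l: "l < bottom"
    and U: "continuous_on UNIV U" "\<And>x. x > 0 \<Longrightarrow> (U has_vector_derivative U1 x) (at x)"
    and U1: "continuous_on UNIV U1"
      "\<And>x. x > 0 \<Longrightarrow> (U1 has_vector_derivative (V (x + t) - l) *\<^sub>R U x) (at x)"
    and L2: "U \<in> L2" "U1 \<in> L2"
  shows "psi l t *\<^sub>R U1 0 = psi' l t *\<^sub>R U 0" and "U 0 = 0 \<Longrightarrow> x \<ge> 0 \<Longrightarrow> U x = 0"
proof -
  have l': "l \<le> bottom" using l by simp
  define q where "q x = psi l (x + t)" for x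
  define q' where "q' x = psi' l (x + t)" for x
  have qd: "(q has_real_derivative q' x) (at x)" "(q' has_real_derivative (V (x + t) - l) * q x) (at x)" for x
    using ode_solution_D[OF ode_solution_shift[OF psi_solution[of l], of t]]
    by (auto simp: q_def[abs_def] q'_def[abs_def])
  have qc: "continuous_on UNIV q" "continuous_on UNIV q'" by (rule DERIV_continuous_on[OF qd(1)], rule DERIV_continuous_on[OF qd(2)])
  have q_pos: "q x > 0" for x by (simp add: q_def psi_pos[OF l'])
  define w where "w x = q x *\<^sub>R U1 x - q' x *\<^sub>R U x" for x
  have w_const: "w x = w 0" if "x \<ge> 0" for x
  proof (rule half_line_constant[OF _ _ that])
    show "continuous_on {0..} w" unfolding w_def[abs_def]
      by (intro continuous_intros continuous_on_subset[OF qc(1)] continuous_on_subset[OF qc(2)]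
          continuous_on_subset[OF U(1)] continuous_on_subset[OF U1(1)]) auto
    fix x :: real assume x: "x > 0"
    have "(w has_vector_derivative (q x *\<^sub>R ((V (x + t) - l) *\<^sub>R U x) + q' x *\<^sub>R U1 x)
        - (q' x *\<^sub>R U1 x + ((V (x + t) - l) * q x) *\<^sub>R U x)) (at x)"
      unfolding w_def[abs_def]
      by (intro has_vector_derivative_diff has_vector_derivative_scaleR qd U(2) U1(2) x)
    then show "(w has_vector_derivative 0) (at x)" by (simp add: mult.commute)
  qed
  have w0: "w 0 = 0"
  proof (rule ccontr)
    assume nz: "w 0 \<noteq> 0"
    obtain C where C: "C \<ge> 0" "\<And>x. \<bar>psi l x\<bar> \<le> C * exp (- (decay_rate l * x))" using psi_decay[OF l] by blast
    obtain M where M: "\<And>x. \<bar>log_psi' l x\<bar> \<le> M" using log_psi'_bounded[OF l'] by blast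
    \<comment> \<open>A positive bound for \<open>psi\<close> on \<open>[t, \<infinity>)\<close>.\<close>
    define D where "D = C * exp (- (decay_rate l * t)) + 1"
    have D: "D > 0" using C by (simp add: D_def add_nonneg_pos)
    have qD: "q x \<le> D" if "x \<ge> 0" for x
    proof -
      have "q x \<le> C * exp (- (decay_rate l * (x + t)))" using C(2)[of "x + t"] by (simp add: q_def)
      also have "\<dots> \<le> C * exp (- (decay_rate l * t))"
        using C(1) that decay_rate_pos[OF l] by (intro mult_left_mono) (auto simp: distrib_left)
      finally show ?thesis by (simp add: D_def)
    qed
    define v where "v x = U1 x - log_psi' l (x + t) *\<^sub>R U x" for x
    have "(\<lambda>x. log_psi' l (x + t) *\<^sub>R U x) \<in> L2"
      using M by (intro L2_scale(1)[OF L2(1), where B = M] borel_measurable_continuous_onI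
          continuous_on_compose2[OF log_psi'_cont[OF l']] continuous_intros) auto
    then have v: "v \<in> L2" unfolding v_def[abs_def] by (intro L2_diff L2)
    have "cmod (w 0) / D \<le> cmod (v x)" if "x \<ge> 0" for x
    proof -
      have "w 0 = q x *\<^sub>R v x"
        using w_const[OF that] q_pos[of x]
        by (simp add: v_def w_def log_psi'_def scaleR_right_diff_distrib flip: q_def q'_def)
      then have "cmod (w 0) = q x * cmod (v x)" using q_pos[of x] by simp
      also have "\<dots> \<le> D * cmod (v x)" using qD[OF that] by (intro mult_right_mono) auto
      finally show ?thesis using D by (simp add: divide_le_eq mult.commute)
    qed
    then show False
      using not_L2_lower_bound[OF v, of "{0..}" "cmod (w 0) / D"] emeasure_lborel_half_line(1)[of 0] nz D
      by (auto intro!: AE_I2)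
  qed
  then show "psi l t *\<^sub>R U1 0 = psi' l t *\<^sub>R U 0" by (simp add: w_def q_def q'_def)
  assume U0: "U 0 = 0" and x: "x \<ge> 0"
  define y where "y x = (1 / q x) *\<^sub>R U x" for x
  have "y x = y 0"
  proof (rule half_line_constant[OF _ _ x])
    show "continuous_on {0..} y" unfolding y_def[abs_def]
      using q_pos by (intro continuous_intros continuous_on_subset[OF qc(1)] continuous_on_subset[OF U(1)])
        (auto simp: less_imp_neq[symmetric])
    fix x :: real assume x: "x > 0"
    have "((\<lambda>x. 1 / q x) has_real_derivative - (q' x / (q x * q x))) (at x)"
      using q_pos[of x] by (auto intro!: derivative_eq_intros qd)
    from has_vector_derivative_scaleR[OF this U(2)[OF x]]
    have "(y has_vector_derivative (1 / q x) *\<^sub>R U1 x + (- (q' x / (q x * q x))) *\<^sub>R U x) (at x)"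
      unfolding y_def[abs_def] .
    also have "(1 / q x) *\<^sub>R U1 x + (- (q' x / (q x * q x))) *\<^sub>R U x = (1 / (q x * q x)) *\<^sub>R w x"
      using q_pos[of x] by (simp add: w_def scaleR_right_diff_distrib)
    finally show "(y has_vector_derivative 0) (at x)" using w_const[of x] x w0 by simp
  qed
  then show "U x = 0" using U0 q_pos[of x] by (simp add: y_def)
qed

lemma dislocated_measurable: "dislocated V t \<in> borel_measurable borel"
proof -
  note [measurable] = borel_measurable_continuous_onI[OF V_cont]
  show ?thesis unfolding dislocated_def by measurable
qed

lemma dislocated_bound: "\<bar>dislocated V t x - l\<bar> \<le> V_bound + \<bar>l\<bar>"
  using q_bound[of x l] q_bound[of "x + t" l] by (simp add: dislocated_def)

text \<open>
  A weak eigenfunction has a representative \<open>U\<close> with continuous derivative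
  \<open>U1\<close>, and \<open>U1\<close> is differentiable off \<open>0\<close>. The half-line
  lemma, applied to \<open>U\<close> on the right and to its reflection on the left, determines
  \<open>U1 0\<close> from \<open>U 0\<close> in two ways. Here \<open>U 0 \<noteq> 0\<close>,
  because otherwise \<open>U\<close> vanishes on both sides.
\<close>

lemma eigenvalue_imp_matching:
  assumes l: "l < bottom" and eig: "complex_of_real l \<in> dislocation_eigenvalues V t"
  shows "matching t l = 0"
proof -
  have l': "l \<le> bottom" using l by simp
  obtain u where u: "u \<in> sobolev_H 2" "\<not> ae_eq u (\<lambda>x. 0)"
    "ae_eq (schroedinger (dislocated V t) u) (\<lambda>x. complex_of_real l * u x)"
    using eig unfolding dislocation_eigenvalues_def eigenvalues_def by blast
  define u2 where "u2 = weak_deriv 2 u"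
  obtain u1 where uL: "u \<in> L2" "u1 \<in> L2" "u2 \<in> L2" and W: "wderiv u u1" "wderiv u1 u2"
    using sobolev_H2_D[OF u(1)] unfolding u2_def by metis
  have u2: "AE x in lborel. u2 x = (dislocated V t x - l) *\<^sub>R u x"
    using u(3) unfolding ae_eq_def
    by eventually_elim (simp add: schroedinger_def u2_def scaleR_conv_of_real algebra_simps)
  have li2: "loc_int u2" using uL by (simp add: loc_int_L2)
  obtain c1 where c1: "AE x in lborel. u1 x = indef_integral u2 x + c1"
    using wderiv_representative[OF W(2)] by blast
  define U1 where "U1 x = indef_integral u2 x + c1" for x
  have U1c: "continuous_on UNIV U1" unfolding U1_def[abs_def]
    by (intro continuous_intros indef_integral_continuous li2)
  have uU1: "ae_eq u1 U1" using c1 by (simp add: ae_eq_def U1_def)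
  have U1L: "U1 \<in> L2" by (rule L2_cong(1)[OF uL(2) uU1 borel_measurable_continuous_onI[OF U1c]])
  have "wderiv u U1"
    by (rule wderiv_cong[OF W(1) _ L2_measurable[OF uL(1)] uU1 L2_measurable[OF U1L]]) (simp add: ae_eq_def)
  from wderiv_continuous_classical[OF this U1c] obtain U where U: "ae_eq u U"
    "\<And>x. (U has_vector_derivative U1 x) (at x)" by blast
  have Uc: "continuous_on UNIV U"
    by (intro continuous_at_imp_continuous_on ballI has_vector_derivative_continuous[OF U(2)])
  have UL: "U \<in> L2" by (rule L2_cong(1)[OF uL(1) U(1) borel_measurable_continuous_onI[OF Uc]])
  \<comment> \<open>The second derivative in terms of the continuous representative.\<close>
  define G where "G x = (dislocated V t x - l) *\<^sub>R U x" for x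
  have Gm: "G \<in> borel_measurable borel"
    unfolding G_def[abs_def] using dislocated_measurable L2_measurable[OF UL] by measurable
  have u2G: "ae_eq u2 G" using u2 U(1) unfolding ae_eq_def by eventually_elim (simp add: G_def)
  have liG: "loc_int G" by (rule loc_int_cong[OF li2 u2G Gm])
  have cV: "continuous_on UNIV (\<lambda>x. V (x + t))"
    by (intro continuous_on_compose2[OF V_cont] continuous_intros) auto
  have "continuous_on UNIV (\<lambda>x. (V x - l) *\<^sub>R U x)" by (intro continuous_intros V_cont Uc)
  from antiderivative_exists[OF this, of 0 0] obtain A where A: "\<And>x. (A has_vector_derivative (V x - l) *\<^sub>R U x) (at x)" "A (0::real) = 0"
    by blast
  have "continuous_on UNIV (\<lambda>x. (V (x + t) - l) *\<^sub>R U x)" by (intro continuous_intros cV Uc)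
  from antiderivative_exists[OF this, of 0 0] obtain A' where A': "\<And>x. (A' has_vector_derivative (V (x + t) - l) *\<^sub>R U x) (at x)" "A' (0::real) = 0"
    by blast
  \<comment> \<open>A continuous primitive of \<open>G\<close>, pieced together at the jump of the potential.\<close>
  define B where "B x = (if x \<le> 0 then A x else A' x)" for x
  have Bd1: "(B has_vector_derivative (V x - l) *\<^sub>R U x) (at x)" if "x < 0" for x
    by (rule has_vector_derivative_transform_within_open[OF A(1), of "{..<0}"]) (use that in \<open>auto simp: B_def\<close>)
  have Bd2: "(B has_vector_derivative (V (x + t) - l) *\<^sub>R U x) (at x)" if "x > 0" for x
    by (rule has_vector_derivative_transform_within_open[OF A'(1), of "{0<..}"]) (use that in \<open>auto simp: B_def\<close>)
  have Bc: "continuous_on UNIV B"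
  proof -
    have "continuous_on ({..0} \<union> {0..}) (\<lambda>x. if x \<le> 0 then A x else A' x)"
      by (intro continuous_on_cases continuous_at_imp_continuous_on ballI has_vector_derivative_continuous[OF A(1)]
          has_vector_derivative_continuous[OF A'(1)]) (auto simp: A(2) A'(2))
    moreover have "{..0} \<union> {0::real..} = UNIV" by auto
    ultimately show ?thesis by (simp add: B_def[abs_def])
  qed
  have "wderiv B G"
  proof (rule wderiv_classical[OF Bc, of "{0}"])
    show "(B has_vector_derivative G x) (at x)" if "x \<notin> {0}" for x
      using Bd1[of x] Bd2[of x] that by (cases "x < 0") (auto simp: G_def dislocated_def)
  qed (use liG in auto)
  moreover have "wderiv U1 G"
    by (rule wderiv_cong[OF W(2) uU1 L2_measurable[OF U1L] u2G Gm])
  ultimately have "wderiv (\<lambda>x. U1 x - B x) (\<lambda>x. 0)" using wderiv_diff[of U1 G B G] by simp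
  from wderiv_zero_const[OF this] obtain c where "AE x in lborel. U1 x - B x = c" ..
  then have "ae_eq U1 (\<lambda>x. B x + c)" unfolding ae_eq_def by eventually_elim (simp add: algebra_simps)
  then have U1B: "U1 = (\<lambda>x. B x + c)"
    using U1c Bc by (intro ext continuous_ae_eq_imp_eq continuous_intros)
  have U1d1: "(U1 has_vector_derivative (V x - l) *\<^sub>R U x) (at x)" if "x < 0" for x
    unfolding U1B using has_vector_derivative_add[OF Bd1[OF that] has_vector_derivative_const] by simp
  have U1d2: "(U1 has_vector_derivative (V (x + t) - l) *\<^sub>R U x) (at x)" if "x > 0" for x
    unfolding U1B using has_vector_derivative_add[OF Bd2[OF that] has_vector_derivative_const] by simp
  note right = half_line_solution[OF l Uc U(2) U1c U1d2 UL U1L]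
  have Rc: "continuous_on UNIV (\<lambda>x. U (- x))" "continuous_on UNIV (\<lambda>x. - U1 (- x))"
    by (auto intro!: continuous_intros continuous_on_compose2[OF Uc] continuous_on_compose2[OF U1c])
  have mirror: "((\<lambda>x. f (- x)) has_vector_derivative - D) (at x)"
    if "(f has_vector_derivative D) (at (- x))" for f :: "real \<Rightarrow> complex" and D x
  proof -
    have "((\<lambda>x::real. - x) has_real_derivative - 1) (at x)" by (auto intro!: derivative_eq_intros)
    then have "((\<lambda>x::real. - x) has_vector_derivative - 1) (at x)"
      by (simp add: has_real_derivative_iff_has_vector_derivative)
    from vector_diff_chain_at[OF this that] show ?thesis by (simp add: o_def)
  qed
  have Rd: "((\<lambda>x. U (- x)) has_vector_derivative - U1 (- x)) (at x)" for x
    by (rule mirror[OF U(2)])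
  have Rd1: "((\<lambda>x. - U1 (- x)) has_vector_derivative (V (x + 0) - l) *\<^sub>R U (- x)) (at x)" if "x > 0" for x
  proof -
    have "- x < 0" using that by simp
    from has_vector_derivative_minus[OF mirror[OF U1d1[OF this]]] show ?thesis by (simp add: V_even)
  qed
  have RL: "(\<lambda>x. U (- x)) \<in> L2" "(\<lambda>x. - U1 (- x)) \<in> L2"
    using L2_reflect(1)[OF UL] L2_cmult[OF L2_reflect(1)[OF U1L], of "-1"] by simp_all
  note left = half_line_solution[OF l Rc(1) Rd Rc(2) Rd1 RL]
  have "U 0 \<noteq> 0"
  proof
    assume U0: "U 0 = 0"
    have "U x = 0" for x
      using right(2)[of x] left(2)[of "- x"] U0 by (cases "x \<ge> 0") auto
    then have "ae_eq u (\<lambda>x. 0)" using U(1) by (simp add: ae_eq_def)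
    then show False using u(2) by simp
  qed
  have "U1 0 = kappa l *\<^sub>R U 0" using left(1) by (simp add: psi_0)
  with right(1) have "(psi' l t - kappa l * psi l t) *\<^sub>R U 0 = 0"
    by (auto simp: scaleR_left_diff_distrib mult.commute)
  then show ?thesis using \<open>U 0 \<noteq> 0\<close> by (simp add: matching_def)
qed

text \<open>
  The eigenfunction is glued from the two decaying solutions; the factor \<open>psi l t\<close>
  on the left makes it continuous at \<open>0\<close>, and the matching condition makes its
  derivative continuous there.
\<close>

lemma matching_imp_eigenvalue:
  assumes l: "l < bottom" and m: "matching t l = 0"
  shows "complex_of_real l \<in> dislocation_eigenvalues V t"
proof -
  have l': "l \<le> bottom" using l by simp
  define r where "r x = (if x \<le> 0 then psi l t * psi l (- x) else psi l (x + t))" for x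
  define r' where "r' x = (if x \<le> 0 then - psi l t * psi' l (- x) else psi' l (x + t))" for x
  define r'' where "r'' x = (dislocated V t x - l) * r x" for x
  have r_pos: "r x > 0" for x by (simp add: r_def psi_pos[OF l'])
  have m': "psi' l t = kappa l * psi l t" using m by (simp add: matching_def)
  have cL: "continuous_on A (\<lambda>x. psi l (- x))" "continuous_on A (\<lambda>x. psi' l (- x))"
     "continuous_on A (\<lambda>x. psi l (x + t))" "continuous_on A (\<lambda>x. psi' l (x + t))" for A
    by (rule continuous_on_compose2[OF psi_cont(1)[of UNIV l]] continuous_on_compose2[OF psi_cont(2)[of UNIV l]],
        intro continuous_intros, simp)+
  have split: "{..0} \<union> {0::real..} = UNIV" by auto
  have rc: "continuous_on UNIV r"
  proof -
    have "continuous_on ({..0} \<union> {0..}) (\<lambda>x. if x \<le> 0 then psi l t * psi l (- x) else psi l (x + t))"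
      by (intro continuous_on_cases continuous_on_mult continuous_on_const cL) (auto simp: psi_0)
    then show ?thesis by (simp add: r_def[abs_def] split)
  qed
  have rc': "continuous_on UNIV r'"
  proof -
    have "continuous_on ({..0} \<union> {0..}) (\<lambda>x. if x \<le> 0 then - psi l t * psi' l (- x) else psi' l (x + t))"
      by (intro continuous_on_cases continuous_on_mult continuous_on_const cL) (auto simp: psi_0 m')
    then show ?thesis by (simp add: r'_def[abs_def] split)
  qed
  note refl = ode_solution_D[OF ode_solution_reflect[OF psi_solution[of l]]]
  note shift = ode_solution_D[OF ode_solution_shift[OF psi_solution[of l], of t]]
  have rd: "(r has_real_derivative r' x) (at x)" if "x \<noteq> 0" for x
  proof (cases "x < 0")
    case True
    have "((\<lambda>x. psi l t * psi l (- x)) has_real_derivative psi l t * (- psi' l (- x))) (at x)"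
      by (rule DERIV_cmult[OF refl(1)])
    then have "((\<lambda>x. psi l t * psi l (- x)) has_real_derivative r' x) (at x)" using True by (simp add: r'_def)
    then show ?thesis
      by (rule has_field_derivative_transform_within_open[of _ _ _ "{..<0}"]) (use True in \<open>auto simp: r_def\<close>)
  next
    case False
    then have x: "x > 0" using that by simp
    have "((\<lambda>x. psi l (x + t)) has_real_derivative r' x) (at x)" using shift(1)[of x] x by (simp add: r'_def)
    then show ?thesis
      by (rule has_field_derivative_transform_within_open[of _ _ _ "{0<..}"]) (use x in \<open>auto simp: r_def\<close>)
  qed
  have rd': "(r' has_real_derivative r'' x) (at x)" if "x \<noteq> 0" for x
  proof (cases "x < 0")
    case True
    have "((\<lambda>x. psi l t * - psi' l (- x)) has_real_derivative psi l t * ((V (- x) - l) * psi l (- x))) (at x)"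
      by (rule DERIV_cmult[OF refl(2)])
    then have "((\<lambda>x. - psi l t * psi' l (- x)) has_real_derivative r'' x) (at x)"
      using True by (simp add: r''_def r_def dislocated_def V_even mult_ac)
    then show ?thesis
      by (rule has_field_derivative_transform_within_open[of _ _ _ "{..<0}"]) (use True in \<open>auto simp: r'_def\<close>)
  next
    case False
    then have x: "x > 0" using that by simp
    have "((\<lambda>x. psi' l (x + t)) has_real_derivative r'' x) (at x)"
      using shift(2)[of x] x by (simp add: r''_def r_def dislocated_def)
    then show ?thesis
      by (rule has_field_derivative_transform_within_open[of _ _ _ "{0<..}"]) (use x in \<open>auto simp: r'_def\<close>)
  qed
  define u where "u x = complex_of_real (r x)" for x
  define u1 where "u1 x = complex_of_real (r' x)" for x
  define u2 where "u2 x = (dislocated V t x - l) *\<^sub>R u x" for x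
  obtain C where C: "C \<ge> 0" "\<And>x. \<bar>psi l x\<bar> \<le> C * exp (- (decay_rate l * x))"
     "\<And>x. \<bar>psi' l x\<bar> \<le> C * exp (- (decay_rate l * x))" using psi_decay[OF l] by blast
  define a where "a = decay_rate l"
  define C' where "C' = C * max (psi l t) (exp (- (a * t)))"
  have left_bound: "psi l t * (C * exp (- (a * (- x)))) \<le> C' * exp (- (a * \<bar>x\<bar>))" if "x \<le> 0" for x
  proof -
    have "psi l t * (C * exp (- (a * (- x)))) \<le> max (psi l t) (exp (- (a * t))) * (C * exp (- (a * (- x))))"
      using C(1) by (intro mult_right_mono) auto
    then show ?thesis using that by (simp add: C'_def mult_ac)
  qed
  have right_bound: "C * exp (- (a * (x + t))) \<le> C' * exp (- (a * \<bar>x\<bar>))" if "x > 0" for x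
  proof -
    have "exp (- (a * t)) * (C * exp (- (a * x))) \<le> max (psi l t) (exp (- (a * t))) * (C * exp (- (a * x)))"
      using C(1) by (intro mult_right_mono) auto
    also have "exp (- (a * t)) * (C * exp (- (a * x))) = C * exp (- (a * (x + t)))"
      by (simp add: distrib_left exp_diff exp_minus field_simps exp_add)
    finally show ?thesis using that by (simp add: C'_def mult_ac)
  qed
  have bounds: "\<bar>r x\<bar> \<le> C' * exp (- (a * \<bar>x\<bar>)) \<and> \<bar>r' x\<bar> \<le> C' * exp (- (a * \<bar>x\<bar>))" for x
  proof (cases "x \<le> 0")
    case True
    have p: "psi l t > 0" by (rule psi_pos[OF l'])
    have "\<bar>r x\<bar> \<le> psi l t * (C * exp (- (a * (- x))))" "\<bar>r' x\<bar> \<le> psi l t * (C * exp (- (a * (- x))))"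
      using True p mult_left_mono[OF C(2)[of "- x"], of "psi l t"] mult_left_mono[OF C(3)[of "- x"], of "psi l t"]
      by (simp_all add: r_def r'_def abs_mult a_def)
    then show ?thesis using left_bound[OF True] by linarith
  next
    case False
    then have "\<bar>r x\<bar> \<le> C * exp (- (a * (x + t)))" "\<bar>r' x\<bar> \<le> C * exp (- (a * (x + t)))"
      using C(2)[of "x + t"] C(3)[of "x + t"] by (simp_all add: r_def r'_def a_def)
    then show ?thesis using right_bound[of x] False by linarith
  qed
  have a: "a > 0" using decay_rate_pos[OF l] by (simp add: a_def)
  have uL: "u \<in> L2" unfolding u_def[abs_def]
    by (rule L2_exp_decay[OF _ _ a, where C = C'])
       (use bounds in \<open>auto intro!: borel_measurable_continuous_onI continuous_intros rc\<close>)
  have u1L: "u1 \<in> L2" unfolding u1_def[abs_def]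
    by (rule L2_exp_decay[OF _ _ a, where C = C'])
       (use bounds in \<open>auto intro!: borel_measurable_continuous_onI continuous_intros rc'\<close>)
  have u2L: "u2 \<in> L2" unfolding u2_def[abs_def]
    by (rule L2_scale(1)[OF uL _ dislocated_bound]) (use dislocated_measurable[of t] in measurable)
  have W: "wderiv u u1"
    unfolding u_def[abs_def] u1_def[abs_def]
  proof (rule wderiv_classical[where S = "{0}"])
    show "loc_int (\<lambda>x. complex_of_real (r' x))" using loc_int_L2[OF u1L] by (simp add: u1_def[abs_def])
  qed (auto intro!: continuous_intros rc has_vector_derivative_of_real rd simp flip: has_real_derivative_iff_has_vector_derivative)
  have u2_eq: "u2 = (\<lambda>x. complex_of_real (r'' x))" by (auto simp: u2_def u_def r''_def scaleR_conv_of_real)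
  have W1: "wderiv u1 u2"
    unfolding u2_eq u1_def[abs_def]
  proof (rule wderiv_classical[where S = "{0}"])
    show "loc_int (\<lambda>x. complex_of_real (r'' x))" using loc_int_L2[OF u2L] by (simp add: u2_eq)
  qed (auto intro!: continuous_intros rc' has_vector_derivative_of_real rd' simp flip: has_real_derivative_iff_has_vector_derivative)
  note H = sobolev_H2_I[OF uL u1L u2L W W1]
  have "\<not> ae_eq u (\<lambda>x. 0)"
  proof
    assume "ae_eq u (\<lambda>x. 0)"
    then have "u 0 = 0"
      by (intro continuous_ae_eq_imp_eq[of u "\<lambda>x. 0"]) (auto simp: u_def[abs_def] intro!: continuous_intros rc)
    then show False using r_pos[of 0] by (simp add: u_def)
  qed
  moreover have "ae_eq (schroedinger (dislocated V t) u) (\<lambda>x. complex_of_real l * u x)"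
    using H(2) unfolding ae_eq_def
    by eventually_elim (simp add: schroedinger_def u2_def scaleR_conv_of_real algebra_simps)
  ultimately show ?thesis using H(1) unfolding dislocation_eigenvalues_def eigenvalues_def by blast
qed

end

section \<open>Eigenvalues in the semi-infinite gap\<close>

context even_periodic
begin

lemma dislocation_eigenvalues_in_gap:
  "dislocation_eigenvalues V t \<inter> semi_infinite_gap V
    = complex_of_real ` {l. l < bottom \<and> matching t l = 0}"
proof -
  have "complex_of_real l \<in> dislocation_eigenvalues V t \<longleftrightarrow> matching t l = 0" if "l < bottom" for l
    using that eigenvalue_imp_matching matching_imp_eigenvalue by blast
  then show ?thesis unfolding semi_infinite_gap_def spectrum_min_eq by blast
qed

lemma no_eigenvalue_in_gap:
  assumes "even_sol' bottom t \<le> 0"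
  shows "dislocation_eigenvalues V t \<inter> semi_infinite_gap V = {}"
  using matching_zero_none[OF assms] by (auto simp: dislocation_eigenvalues_in_gap)

lemma unique_eigenvalue_in_gap:
  assumes "even_sol' bottom t > 0"
  shows "\<exists>!z. z \<in> dislocation_eigenvalues V t \<inter> semi_infinite_gap V"
proof -
  obtain l where l: "l < bottom" "matching t l = 0"
    "\<And>\<mu>. \<mu> < bottom \<Longrightarrow> matching t \<mu> = 0 \<Longrightarrow> \<mu> = l"
    using matching_zero_exists[OF assms] by blast
  then have "{l. l < bottom \<and> matching t l = 0} = {l}" by blast
  then show ?thesis by (simp add: dislocation_eigenvalues_in_gap)
qed

lemma ground_state_critical:
  "even_sol' bottom 0 = 0" "even_sol' bottom (d / 2) = 0" "even_sol' bottom d = 0"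
  using ground_state_reflect[of 0] by (simp_all add: even_sol bottom_neumann)

end

theorem theorem3p15:
  fixes d :: real and V\<^sub>0 :: "real \<Rightarrow> real"
  assumes "d > 0"
    and "continuous_on UNIV V\<^sub>0"
    and "\<And>x. V\<^sub>0 (- x) = V\<^sub>0 x"
    and "\<And>x. V\<^sub>0 (x + d) = V\<^sub>0 x"
  shows
    "(strict_mono_on {0..d/2} V\<^sub>0 \<longrightarrow>
        (\<forall>t\<in>{0..d/2}. dislocation_eigenvalues V\<^sub>0 t \<inter> semi_infinite_gap V\<^sub>0 = {}) \<and>
        (\<forall>t\<in>{d/2<..<d}. \<exists>!z. z \<in> dislocation_eigenvalues V\<^sub>0 t \<inter> semi_infinite_gap V\<^sub>0)) \<and>
     (strict_antimono_on {0..d/2} V\<^sub>0 \<longrightarrow>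
        (\<forall>t\<in>{0<..<d/2}. \<exists>!z. z \<in> dislocation_eigenvalues V\<^sub>0 t \<inter> semi_infinite_gap V\<^sub>0) \<and>
        (\<forall>t\<in>{d/2..d}. dislocation_eigenvalues V\<^sub>0 t \<inter> semi_infinite_gap V\<^sub>0 = {}))"
proof -
  interpret even_periodic d "V\<^sub>0" by (rule even_periodic.intro) (fact assms)+
  note crit = ground_state_critical
  have reflect: "even_sol' bottom t = - even_sol' bottom (d - t)" for t
    using ground_state_reflect[of t] by simp
  show ?thesis
  proof (intro conjI impI ballI)
    fix t assume inc: "strict_mono_on {0..d/2} V\<^sub>0" and t: "t \<in> {0..d/2}"
    have "even_sol' bottom t \<le> 0"
      using ground_state_deriv_neg[OF inc, of t] t crit by (cases "t = 0 \<or> t = d/2") auto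
    then show "dislocation_eigenvalues V\<^sub>0 t \<inter> semi_infinite_gap V\<^sub>0 = {}"
      by (rule no_eigenvalue_in_gap)
  next
    fix t assume inc: "strict_mono_on {0..d/2} V\<^sub>0" and t: "t \<in> {d/2<..<d}"
    have "even_sol' bottom t > 0"
      using ground_state_deriv_neg[OF inc, of "d - t"] t reflect[of t] by auto
    then show "\<exists>!z. z \<in> dislocation_eigenvalues V\<^sub>0 t \<inter> semi_infinite_gap V\<^sub>0"
      by (rule unique_eigenvalue_in_gap)
  next
    fix t assume dec: "strict_antimono_on {0..d/2} V\<^sub>0" and t: "t \<in> {0<..<d/2}"
    have "even_sol' bottom t > 0"
      using ground_state_deriv_pos[OF dec, of t] t by auto
    then show "\<exists>!z. z \<in> dislocation_eigenvalues V\<^sub>0 t \<inter> semi_infinite_gap V\<^sub>0"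
      by (rule unique_eigenvalue_in_gap)
  next
    fix t assume dec: "strict_antimono_on {0..d/2} V\<^sub>0" and t: "t \<in> {d/2..d}"
    have "even_sol' bottom t \<le> 0"
    proof (cases "t = d/2 \<or> t = d")
      case False
      then have "even_sol' bottom (d - t) > 0" using t by (intro ground_state_deriv_pos[OF dec]) auto
      then show ?thesis using reflect[of t] by simp
    qed (use crit in auto)
    then show "dislocation_eigenvalues V\<^sub>0 t \<inter> semi_infinite_gap V\<^sub>0 = {}"
      by (rule no_eigenvalue_in_gap)
  qed
qed

end
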